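(* Let $u_\infty$ be a limit solution in $B_1$ and let $x_0\in\partial\{u_\infty>0\}\cap B_{\frac12}$ be a free boundary point. Then for any $0<\rho<\frac12$, $$\mathcal L^N\left(B_\rho(x_0)\cap\{u_\infty>0\}\right)\ \ge\ \theta\,\rho^N,$$ for a constant $\theta>0$ that depends only on the dimension $N$ and on $\ell$.
   Context: $\mathcal L^N$ is Lebesgue measure in $\mathbb R^N$ and $B_1\subset\mathbb R^N$ the unit ball centered at $0$. Limit solution in a regular bounded domain $\Omega$ (here $\Omega=B_1$): let $\lambda_0$ be a bounded function on $\Omega$ with $0<\inf_\Omega\lambda_0\le\sup_\Omega\lambda_0<\infty$, let $0\le g\in\mathrm{Lip}(\partial\Omega)$, and for $p\ge2$ let $0\le q(p)<p-1$ be such that $\ell:=\lim_{p\to\infty}q(p)/p\in[0,1)$ exists. Let $u_p$ be the nonnegative weak solution of $-\mathrm{div}(|\nabla u_p|^{p-2}\nabla u_p)+\lambda_0(u_p)_+^{q(p)}=0$ in $\Omega$, $u_p=g$ on $\partial\Omega$ (weak solution: $u_p\in W^{1,p}_{\rm loc}(\Omega)$ with $\int_\Omega|\nabla u_p|^{p-2}\nabla u_p\cdot\nabla\varphi\,dx=-\int_\Omega\lambda_0(u_p)_+^{q(p)}\varphi\,dx$ for all $0\le\varphi\in C^1_0(\Omega)$; $s_+=\max\{s,0\}$, and $s_+^0$ means $1$ if $s>0$ and $0$ otherwise). A limit solution is a function $u_\infty$ such that $u_{p_j}\to u_\infty$ uniformly in $\overline\Omega$ for some sequence $p_j\to\infty$.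 *)

theory Defs
  imports "HOL-Analysis.Analysis"
begin

text \<open>
  Functions of class \<open>C\<^sup>1\<close> with compact support in \<open>\<Omega>\<close>, extended by zero to the whole
  space, together with their gradient field \<open>D\<phi>\<close>.
\<close>

definition C1_0 :: "'a::euclidean_space set \<Rightarrow> ('a \<Rightarrow> real) \<Rightarrow> ('a \<Rightarrow> 'a) \<Rightarrow> bool" where
  "C1_0 \<Omega> \<phi> D\<phi> \<longleftrightarrow>
     (\<forall>x. GDERIV \<phi> x :> D\<phi> x) \<and> continuous_on UNIV D\<phi> \<and>
     compact (closure {x. \<phi> x \<noteq> 0}) \<and> closure {x. \<phi> x \<noteq> 0} \<subseteq> \<Omega>"

definition locally_integrable_on ::
    "'a::euclidean_space set \<Rightarrow> ('a \<Rightarrow> 'b::euclidean_space) \<Rightarrow> bool" where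
  "locally_integrable_on \<Omega> f \<longleftrightarrow>
     (\<forall>K. compact K \<and> K \<subseteq> \<Omega> \<longrightarrow> set_integrable lebesgue K f)"

definition weak_gradient_on ::
    "'a::euclidean_space set \<Rightarrow> ('a \<Rightarrow> real) \<Rightarrow> ('a \<Rightarrow> 'a) \<Rightarrow> bool" where
  "weak_gradient_on \<Omega> u G \<longleftrightarrow>
     locally_integrable_on \<Omega> u \<and> locally_integrable_on \<Omega> G \<and>
     (\<forall>\<phi> D\<phi>. C1_0 \<Omega> \<phi> D\<phi> \<longrightarrow>
        (LINT x:\<Omega>|lebesgue. u x *\<^sub>R D\<phi> x) = - (LINT x:\<Omega>|lebesgue. \<phi> x *\<^sub>R G x))"

text \<open>\<open>u\<close> belongs to \<open>W\<^sup>1\<^sup>,\<^sup>p\<close> locally in \<open>\<Omega>\<close>, with weak gradient \<open>G\<close>.\<close>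

definition W1p_loc ::
    "'a::euclidean_space set \<Rightarrow> real \<Rightarrow> ('a \<Rightarrow> real) \<Rightarrow> ('a \<Rightarrow> 'a) \<Rightarrow> bool" where
  "W1p_loc \<Omega> p u G \<longleftrightarrow>
     weak_gradient_on \<Omega> u G \<and>
     locally_integrable_on \<Omega> (\<lambda>x. \<bar>u x\<bar> powr p) \<and>
     locally_integrable_on \<Omega> (\<lambda>x. norm (G x) powr p)"

text \<open>
  Since \<open>0 powr a = 0\<close> for every \<open>a\<close>, the term \<open>max (u x) 0 powr q\<close> vanishes where
  \<open>u \<le> 0\<close> also when \<open>q = 0\<close>, where it is the indicator of \<open>{u > 0}\<close>.
\<close>

definition weak_solution ::
    "'a::euclidean_space set \<Rightarrow> real \<Rightarrow> real \<Rightarrow> ('a \<Rightarrow> real) \<Rightarrow> ('a \<Rightarrow> real) \<Rightarrow> bool" where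
  "weak_solution \<Omega> p q lam0 u \<longleftrightarrow>
     (\<exists>G. W1p_loc \<Omega> p u G \<and>
       (\<forall>\<phi> D\<phi>. C1_0 \<Omega> \<phi> D\<phi> \<and> (\<forall>x. 0 \<le> \<phi> x) \<longrightarrow>
          (LINT x:\<Omega>|lebesgue. (norm (G x) powr (p - 2) *\<^sub>R G x) \<bullet> D\<phi> x) =
          - (LINT x:\<Omega>|lebesgue. lam0 x * max (u x) 0 powr q * \<phi> x)))"

text \<open>
  The boundary condition is pointwise, for \<open>u\<close> continuous up to the boundary; values of
  \<open>u\<close> outside \<open>closure \<Omega>\<close> are irrelevant.
\<close>

definition dirichlet_solution ::
    "'a::euclidean_space set \<Rightarrow> real \<Rightarrow> real \<Rightarrow> ('a \<Rightarrow> real) \<Rightarrow> ('a \<Rightarrow> real) \<Rightarrow> ('a \<Rightarrow> real) \<Rightarrow> bool"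
  where
  "dirichlet_solution \<Omega> p q lam0 g u \<longleftrightarrow>
     weak_solution \<Omega> p q lam0 u \<and> continuous_on (closure \<Omega>) u \<and>
     (\<forall>x\<in>closure \<Omega>. 0 \<le> u x) \<and> (\<forall>x\<in>frontier \<Omega>. u x = g x)"

definition admissible_data ::
    "'a::euclidean_space set \<Rightarrow> real \<Rightarrow> ('a \<Rightarrow> real) \<Rightarrow> ('a \<Rightarrow> real) \<Rightarrow> (real \<Rightarrow> real) \<Rightarrow> bool" where
  "admissible_data \<Omega> ell lam0 g q \<longleftrightarrow>
     lam0 \<in> borel_measurable (lebesgue_on \<Omega>) \<and> bounded (lam0 ` \<Omega>) \<and> 0 < (INF x\<in>\<Omega>. lam0 x) \<and>
     (\<forall>x\<in>frontier \<Omega>. 0 \<le> g x) \<and> (\<exists>L. L-lipschitz_on (frontier \<Omega>) g) \<and>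
     (\<forall>p\<ge>2. 0 \<le> q p \<and> q p < p - 1) \<and>
     ((\<lambda>p. q p / p) \<longlongrightarrow> ell) at_top"

definition limit_solution ::
    "'a::euclidean_space set \<Rightarrow> ('a \<Rightarrow> real) \<Rightarrow> ('a \<Rightarrow> real) \<Rightarrow> (real \<Rightarrow> real) \<Rightarrow> ('a \<Rightarrow> real) \<Rightarrow> bool"
  where
  "limit_solution \<Omega> lam0 g q u_inf \<longleftrightarrow>
     (\<exists>u :: real \<Rightarrow> 'a \<Rightarrow> real. (\<forall>p\<ge>2. dirichlet_solution \<Omega> p (q p) lam0 g (u p)) \<and>
       (\<exists>P :: nat \<Rightarrow> real. (\<forall>j. 2 \<le> P j) \<and> filterlim P at_top sequentially \<and>
          uniform_limit (closure \<Omega>) (\<lambda>j. u (P j)) u_inf sequentially))"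

text \<open>Positivity is only considered in \<open>\<Omega>\<close>, where \<open>v\<close> is meaningful.\<close>

definition positivity_set :: "'a set \<Rightarrow> ('a \<Rightarrow> real) \<Rightarrow> 'a set" where
  "positivity_set \<Omega> v = {x \<in> \<Omega>. 0 < v x}"

end

theory Submission
  imports Defs "HOL-Real_Asymp.Real_Asymp"
begin

text \<open>
  Write \<open>v\<close> for the limit solution. The density estimate follows from two properties of \<open>v\<close>, both
  with constants that depend on \<open>ell\<close> only.

  \<^item> Nondegeneracy (\<open>limit_solution_nondegenerate\<close>): if \<open>v y > 0\<close>, then in the ball of radius \<open>r\<close>
    around \<open>y\<close> the function \<open>v\<close> reaches a height comparable to \<open>r\<close> to the power \<open>1 / (1 - ell)\<close>.
  \<^item> Positivity around large values (\<open>limit_solution_positive_near\<close>): if \<open>v y > M\<close>, then \<open>v\<close> is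
    positive in the ball around \<open>y\<close> of radius \<open>M powr (1 - ell) / 2\<close>.

  Near a free boundary point \<open>x0\<close> there is a point of positivity; nondegeneracy at scale \<open>\<rho> / 4\<close> gives
  a point \<open>y\<close> in the ball of radius \<open>\<rho> / 2\<close> around \<open>x0\<close> where \<open>v\<close> has the order of \<open>\<rho>\<close> to the power
  \<open>1 / (1 - ell)\<close>; the second property then yields a ball around \<open>y\<close> whose radius is a fixed
  multiple of \<open>\<rho>\<close> and in which \<open>v > 0\<close>.

  Both properties are obtained by comparing the solutions for finite \<open>p\<close> with explicit radial
  barriers and letting \<open>p\<close> tend to infinity. The \<open>p\<close>-Laplacian of a smooth \<open>\<Phi>\<close> is of the order
  \<open>p\<close> times the power \<open>p - 2\<close> of the slope of \<open>\<Phi>\<close>, while the absorption term is of the order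
  \<open>\<Phi> powr q p\<close>. After a \<open>p\<close>-th root the first becomes the slope of \<open>\<Phi>\<close> and the second
  \<open>\<Phi> powr ell\<close>. So a function with slope strictly below \<open>\<Phi> powr ell\<close> is a strict supersolution for
  large \<open>p\<close>, and a function with slope strictly above \<open>\<Phi> powr ell\<close> is a strict subsolution if it is
  convex along rays. The bounds of \<open>lam0\<close> and the dimension only enter through factors whose
  \<open>p\<close>-th root tends to \<open>1\<close>, which is why they do not influence the constants of the two properties.

  The comparison with a barrier \<open>\<Phi>\<close> wants the test function given by the squared positive part of
  \<open>u - \<Phi> - \<delta>\<close>, which need not be of class \<open>C1\<close>. It is replaced by the same expression for a
  mollification \<open>w\<close> of \<open>u\<close>. Since \<open>w\<close> is uniformly close to \<open>u\<close>, and the gradient of \<open>w\<close> is close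
  to the weak gradient of \<open>u\<close> in a suitable weighted norm (\<open>smooth_approximation\<close>), monotonicity of
  the flux gives the comparison principle in the limit (\<open>weak_comparison\<close>).
\<close>

section \<open>Mollifiers\<close>

text \<open>
  The squared positive part is the simplest function of class \<open>C1\<close> that vanishes on a half line and is
  positive on the other one. It serves as the profile of the mollifier and as the truncation in the
  test function of the comparison principle.
\<close>

lemma DERIV_pos_part_square:
  "((\<lambda>s::real. (max 0 s)\<^sup>2) has_real_derivative 2 * max 0 s) (at s)"
proof -
  consider "s > 0" | "s < 0" | "s = 0" by linarith
  then show ?thesis
  proof cases
    case 1
    have "((\<lambda>s::real. s\<^sup>2) has_real_derivative 2 * max 0 s) (at s)"
      using 1 by (auto intro!: derivative_eq_intros)
    then show ?thesis
      by (rule has_field_derivative_transform_within_open[where S="{0<..}"]) (use 1 in auto)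
  next
    case 2
    have "((\<lambda>s::real. 0) has_real_derivative 2 * max 0 s) (at s)"
      using 2 by (auto intro!: derivative_eq_intros)
    then show ?thesis
      by (rule has_field_derivative_transform_within_open[where S="{..<0}"]) (use 2 in auto)
  next
    case 3
    have "((\<lambda>h::real. (max 0 h)\<^sup>2 / h) \<longlongrightarrow> 0) (at 0)"
    proof (rule Lim_null_comparison)
      show "\<forall>\<^sub>F h in at 0. norm ((max 0 h)\<^sup>2 / h) \<le> \<bar>h::real\<bar>"
        by (intro eventuallyI) (auto simp: max_def power2_eq_square)
      show "((\<lambda>h::real. \<bar>h\<bar>) \<longlongrightarrow> 0) (at 0)" by (auto intro!: tendsto_eq_intros)
    qed
    then show ?thesis using 3 by (simp add: DERIV_def)
  qed
qed

lemma GDERIV_pos_part_square: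
  assumes "GDERIV f x :> d"
  shows "GDERIV (\<lambda>x. (max 0 (f x))\<^sup>2) x :> (2 * max 0 (f x)) *\<^sub>R d"
  using GDERIV_DERIV_compose[OF assms DERIV_pos_part_square] by simp

lemma GDERIV_imp_isCont: "GDERIV f x :> d \<Longrightarrow> isCont f x"
  unfolding gderiv_def by (rule has_derivative_continuous)

lemma integrable_lebesgue_compact_support:
  fixes f :: "'a::euclidean_space \<Rightarrow> 'b::euclidean_space"
  assumes "compact K" "continuous_on K f" "\<And>x. x \<notin> K \<Longrightarrow> f x = 0"
  shows "integrable lebesgue f"
proof -
  have "integrable lborel (\<lambda>x. indicator K x *\<^sub>R f x)"
    by (rule borel_integrable_compact[OF assms(1,2)])
  then have "integrable lebesgue (\<lambda>x. indicator K x *\<^sub>R f x)"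
    using borel_measurable_integrable integrable_completion by blast
  moreover have "(\<lambda>x. indicator K x *\<^sub>R f x) = f" using assms(3) by (auto simp: indicator_def fun_eq_iff)
  ultimately show ?thesis by simp
qed

text \<open>
  Two points at distance less than \<open>1\<close> either both lie outside the ball of radius \<open>R\<close> or both in the
  ball of radius \<open>R + 1\<close>, which is compact.
\<close>

lemma uniform_continuity_compact_support:
  fixes f :: "'a::euclidean_space \<Rightarrow> 'b::euclidean_space"
  assumes "continuous_on UNIV f" "\<And>x. R \<le> norm x \<Longrightarrow> f x = 0" "0 < e"
  obtains d where "0 < d" "\<And>x y. norm (x - y) < d \<Longrightarrow> norm (f x - f y) < e"
proof -
  have "uniformly_continuous_on (cball 0 (R+1)) f"
    using assms(1) by (intro compact_uniformly_continuous) (auto intro: continuous_on_subset)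
  then obtain d where d: "d > 0" "\<And>x y. x \<in> cball 0 (R+1) \<Longrightarrow> y \<in> cball 0 (R+1) \<Longrightarrow> dist x y < d \<Longrightarrow> dist (f x) (f y) < e"
    using \<open>0<e\<close> unfolding uniformly_continuous_on_def by metis
  show thesis
  proof (rule that[of "min d 1"])
    fix x y :: 'a assume h: "norm (x - y) < min d 1"
    show "norm (f x - f y) < e"
    proof (cases "R \<le> norm x \<and> R \<le> norm y")
      case True then show ?thesis using assms by simp
    next
      case False
      have "\<bar>norm x - norm y\<bar> \<le> norm (x - y)" by (rule norm_triangle_ineq3)
      with False h have "norm x \<le> R+1" "norm y \<le> R+1" by auto
      then show ?thesis using d(2)[of x y] h by (simp add: dist_norm)
    qed
  qed (use d in auto)
qed

lemma norm_integral_le: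
  fixes f :: "'a \<Rightarrow> 'b::euclidean_space"
  assumes "integrable M f" "integrable M g" "\<And>x. norm (f x) \<le> g x"
  shows "norm (integral\<^sup>L M f) \<le> integral\<^sup>L M g"
  using order_trans[OF integral_norm_bound integral_mono[OF integrable_norm[OF assms(1)] assms(2,3)]] .

lemma mollifier_exists:
  fixes e :: real
  assumes "0 < e"
  obtains \<rho> :: "'a::euclidean_space \<Rightarrow> real" and D\<rho>
  where "\<And>x. GDERIV \<rho> x :> D\<rho> x" "continuous_on UNIV D\<rho>" "\<And>x. 0 \<le> \<rho> x"
    "\<And>x. e \<le> norm x \<Longrightarrow> \<rho> x = 0" "\<And>x. e \<le> norm x \<Longrightarrow> D\<rho> x = 0" "\<And>x. \<rho> (- x) = \<rho> x"
    "integrable lebesgue \<rho>" "(LINT x|lebesgue. \<rho> x) = 1"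
proof -
  define b :: "'a \<Rightarrow> real" where "b x = (max 0 (e\<^sup>2 - x \<bullet> x))\<^sup>2" for x
  define Db :: "'a \<Rightarrow> 'a" where "Db x = (2 * max 0 (e\<^sup>2 - x \<bullet> x)) *\<^sub>R (- 2 *\<^sub>R x)" for x
  have gb: "GDERIV b x :> Db x" for x
  proof -
    have "GDERIV (\<lambda>x. e\<^sup>2 - x \<bullet> x) x :> - 2 *\<^sub>R x"
      unfolding gderiv_def by (auto intro!: derivative_eq_intros simp: inner_commute)
    from GDERIV_pos_part_square[OF this] show ?thesis unfolding b_def Db_def by simp
  qed
  have cDb: "continuous_on UNIV Db" unfolding Db_def by (intro continuous_intros)
  have cb: "continuous_on UNIV b" unfolding b_def by (intro continuous_intros)
  have le: "e\<^sup>2 - x \<bullet> x \<le> 0" if "e \<le> norm x" for x :: 'a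
    using that assms by (simp add: power2_norm_eq_inner[symmetric])
  have b0: "b x = 0" "Db x = 0" if "e \<le> norm x" for x using le[OF that] by (auto simp: b_def Db_def max_def)
  have ib: "integrable lebesgue b"
    by (rule integrable_lebesgue_compact_support[of "cball 0 e"]) (auto intro: continuous_on_subset[OF cb] b0)
  define m where "m = (LINT x|lebesgue. b x)"
  have m: "0 < m"
  proof -
    have "0 \<le> m" unfolding m_def by (intro integral_nonneg_AE) (auto simp: b_def)
    moreover have "m \<noteq> 0"
    proof
      assume "m = 0"
      then have ae: "AE x in lebesgue. b x = 0"
        unfolding m_def using ib by (subst (asm) integral_nonneg_eq_0_iff_AE) (auto simp: b_def)
      have "ball 0 e \<subseteq> {x. b x \<noteq> 0}"
      proof
        fix x :: 'a assume "x \<in> ball 0 e"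
        then have "(norm x)\<^sup>2 < e\<^sup>2" using assms by (intro power_strict_mono) auto
        then show "x \<in> {x. b x \<noteq> 0}" by (simp add: b_def power2_norm_eq_inner)
      qed
      moreover have "{x. b x \<noteq> 0} \<in> null_sets lebesgue"
        using ae by (subst AE_iff_null_sets) (auto intro!: measurable_sets_Collect simp: b_def)
      ultimately have "negligible (ball (0::'a) e)"
        by (metis negligible_iff_null_sets negligible_subset)
      then show False using open_not_negligible[of "ball (0::'a) e"] assms by auto
    qed
    ultimately show ?thesis by simp
  qed
  show thesis
  proof (rule that[of "\<lambda>x. b x / m" "\<lambda>x. (1/m) *\<^sub>R Db x"])
    show "GDERIV (\<lambda>x. b x / m) x :> (1 / m) *\<^sub>R Db x" for x
      using gb[of x] m unfolding gderiv_def by (auto intro!: derivative_eq_intros simp: field_simps)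
      show "0 \<le> b x / m" "b (- x) / m = b x / m" for x using m by (auto simp: b_def)
    show "(LINT x|lebesgue. b x / m) = 1" using m by (simp add: m_def[symmetric])
    show "integrable lebesgue (\<lambda>x. b x / m)" using ib by simp
  qed (use m cDb b0 in \<open>auto intro!: continuous_intros\<close>)
qed

text \<open>
  The error of the first order expansion is uniform in the base point. This is what allows
  differentiation under the integral sign in a convolution with a merely integrable function.
\<close>

lemma uniform_differentiability_compact_support:
  fixes \<rho> :: "'a::euclidean_space \<Rightarrow> real"
  assumes "\<And>x. GDERIV \<rho> x :> D\<rho> x" "continuous_on UNIV D\<rho>" "\<And>x. R \<le> norm x \<Longrightarrow> D\<rho> x = 0" "0 < e"
  obtains d where "0 < d" "\<And>x h. norm h < d \<Longrightarrow> \<bar>\<rho> (x + h) - \<rho> x - h \<bullet> D\<rho> x\<bar> \<le> e * norm h"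
proof -
  obtain d where d: "0 < d" "\<And>x y. norm (x - y) < d \<Longrightarrow> norm (D\<rho> x - D\<rho> y) < e"
    using uniform_continuity_compact_support[OF assms(2,3,4)] by metis
  show thesis
  proof (rule that[OF d(1)])
    fix x h :: 'a assume h: "norm h < d"
    have "norm ((\<rho> (x+h) - (x+h) \<bullet> D\<rho> x) - (\<rho> x - x \<bullet> D\<rho> x)) \<le> e * norm (x + h - x)"
    proof (rule differentiable_bound[where S="ball x d" and f'="\<lambda>y k. k \<bullet> D\<rho> y - k \<bullet> D\<rho> x"])
      fix y assume y: "y \<in> ball x d"
      show "((\<lambda>y. \<rho> y - y \<bullet> D\<rho> x) has_derivative (\<lambda>k. k \<bullet> D\<rho> y - k \<bullet> D\<rho> x)) (at y within ball x d)"
        using assms(1)[of y] unfolding gderiv_def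
        by (auto intro!: derivative_eq_intros intro: has_derivative_at_withinI)
      show "onorm (\<lambda>k. k \<bullet> D\<rho> y - k \<bullet> D\<rho> x) \<le> e"
      proof (rule onorm_bound)
        fix k
        have "norm (k \<bullet> D\<rho> y - k \<bullet> D\<rho> x) \<le> norm k * norm (D\<rho> y - D\<rho> x)"
          using Cauchy_Schwarz_ineq2[of k "D\<rho> y - D\<rho> x"] by (simp add: inner_diff_right)
        also have "\<dots> \<le> norm k * e"
          using d(2)[of y x] y by (intro mult_left_mono) (auto simp: dist_norm norm_minus_commute)
        finally show "norm (k \<bullet> D\<rho> y - k \<bullet> D\<rho> x) \<le> e * norm k" by (simp add: mult.commute)
      qed (use assms in auto)
    qed (use h d in \<open>auto simp: dist_norm\<close>)
    then show "\<bar>\<rho> (x + h) - \<rho> x - h \<bullet> D\<rho> x\<bar> \<le> e * norm h" by (simp add: algebra_simps)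
  qed
qed

lemma borel_measurable_lebesgue_continuous:
  "continuous_on UNIV f \<Longrightarrow> f \<in> borel_measurable lebesgue"
  for f :: "'a::euclidean_space \<Rightarrow> 'b::euclidean_space"
  by (intro measurable_completion) (simp add: borel_measurable_continuous_onI)

lemma bounded_compact_support:
  fixes f :: "'a::euclidean_space \<Rightarrow> 'b::euclidean_space"
  assumes "continuous_on UNIV f" "\<And>x. R \<le> norm x \<Longrightarrow> f x = 0"
  obtains B where "\<And>x. norm (f x) \<le> B"
proof -
  have "compact (f ` cball 0 R)" by (rule compact_continuous_image) (auto intro: continuous_on_subset[OF assms(1)])
  then obtain B where "\<And>x. x \<in> cball 0 R \<Longrightarrow> norm (f x) \<le> B" "0 < B"
    using compact_imp_bounded bounded_pos by (metis imageI)
  then have "norm (f x) \<le> B" for x using assms(2)[of x] by (cases "R \<le> norm x") auto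
  then show thesis by (rule that)
qed

lemma integrable_continuous_bounded_mult:
  fixes k :: "'a::euclidean_space \<Rightarrow> 'b::euclidean_space" and v :: "'a \<Rightarrow> real"
  assumes "integrable lebesgue v" "continuous_on UNIV k" "\<And>x. norm (k x) \<le> B"
  shows "integrable lebesgue (\<lambda>y. v y *\<^sub>R k y)"
proof (rule Bochner_Integration.integrable_bound[of _ "\<lambda>y. B * v y"])
  show "(\<lambda>y. v y *\<^sub>R k y) \<in> borel_measurable lebesgue"
    using assms by (intro borel_measurable_scaleR borel_measurable_integrable borel_measurable_lebesgue_continuous)
  have "0 \<le> B" using assms(3)[of undefined] norm_ge_zero order_trans by blast
  then show "AE x in lebesgue. norm (v x *\<^sub>R k x) \<le> norm (B * v x)"
    using mult_right_mono[OF assms(3) abs_ge_zero] by (intro AE_I2) (simp add: abs_mult mult.commute)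
qed (use assms in auto)

lemma GDERIV_convolution:
  fixes \<rho> v :: "'a::euclidean_space \<Rightarrow> real"
  assumes "\<And>x. GDERIV \<rho> x :> D\<rho> x" "continuous_on UNIV D\<rho>"
    "\<And>x. R \<le> norm x \<Longrightarrow> \<rho> x = 0" "\<And>x. R \<le> norm x \<Longrightarrow> D\<rho> x = 0"
    and v: "integrable lebesgue v"
  shows "GDERIV (\<lambda>x. LINT y|lebesgue. v y * \<rho> (y - x)) x :> - (LINT y|lebesgue. v y *\<^sub>R D\<rho> (y - x))"
    and "continuous_on UNIV (\<lambda>x. - (LINT y|lebesgue. v y *\<^sub>R D\<rho> (y - x)))"
proof -
  have c\<rho>: "continuous_on UNIV \<rho>"
    using assms(1) GDERIV_imp_isCont continuous_at_imp_continuous_on by blast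
  obtain B1 where B1: "\<And>x. norm (\<rho> x) \<le> B1" using bounded_compact_support[OF c\<rho> assms(3)] by blast
  obtain B2 where B2: "\<And>x. norm (D\<rho> x) \<le> B2" using bounded_compact_support[OF assms(2,4)] by blast
  have i1: "integrable lebesgue (\<lambda>y. v y * \<rho> (y - x))" for x
  proof -
    have "continuous_on UNIV (\<lambda>y. \<rho> (y - x))"
      by (rule continuous_on_compose2[OF c\<rho>]) (auto intro!: continuous_intros)
    from integrable_continuous_bounded_mult[OF v this B1] show ?thesis by simp
  qed
  have i2: "integrable lebesgue (\<lambda>y. v y *\<^sub>R D\<rho> (y - x))" for x
    by (rule integrable_continuous_bounded_mult[OF v, of _ B2])
       (auto intro!: continuous_on_compose2[OF assms(2)] continuous_intros B2)
  define M where "M = (LINT y|lebesgue. \<bar>v y\<bar>) + 1"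
  have M: "M > 0" unfolding M_def by (smt (verit) integral_nonneg_AE AE_I2 abs_ge_zero)
  have iv: "integrable lebesgue (\<lambda>y. \<bar>v y\<bar>)" using v by auto
  show "GDERIV (\<lambda>x. LINT y|lebesgue. v y * \<rho> (y - x)) x :> - (LINT y|lebesgue. v y *\<^sub>R D\<rho> (y - x))"
    unfolding gderiv_def
  proof (subst has_derivative_at_alt, intro conjI allI impI)
    show "bounded_linear (\<lambda>h. h \<bullet> - (LINT y|lebesgue. v y *\<^sub>R D\<rho> (y - x)))" by (rule bounded_linear_inner_left)
    fix e :: real assume "0 < e"
    then have "0 < e / M" using M by simp
    then obtain d where d: "0 < d" "\<And>x h. norm h < d \<Longrightarrow> \<bar>\<rho> (x + h) - \<rho> x - h \<bullet> D\<rho> x\<bar> \<le> e / M * norm h"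
      using uniform_differentiability_compact_support[OF assms(1,2,4)] by metis
    show "\<exists>d>0. \<forall>z. norm (z - x) < d \<longrightarrow>
      norm ((LINT y|lebesgue. v y * \<rho> (y - z)) - (LINT y|lebesgue. v y * \<rho> (y - x)) -
         (z - x) \<bullet> - (LINT y|lebesgue. v y *\<^sub>R D\<rho> (y - x))) \<le> e * norm (z - x)"
    proof (intro exI[of _ d] conjI d(1) allI impI)
      fix z assume z: "norm (z - x) < d"
      let ?h = "z - x"
      have i3: "integrable lebesgue (\<lambda>y. ?h \<bullet> (v y *\<^sub>R D\<rho> (y - x)))"
        by (intro integrable_inner_right i2)
      have "(LINT y|lebesgue. v y * \<rho> (y - z)) - (LINT y|lebesgue. v y * \<rho> (y - x)) -
         ?h \<bullet> - (LINT y|lebesgue. v y *\<^sub>R D\<rho> (y - x)) =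
         (LINT y|lebesgue. v y * \<rho> (y - z) - v y * \<rho> (y - x) + ?h \<bullet> (v y *\<^sub>R D\<rho> (y - x)))"
        using i1 i2 i3 by (simp only: Bochner_Integration.integral_diff Bochner_Integration.integral_add
            Bochner_Integration.integrable_diff integral_inner_right inner_minus_right diff_minus_eq_add)
      also have "norm \<dots> \<le> (LINT y|lebesgue. (e / M * norm ?h) * \<bar>v y\<bar>)"
      proof (rule norm_integral_le)
        fix y
        have "v y * \<rho> (y - z) - v y * \<rho> (y - x) + ?h \<bullet> (v y *\<^sub>R D\<rho> (y - x)) =
          v y * (\<rho> ((y - x) + (- ?h)) - \<rho> (y - x) - (- ?h) \<bullet> D\<rho> (y - x))"
          by (simp add: algebra_simps)
        also have "norm \<dots> \<le> \<bar>v y\<bar> * (e / M * norm ?h)"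
          unfolding real_norm_def abs_mult
          using d(2)[of "- ?h" "y - x"] z by (intro mult_left_mono) (auto simp: norm_minus_commute)
        finally show "norm (v y * \<rho> (y - z) - v y * \<rho> (y - x) + ?h \<bullet> (v y *\<^sub>R D\<rho> (y - x))) \<le> (e / M * norm ?h) * \<bar>v y\<bar>"
          by (simp add: mult.commute)
      qed (use i1 i3 iv in auto)
      also have "\<dots> = (e / M * norm ?h) * (M - 1)" by (simp add: M_def)
      also have "\<dots> \<le> (e / M * norm ?h) * M"
        using \<open>0 < e\<close> M by (intro mult_left_mono mult_nonneg_nonneg divide_nonneg_nonneg) auto
      also have "\<dots> = e * norm ?h" using M by simp
      finally show "norm ((LINT y|lebesgue. v y * \<rho> (y - z)) - (LINT y|lebesgue. v y * \<rho> (y - x)) -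
         ?h \<bullet> - (LINT y|lebesgue. v y *\<^sub>R D\<rho> (y - x))) \<le> e * norm ?h" .
    qed
  qed
  show "continuous_on UNIV (\<lambda>x. - (LINT y|lebesgue. v y *\<^sub>R D\<rho> (y - x)))"
    unfolding continuous_on_iff
  proof (intro ballI allI impI)
    fix x :: 'a and e :: real assume "0 < e"
    then have "0 < e / M" using M by simp
    then obtain d where d: "0 < d" "\<And>x y. norm (x - y) < d \<Longrightarrow> norm (D\<rho> x - D\<rho> y) < e / M"
      using uniform_continuity_compact_support[OF assms(2,4)] by metis
    show "\<exists>d>0. \<forall>z\<in>UNIV. dist z x < d \<longrightarrow>
       dist (- (LINT y|lebesgue. v y *\<^sub>R D\<rho> (y - z))) (- (LINT y|lebesgue. v y *\<^sub>R D\<rho> (y - x))) < e"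
    proof (intro exI[of _ d] conjI d(1) ballI impI)
      fix z assume z: "dist z x < d"
      have "norm ((LINT y|lebesgue. v y *\<^sub>R D\<rho> (y - z)) - (LINT y|lebesgue. v y *\<^sub>R D\<rho> (y - x))) =
        norm (LINT y|lebesgue. v y *\<^sub>R D\<rho> (y - z) - v y *\<^sub>R D\<rho> (y - x))"
        using i2 by simp
      also have "\<dots> \<le> (LINT y|lebesgue. (e / M) * \<bar>v y\<bar>)"
      proof (rule norm_integral_le)
        fix y
        have "norm (v y *\<^sub>R D\<rho> (y - z) - v y *\<^sub>R D\<rho> (y - x)) = \<bar>v y\<bar> * norm (D\<rho> (y - z) - D\<rho> (y - x))"
          by (simp add: scaleR_diff_right[symmetric])
        also have "\<dots> \<le> \<bar>v y\<bar> * (e / M)"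
          using d(2)[of "y - z" "y - x"] z by (intro mult_left_mono) (auto simp: dist_norm norm_minus_commute)
        finally show "norm (v y *\<^sub>R D\<rho> (y - z) - v y *\<^sub>R D\<rho> (y - x)) \<le> (e / M) * \<bar>v y\<bar>" by (simp add: mult.commute)
      qed (use i2 iv in auto)
      also have "\<dots> = (e / M) * (M - 1)" by (simp add: M_def)
      also have "\<dots> < (e / M) * M" using \<open>0 < e / M\<close> by (intro mult_strict_left_mono) auto
      also have "\<dots> = e" using M by simp
      finally show "dist (- (LINT y|lebesgue. v y *\<^sub>R D\<rho> (y - z))) (- (LINT y|lebesgue. v y *\<^sub>R D\<rho> (y - x))) < e"
        by (simp add: dist_norm norm_minus_commute)
    qed
  qed
qed

section \<open>Convolution and density of continuous functions in p-norm\<close>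

text \<open>
  An inequality of Young type with an arbitrarily small factor in front of the first term; it
  follows by comparing \<open>b\<close> with \<open>\<tau> * a\<close>. It takes the place of the Hoelder inequality in the estimate of
  the weighted distance between a weak gradient and its mollification.
\<close>

lemma Young_weighted:
  fixes a b p \<tau> :: real
  assumes "0 \<le> a" "0 \<le> b" "0 < \<tau>" "1 < p"
  shows "a powr (p - 1) * b \<le> \<tau> * a powr p + \<tau> powr (1 - p) * b powr p"
proof (cases "b \<le> \<tau> * a")
  case True
  have "a powr (p - 1) * b \<le> a powr (p - 1) * (\<tau> * a)" using True by (intro mult_left_mono) auto
  also have "\<dots> = \<tau> * a powr p"
    using assms(1) by (cases "a = 0") (auto simp: powr_diff)
  also have "\<dots> \<le> \<tau> * a powr p + \<tau> powr (1 - p) * b powr p" by simp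
  finally show ?thesis .
next
  case False
  then have b: "0 < b" using assms by (smt (verit) mult_nonneg_nonneg)
  have "a \<le> b / \<tau>" using False assms by (simp add: field_simps)
  then have "a powr (p - 1) * b \<le> (b / \<tau>) powr (p - 1) * b"
    using assms by (intro mult_right_mono powr_mono2) auto
  also have "\<dots> = \<tau> powr (1 - p) * b powr p"
    using assms b by (simp add: powr_divide powr_diff powr_minus field_simps)
  also have "\<dots> \<le> \<tau> * a powr p + \<tau> powr (1 - p) * b powr p" using assms by simp
  finally show ?thesis .
qed

lemma lborel_shift:
  fixes f :: "'a::euclidean_space \<Rightarrow> real"
  assumes "f \<in> borel_measurable borel"
  shows "integral\<^sup>L lborel (\<lambda>x. f (c + x)) = integral\<^sup>L lborel f"
    and "integrable lborel (\<lambda>x. f (c + x)) \<longleftrightarrow> integrable lborel f"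
proof -
  have "integral\<^sup>L lborel f = integral\<^sup>L (distr lborel borel ((+) c)) f" by (simp add: lborel_distr_plus)
  also have "\<dots> = integral\<^sup>L lborel (\<lambda>x. f (c + x))" using assms by (subst integral_distr) auto
  finally show "integral\<^sup>L lborel (\<lambda>x. f (c + x)) = integral\<^sup>L lborel f" ..
  have "integrable lborel f \<longleftrightarrow> integrable (distr lborel borel ((+) c)) f" by (simp add: lborel_distr_plus)
  also have "\<dots> \<longleftrightarrow> integrable lborel (\<lambda>x. f (c + x))" using assms by (subst integrable_distr_eq) auto
  finally show "integrable lborel (\<lambda>x. f (c + x)) \<longleftrightarrow> integrable lborel f" ..
qed

text \<open>
  By Tonelli, averaging with an even kernel of mass one preserves the mass. The function \<open>k\<close> is
  first replaced by a Borel function that agrees with it almost everywhere, because the product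
  measure is formed from \<open>lborel\<close>.
\<close>

lemma integral_mollified:
  fixes \<rho> k :: "'a::euclidean_space \<Rightarrow> real"
  assumes c: "continuous_on UNIV \<rho>" and nn: "\<And>x. 0 \<le> \<rho> x" and ev: "\<And>x. \<rho> (- x) = \<rho> x"
    and int: "integrable lebesgue \<rho>" "(LINT x|lebesgue. \<rho> x) = 1"
    and k: "integrable lebesgue k" "\<And>x. 0 \<le> k x"
  shows "integrable lebesgue (\<lambda>x. LINT y|lebesgue. k y * \<rho> (y - x))"
    and "(LINT x|lebesgue. LINT y|lebesgue. k y * \<rho> (y - x)) = (LINT y|lebesgue. k y)"
proof -
  have \<rho>m[measurable]: "\<rho> \<in> borel_measurable borel" by (rule borel_measurable_continuous_onI[OF c])
  have \<rho>i: "integrable lborel \<rho>" "(LINT x|lborel. \<rho> x) = 1"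
    using int \<rho>m by (auto simp: integrable_completion integral_completion)
  have sh: "integrable lborel (\<lambda>x. \<rho> (y - x))" "(LINT x|lborel. \<rho> (y - x)) = 1" for y
  proof -
    have e: "\<rho> (y - x) = \<rho> (- y + x)" for x using ev[of "y - x"] by simp
    show "integrable lborel (\<lambda>x. \<rho> (y - x))" "(LINT x|lborel. \<rho> (y - x)) = 1"
      unfolding e using lborel_shift[OF \<rho>m, of "- y"] \<rho>i by auto
  qed
  obtain k' where k'm[measurable]: "k' \<in> borel_measurable lborel" and kk: "AE x in lborel. k x = k' x"
    using completion_ex_borel_measurable_real[OF borel_measurable_integrable[OF k(1)]] by blast
  have kk': "AE x in lebesgue. k x = k' x" using kk by (rule AE_completion)
  have k'L: "integrable lebesgue k'"
    by (rule integrable_cong_AE_imp[OF k(1) measurable_completion[OF k'm] kk'])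
  then have k'i: "integrable lborel k'" using k'm by (simp add: integrable_completion)
  have m2: "(\<lambda>z. k' (fst z) * \<rho> (fst z - snd z)) \<in> borel_measurable (lborel \<Otimes>\<^sub>M lborel)"
    by measurable
  have pint: "integrable (lborel \<Otimes>\<^sub>M lborel) (\<lambda>(y,x). k' y * \<rho> (y - x))"
  proof (rule lborel_pair.Fubini_integrable)
    show "(\<lambda>(y, x). k' y * \<rho> (y - x)) \<in> borel_measurable (lborel \<Otimes>\<^sub>M lborel)"
      using m2 by (simp add: split_beta')
    have "(\<lambda>y. LINT x|lborel. norm (case (y, x) of (y, x) \<Rightarrow> k' y * \<rho> (y - x))) = (\<lambda>y. \<bar>k' y\<bar>)"
      using sh nn by (simp add: abs_mult)
    then show "integrable lborel (\<lambda>y. LINT x|lborel. norm (case (y, x) of (y, x) \<Rightarrow> k' y * \<rho> (y - x)))"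
      using k'i by simp
    show "AE y in lborel. integrable lborel (\<lambda>x. case (y, x) of (y, x) \<Rightarrow> k' y * \<rho> (y - x))"
      using sh by auto
  qed
  define M where "M x = (LINT y|lborel. k' y * \<rho> (y - x))" for x
  have Mi: "integrable lborel M"
    using lborel_pair.integrable_snd[OF pint] unfolding M_def by simp
  have "(LINT x|lborel. M x) = (LINT y|lborel. LINT x|lborel. k' y * \<rho> (y - x))"
    unfolding M_def using lborel_pair.Fubini_integral[OF pint] by simp
  also have "\<dots> = (LINT y|lborel. k' y)" using sh by simp
  finally have Mint: "(LINT x|lborel. M x) = (LINT y|lborel. k' y)" .
  have eq: "(LINT y|lebesgue. k y * \<rho> (y - x)) = M x" for x
  proof -
    have "(LINT y|lebesgue. k y * \<rho> (y - x)) = (LINT y|lebesgue. k' y * \<rho> (y - x))"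
    proof (rule integral_cong_AE)
      have "(\<lambda>y. \<rho> (y - x)) \<in> borel_measurable lebesgue"
        by (rule measurable_completion) simp
      then show "(\<lambda>y. k y * \<rho> (y - x)) \<in> borel_measurable lebesgue" "(\<lambda>y. k' y * \<rho> (y - x)) \<in> borel_measurable lebesgue"
        using k(1) k'L by auto
    qed (use kk' in auto)
    also have "\<dots> = M x" unfolding M_def by (rule integral_completion) measurable
    finally show ?thesis .
  qed
  show "integrable lebesgue (\<lambda>x. LINT y|lebesgue. k y * \<rho> (y - x))"
    unfolding eq using Mi integrable_completion borel_measurable_integrable by blast
  have "(LINT x|lebesgue. M x) = (LINT y|lborel. k' y)"
    using Mi Mint by (simp add: integral_completion)
  also have "\<dots> = (LINT y|lebesgue. k' y)" using k'm by (simp add: integral_completion)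
  also have "\<dots> = (LINT y|lebesgue. k y)"
    using kk' k'L k(1) by (intro integral_cong_AE) auto
  finally show "(LINT x|lebesgue. LINT y|lebesgue. k y * \<rho> (y - x)) = (LINT y|lebesgue. k y)"
    unfolding eq .
qed

lemma powr_add_le:
  fixes a b p :: real
  assumes "0 \<le> a" "0 \<le> b" "0 \<le> p"
  shows "(a + b) powr p \<le> 2 powr p * (a powr p + b powr p)"
proof -
  have "(a + b) powr p \<le> (2 * max a b) powr p" using assms by (intro powr_mono2) auto
  also have "\<dots> = 2 powr p * max a b powr p" using assms by (simp add: powr_mult)
  also have "\<dots> \<le> 2 powr p * (a powr p + b powr p)" by (intro mult_left_mono) (auto simp: max_def)
  finally show ?thesis .
qed

text \<open>
  The function is truncated by projecting its values to a large ball; for the bounded truncation,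
  an almost everywhere approximation by continuous functions, projected to the same ball, converges
  in the mean by dominated convergence.
\<close>

lemma continuous_dense_Lp:
  fixes G :: "'a::euclidean_space \<Rightarrow> 'b::euclidean_space"
  assumes K: "compact K" and p: "1 \<le> p" and Gm: "G \<in> borel_measurable lebesgue"
    and G0: "\<And>x. x \<notin> K \<Longrightarrow> G x = 0"
    and Gp: "integrable lebesgue (\<lambda>x. norm (G x) powr p)" and e: "0 < e"
  obtains g where "continuous_on UNIV g"
    "integrable lebesgue (\<lambda>x. indicator K x * norm (G x - g x) powr p)"
    "(LINT x|lebesgue. indicator K x * norm (G x - g x) powr p) < e"
proof -
  define T :: "nat \<Rightarrow> 'b \<Rightarrow> 'b" where "T k y = closest_point (cball 0 (real k)) y" for k y
  have cT: "continuous_on UNIV (T k)" for k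
    unfolding T_def by (intro continuous_on_closest_point) auto
  have Tb: "norm (T k y) \<le> real k" for k y
    using closest_point_in_set[of "cball 0 (real k)" y] by (auto simp: T_def)
  have Tid: "T k y = y" if "norm y \<le> real k" for k y
    unfolding T_def using that by (intro closest_point_self) auto
  have Td: "norm (y - T k y) \<le> norm y" for k y
    using closest_point_le[of "cball 0 (real k)" 0 y] by (simp add: T_def dist_norm)
  note Gm[measurable]
  have TGm[measurable]: "(\<lambda>x. T k (G x)) \<in> borel_measurable lebesgue" for k
    by (rule measurable_compose[OF Gm borel_measurable_continuous_onI[OF cT]])
  have Km[measurable]: "K \<in> sets lebesgue" using K by (simp add: compact_imp_closed borel_closed sets_completionI_sets)
  have Ki: "integrable lebesgue (indicator K :: 'a \<Rightarrow> real)"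
    using integrable_lebesgue_compact_support[OF K, of "indicator K :: 'a \<Rightarrow> real"]
    by (auto simp: indicator_def)
  define q where "q = 2 powr p"
  have q: "q > 0" unfolding q_def by simp
  have lim1: "(\<lambda>k. LINT x|lebesgue. norm (G x - T k (G x)) powr p) \<longlonglongrightarrow> (LINT x::'a|lebesgue. (0::real))"
  proof (rule integral_dominated_convergence[where w = "\<lambda>x. norm (G x) powr p"])
    show "(\<lambda>x. norm (G x - T k (G x)) powr p) \<in> borel_measurable lebesgue" for k
      by measurable
    show "AE x in lebesgue. norm (norm (G x - T k (G x)) powr p) \<le> norm (G x) powr p" for k
      using Td p by (intro AE_I2) (simp add: powr_mono2)
    have "(\<lambda>k. norm (G x - T k (G x)) powr p) \<longlonglongrightarrow> 0" for x
    proof (rule tendsto_eventually)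
      obtain n :: nat where "norm (G x) \<le> real n" using real_arch_simple by blast
      then have "norm (G x - T k (G x)) powr p = 0" if "n \<le> k" for k
        using that Tid[of "G x" k] by simp
      then show "\<forall>\<^sub>F k in sequentially. norm (G x - T k (G x)) powr p = 0"
        unfolding eventually_sequentially by blast
    qed
    then show "AE x in lebesgue. (\<lambda>k. norm (G x - T k (G x)) powr p) \<longlonglongrightarrow> 0" by simp
  qed (use Gp in auto)
  have "0 < e / (2 * q)" using e q by simp
  then obtain k where k: "(LINT x|lebesgue. norm (G x - T k (G x)) powr p) < e / (2 * q)"
    using order_tendstoD(2)[OF lim1, of "e / (2 * q)"] by (auto dest: eventually_happens)
  have int1: "integrable lebesgue (\<lambda>x. norm (G x - T k (G x)) powr p)"
  proof (rule Bochner_Integration.integrable_bound[OF Gp])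
    show "(\<lambda>x. norm (G x - T k (G x)) powr p) \<in> borel_measurable lebesgue"
      by measurable
    show "AE x in lebesgue. norm (norm (G x - T k (G x)) powr p) \<le> norm (norm (G x) powr p)"
      using Td p by (intro AE_I2) (simp add: powr_mono2)
  qed
  have "G measurable_on UNIV" using Gm by (simp add: lebesgue_measurable_imp_measurable_on)
  then obtain N h where N: "negligible N" and hc: "\<And>n. continuous_on UNIV (h n)"
    and hl: "\<And>x. x \<notin> N \<Longrightarrow> (\<lambda>n. h n x) \<longlonglongrightarrow> G x"
    unfolding measurable_on_def by auto
  define g where "g n x = T k (h n x)" for n x
  have gc: "continuous_on UNIV (g n)" for n
    unfolding g_def by (rule continuous_on_compose2[OF cT hc]) auto
  have gm[measurable]: "g n \<in> borel_measurable lebesgue" for n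
    by (rule borel_measurable_lebesgue_continuous[OF gc])
  have m2: "(\<lambda>x. indicator K x * norm (T k (G x) - g n x) powr p) \<in> borel_measurable lebesgue" for n
    by measurable
  have b2: "norm (indicator K x * norm (T k (G x) - g n x) powr p) \<le> indicator K x * (2 * real k) powr p" for n x
  proof -
    have "norm (T k (G x) - g n x) \<le> 2 * real k"
      using norm_triangle_ineq4[of "T k (G x)" "g n x"] Tb[of k "G x"] Tb[of k "h n x"] unfolding g_def by linarith
    then show ?thesis using p by (auto simp: indicator_def intro!: powr_mono2)
  qed
  have w2: "integrable lebesgue (\<lambda>x. indicator K x * (2 * real k) powr p)" using Ki by auto
  have int2: "integrable lebesgue (\<lambda>x. indicator K x * norm (T k (G x) - g n x) powr p)" for n
    by (rule Bochner_Integration.integrable_bound[OF w2 m2]) (use b2 in \<open>auto intro!: AE_I2\<close>)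
  have lim2: "(\<lambda>n. LINT x|lebesgue. indicator K x * norm (T k (G x) - g n x) powr p) \<longlonglongrightarrow> (LINT x::'a|lebesgue. (0::real))"
  proof (rule integral_dominated_convergence[OF _ m2 w2])
    have "AE x in lebesgue. x \<notin> N"
      using N by (simp add: negligible_iff_null_sets AE_not_in)
    then show "AE x in lebesgue. (\<lambda>n. indicator K x * norm (T k (G x) - g n x) powr p) \<longlonglongrightarrow> 0"
    proof eventually_elim
      case (elim x)
      have "(\<lambda>n. g n x) \<longlonglongrightarrow> T k (G x)"
        unfolding g_def
        by (rule isCont_tendsto_compose[OF _ hl[OF elim]])
          (use cT[of k] in \<open>simp add: continuous_on_eq_continuous_at\<close>)
      then have "(\<lambda>n. norm (T k (G x) - g n x)) \<longlonglongrightarrow> norm (T k (G x) - T k (G x))"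
        by (intro tendsto_intros)
      then have "(\<lambda>n. norm (T k (G x) - g n x) powr p) \<longlonglongrightarrow> 0 powr p"
        using p by (intro tendsto_powr') auto
      then have "(\<lambda>n. indicator K x * norm (T k (G x) - g n x) powr p) \<longlonglongrightarrow> indicator K x * 0 powr p"
        by (rule tendsto_mult_left)
      then show ?case by simp
    qed
  qed (use b2 in auto)
  obtain n where n: "(LINT x|lebesgue. indicator K x * norm (T k (G x) - g n x) powr p) < e / (2 * q)"
    using order_tendstoD(2)[OF lim2, of "e / (2 * q)"] \<open>0 < e / (2*q)\<close> by (auto dest: eventually_happens)
  let ?A = "\<lambda>x. norm (G x - T k (G x)) powr p" and ?B = "\<lambda>x. indicator K x * norm (T k (G x) - g n x) powr p"
  let ?C = "\<lambda>x. indicator K x * norm (G x - g n x) powr p"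
  have AB: "integrable lebesgue (\<lambda>x. q * (?A x + ?B x))" using int1 int2 by auto
  have le: "?C x \<le> q * (?A x + ?B x)" for x
  proof (cases "x \<in> K")
    case True
    have "norm (G x - g n x) \<le> norm (G x - T k (G x)) + norm (T k (G x) - g n x)"
      using dist_triangle[of "G x" "g n x" "T k (G x)"] by (simp add: dist_norm)
    then have "norm (G x - g n x) powr p \<le> (norm (G x - T k (G x)) + norm (T k (G x) - g n x)) powr p"
      using p by (intro powr_mono2) auto
    also have "\<dots> \<le> q * (?A x + norm (T k (G x) - g n x) powr p)"
      unfolding q_def using p by (intro powr_add_le) auto
    finally show ?thesis using True by simp
  qed (use q in auto)
  have C: "integrable lebesgue ?C"
  proof (rule Bochner_Integration.integrable_bound[OF AB])
    show "?C \<in> borel_measurable lebesgue"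
      by measurable
    show "AE x in lebesgue. norm (?C x) \<le> norm (q * (?A x + ?B x))"
    proof (rule AE_I2)
      fix x have "0 \<le> ?C x" by simp
      then show "norm (?C x) \<le> norm (q * (?A x + ?B x))" using le[of x] unfolding real_norm_def by linarith
    qed
  qed
  have "(LINT x|lebesgue. ?C x) \<le> (LINT x|lebesgue. q * (?A x + ?B x))"
    by (rule integral_mono[OF C AB le])
  also have "\<dots> = q * ((LINT x|lebesgue. ?A x) + (LINT x|lebesgue. ?B x))" using int1 int2 by simp
  also have "\<dots> < q * (e / (2 * q) + e / (2 * q))" using k n q by (intro mult_strict_left_mono add_strict_mono) auto
  also have "\<dots> = e" using q by simp
  finally show thesis using that[OF gc C] by simp
qed

section \<open>Smooth approximation of functions with a weak gradient\<close>

lemma lebesgue_shift: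
  fixes \<rho> :: "'a::euclidean_space \<Rightarrow> real"
  assumes c: "continuous_on UNIV \<rho>" and int: "integrable lebesgue \<rho>"
  shows "integrable lebesgue (\<lambda>y. \<rho> (y - x))" "(LINT y|lebesgue. \<rho> (y - x)) = (LINT y|lebesgue. \<rho> y)"
proof -
  have \<rho>m[measurable]: "\<rho> \<in> borel_measurable borel" by (rule borel_measurable_continuous_onI[OF c])
  have m: "(\<lambda>y. \<rho> (y - x)) \<in> borel_measurable lborel" by measurable
  have i: "integrable lborel \<rho>" using int \<rho>m by (simp add: integrable_completion)
  show "integrable lebesgue (\<lambda>y. \<rho> (y - x))"
    using lborel_shift(2)[OF \<rho>m, of "- x"] i m by (simp add: integrable_completion)
  show "(LINT y|lebesgue. \<rho> (y - x)) = (LINT y|lebesgue. \<rho> y)"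
    using lborel_shift(1)[OF \<rho>m, of "- x"] m \<rho>m by (simp add: integral_completion)
qed

text \<open>
  The approximation is a mollification at a small scale. On \<open>K\<close> its gradient is the mollified weak
  gradient, by the definition of a weak gradient with the shifted kernel as test function. The
  weight \<open>H powr (p - 1)\<close> has the size of the flux of \<open>u\<close>, and it is only known that \<open>H powr p\<close> is
  integrable; so the gradient must be approximated in the \<open>p\<close>-norm in disguise. To this end \<open>G\<close> is
  split into a continuous \<open>g\<close>, which is almost unchanged by mollification, and a remainder \<open>d\<close> with
  a small \<open>p\<close>-norm, to which \<open>Young_weighted\<close> applies before and after averaging.
\<close>

lemma smooth_approximation:
  fixes u :: "'a::euclidean_space \<Rightarrow> real"
  assumes \<Omega>: "open \<Omega>" and u: "continuous_on \<Omega> u" and wg: "weak_gradient_on \<Omega> u G"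
    and Gp: "locally_integrable_on \<Omega> (\<lambda>x. norm (G x) powr p)" and p: "1 < p"
    and K: "compact K" "K \<subseteq> \<Omega>"
    and H: "H \<in> borel_measurable lebesgue" "\<And>x. 0 \<le> H x" "\<And>x. x \<notin> K \<Longrightarrow> H x = 0"
      "integrable lebesgue (\<lambda>x. H x powr p)"
    and e: "0 < e"
  obtains v Dv where "\<And>x. GDERIV v x :> Dv x" "continuous_on UNIV Dv"
    "\<And>x. x \<in> K \<Longrightarrow> \<bar>v x - u x\<bar> \<le> e"
    "integrable lebesgue (\<lambda>x. H x powr (p - 1) * norm (Dv x - G x))"
    "(LINT x|lebesgue. H x powr (p - 1) * norm (Dv x - G x)) \<le> e"
proof -
  obtain r where r: "0 < r" "(\<Union>x\<in>K. cball x r) \<subseteq> \<Omega>"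
    using compact_subset_open_imp_cball_epsilon_subset[OF K(1) \<Omega> K(2)] by blast
  define K2 where "K2 = {x + y | x y. x \<in> K \<and> y \<in> cball 0 r}"
  have K2c: "compact K2" unfolding K2_def by (intro compact_sums K) auto
  have K2: "cball x r \<subseteq> K2" if "x \<in> K" for x
  proof
    fix y assume "y \<in> cball x r"
    then have "y = x + (y - x)" "y - x \<in> cball 0 r" by (auto simp: dist_norm norm_minus_commute)
    then show "y \<in> K2" unfolding K2_def using that by blast
  qed
  have K2\<Omega>: "K2 \<subseteq> \<Omega>"
  proof
    fix z assume "z \<in> K2"
    then obtain x y where "x \<in> K" "z = x + y" "norm y \<le> r" unfolding K2_def by auto
    then have "z \<in> cball x r" by (simp add: dist_norm)
    then show "z \<in> \<Omega>" using r \<open>x \<in> K\<close> by blast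
  qed
  have K2m[measurable]: "K2 \<in> sets lebesgue"
    using K2c by (simp add: compact_imp_closed borel_closed sets_completionI_sets)
  define G0 where "G0 x = indicator K2 x *\<^sub>R G x" for x
  define u0 where "u0 x = indicator K2 x *\<^sub>R u x" for x
  have u0i: "integrable lebesgue u0"
    using wg K2c K2\<Omega> unfolding weak_gradient_on_def locally_integrable_on_def set_integrable_def u0_def by blast
  have G0i: "integrable lebesgue G0"
    using wg K2c K2\<Omega> unfolding weak_gradient_on_def locally_integrable_on_def set_integrable_def G0_def by blast
  have G0m[measurable]: "G0 \<in> borel_measurable lebesgue" using G0i by auto
  have "integrable lebesgue (\<lambda>x. indicator K2 x *\<^sub>R norm (G x) powr p)"
    using Gp K2c K2\<Omega> unfolding locally_integrable_on_def set_integrable_def by blast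
  moreover have "(\<lambda>x. indicator K2 x *\<^sub>R norm (G x) powr p) = (\<lambda>x. norm (G0 x) powr p)"
    using p by (auto simp: G0_def fun_eq_iff indicator_def)
  ultimately have G0p: "integrable lebesgue (\<lambda>x. norm (G0 x) powr p)" by simp
  note H(1)[measurable]
  define I where "I = (LINT x|lebesgue. H x powr p)"
  have I: "0 \<le> I" unfolding I_def by (intro integral_nonneg_AE) auto
  have Ki: "integrable lebesgue (indicator K :: 'a \<Rightarrow> real)"
    using integrable_lebesgue_compact_support[OF K(1), of "indicator K :: 'a \<Rightarrow> real"]
    by (auto simp: indicator_def)
  have Hle: "H x powr (p - 1) \<le> indicator K x + H x powr p" for x
  proof (cases "x \<in> K \<and> 1 \<le> H x")
    case True
    then show ?thesis using powr_mono[of "p - 1" p "H x"] by simp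
  next
    case False
    then have "x \<in> K \<Longrightarrow> H x powr (p - 1) \<le> 1" using p H(2)[of x] powr_le1[of "p - 1" "H x"] by auto
    then show ?thesis using H(3)[of x] by (cases "x \<in> K") (auto simp: add_increasing2)
  qed
  have Hi: "integrable lebesgue (\<lambda>x. H x powr (p - 1))"
    by (rule Bochner_Integration.integrable_bound[OF Bochner_Integration.integrable_add[OF Ki H(4)]])
       (use Hle in auto)
  define J where "J = (LINT x|lebesgue. H x powr (p - 1))"
  have J: "0 \<le> J" unfolding J_def by (intro integral_nonneg_AE) auto
  \<comment> \<open>The bound \<open>F\<close> below integrates to \<open>2 * \<tau> * I + \<gamma> * J\<close> plus \<open>2 * \<tau> powr (1 - p)\<close> times the integral of \<open>d powr p\<close>; the choices of \<open>\<tau>\<close>, \<open>\<gamma>\<close> and \<open>g\<close> make each of the three terms at most \<open>e / 3\<close>.\<close>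
  define \<tau> where "\<tau> = e / (6 * (I + 1))"
  define \<gamma> where "\<gamma> = e / (3 * (J + 1))"
  have \<tau>: "0 < \<tau>" "0 < \<gamma>" using e I J by (auto simp: \<tau>_def \<gamma>_def)
  have "0 < e * \<tau> powr (p - 1) / 6" using e \<tau> by simp
  then obtain g where gc: "continuous_on UNIV g"
    and gi: "integrable lebesgue (\<lambda>x. indicator K2 x * norm (G0 x - g x) powr p)"
    and gle: "(LINT x|lebesgue. indicator K2 x * norm (G0 x - g x) powr p) < e * \<tau> powr (p - 1) / 6"
    using continuous_dense_Lp[OF K2c _ G0m _ G0p, of "e * \<tau> powr (p - 1) / 6"] p
    by (auto simp: G0_def)
  define d where "d x = norm (G0 x - indicator K2 x *\<^sub>R g x)" for x
  have dnn: "0 \<le> d x" for x by (simp add: d_def)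
  have dp: "(\<lambda>x. d x powr p) = (\<lambda>x. indicator K2 x * norm (G0 x - g x) powr p)"
    using p by (auto simp: d_def G0_def fun_eq_iff indicator_def)
  have dpi: "integrable lebesgue (\<lambda>x. d x powr p)" unfolding dp by (rule gi)
  have ig: "integrable lebesgue (\<lambda>x. indicator K2 x *\<^sub>R g x)"
  proof (rule integrable_lebesgue_compact_support[OF K2c])
    show "continuous_on K2 (\<lambda>x. indicator K2 x *\<^sub>R g x)"
      by (rule continuous_on_eq[OF continuous_on_subset[OF gc subset_UNIV]]) auto
  qed auto
  have di: "integrable lebesgue d" unfolding d_def using G0i ig by auto
  have "uniformly_continuous_on K2 u" "uniformly_continuous_on K2 g"
    using u gc K2c K2\<Omega> by (auto intro!: compact_uniformly_continuous intro: continuous_on_subset)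
  then obtain d1 d2 where d1: "0 < d1" "\<And>x y. x \<in> K2 \<Longrightarrow> y \<in> K2 \<Longrightarrow> dist y x < d1 \<Longrightarrow> dist (u y) (u x) < e"
    and d2: "0 < d2" "\<And>x y. x \<in> K2 \<Longrightarrow> y \<in> K2 \<Longrightarrow> dist y x < d2 \<Longrightarrow> dist (g y) (g x) < \<gamma>"
    unfolding uniformly_continuous_on_def using e \<tau> by metis
  define \<epsilon> where "\<epsilon> = min r (min d1 d2)"
  have \<epsilon>: "0 < \<epsilon>" "\<epsilon> \<le> r" "\<epsilon> \<le> d1" "\<epsilon> \<le> d2" using r d1 d2 by (auto simp: \<epsilon>_def)
  obtain \<rho> :: "'a \<Rightarrow> real" and D\<rho> where
    \<rho>: "\<And>x. GDERIV \<rho> x :> D\<rho> x" "continuous_on UNIV D\<rho>" "\<And>x. 0 \<le> \<rho> x"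
    "\<And>x. \<epsilon> \<le> norm x \<Longrightarrow> \<rho> x = 0" "\<And>x. \<epsilon> \<le> norm x \<Longrightarrow> D\<rho> x = 0" "\<And>x. \<rho> (- x) = \<rho> x"
    "integrable lebesgue \<rho>" "(LINT x|lebesgue. \<rho> x) = 1"
    using mollifier_exists[OF \<epsilon>(1)] by metis
  have c\<rho>: "continuous_on UNIV \<rho>"
    using \<rho>(1) GDERIV_imp_isCont continuous_at_imp_continuous_on by blast
  have sh: "integrable lebesgue (\<lambda>y. \<rho> (y - x))" "(LINT y|lebesgue. \<rho> (y - x)) = 1" for x
    using lebesgue_shift[OF c\<rho> \<rho>(7), of x] \<rho>(8) by auto
  obtain B where B: "\<And>x. norm (\<rho> x) \<le> B" using bounded_compact_support[OF c\<rho> \<rho>(4)] by blast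
  have c\<rho>x: "continuous_on UNIV (\<lambda>y. \<rho> (y - x))" for x
    by (rule continuous_on_compose2[OF c\<rho>]) (auto intro!: continuous_intros)
  have i\<rho>: "integrable lebesgue (\<lambda>y. f y * \<rho> (y - x))" if "integrable lebesgue f" for f x
    using integrable_continuous_bounded_mult[OF that c\<rho>x B] by simp
  define v where "v x = (LINT y|lebesgue. u0 y * \<rho> (y - x))" for x
  define Dv where "Dv x = - (LINT y|lebesgue. u0 y *\<^sub>R D\<rho> (y - x))" for x
  have gv: "GDERIV v x :> Dv x" for x
    unfolding v_def Dv_def by (rule GDERIV_convolution(1)[OF \<rho>(1,2,4,5) u0i])
  have cDv: "continuous_on UNIV Dv"
    unfolding Dv_def by (rule GDERIV_convolution(2)[OF \<rho>(1,2,4,5) u0i])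
  have i\<rho>G: "integrable lebesgue (\<lambda>y. \<rho> (y - x) *\<^sub>R G0 y)" for x
  proof (rule Bochner_Integration.integrable_bound)
    show "integrable lebesgue (\<lambda>y. B * norm (G0 y))" using G0i by auto
    have [measurable]: "(\<lambda>y. \<rho> (y - x)) \<in> borel_measurable lebesgue" using sh(1) by auto
    show "(\<lambda>y. \<rho> (y - x) *\<^sub>R G0 y) \<in> borel_measurable lebesgue" by measurable
    show "AE y in lebesgue. norm (\<rho> (y - x) *\<^sub>R G0 y) \<le> norm (B * norm (G0 y))"
    proof (rule AE_I2)
      fix y have "\<bar>\<rho> (y - x)\<bar> \<le> \<bar>B\<bar>" using B[of "y - x"] by simp
      then show "norm (\<rho> (y - x) *\<^sub>R G0 y) \<le> norm (B * norm (G0 y))"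
        by (simp add: abs_mult mult_right_mono)
    qed
  qed
  have Dv: "Dv x = (LINT y|lebesgue. \<rho> (y - x) *\<^sub>R G0 y)" if x: "x \<in> K" for x
  proof -
    have sub: "cball x \<epsilon> \<subseteq> K2" using K2[OF x] \<epsilon>(2) by auto
    have off: "\<rho> (y - x) = 0" "D\<rho> (y - x) = 0" if "y \<notin> K2" for y
    proof -
      have "\<epsilon> \<le> norm (y - x)" using that sub by (force simp: dist_norm norm_minus_commute)
      then show "\<rho> (y - x) = 0" "D\<rho> (y - x) = 0" using \<rho>(4,5) by auto
    qed
    have cl: "closure {y. \<rho> (y - x) \<noteq> 0} \<subseteq> cball x \<epsilon>"
    proof (rule closure_minimal)
      show "{y. \<rho> (y - x) \<noteq> 0} \<subseteq> cball x \<epsilon>"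
        using \<rho>(4) by (auto simp: dist_norm norm_minus_commute) (metis linorder_le_cases norm_minus_commute)
    qed auto
    have "C1_0 \<Omega> (\<lambda>y. \<rho> (y - x)) (\<lambda>y. D\<rho> (y - x))"
      unfolding C1_0_def
    proof (intro conjI allI)
      show "GDERIV (\<lambda>y. \<rho> (y - x)) y :> D\<rho> (y - x)" for y
      proof -
        have "((\<lambda>y. y - x) has_derivative (\<lambda>h. h)) (at y)" by (auto intro!: derivative_eq_intros)
        from has_derivative_compose[OF this, of \<rho>] \<rho>(1)[of "y - x"] show ?thesis
          unfolding gderiv_def by simp
      qed
      show "continuous_on UNIV (\<lambda>y. D\<rho> (y - x))"
        by (rule continuous_on_compose2[OF \<rho>(2)]) (auto intro!: continuous_intros)
      show "compact (closure {y. \<rho> (y - x) \<noteq> 0})"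
        using cl by (meson bounded_cball bounded_subset closed_closure compact_eq_bounded_closed)
      show "closure {y. \<rho> (y - x) \<noteq> 0} \<subseteq> \<Omega>" using cl sub K2\<Omega> by blast
    qed
    then have "(LINT y:\<Omega>|lebesgue. u y *\<^sub>R D\<rho> (y - x)) = - (LINT y:\<Omega>|lebesgue. \<rho> (y - x) *\<^sub>R G y)"
      using wg unfolding weak_gradient_on_def by blast
    moreover have "(LINT y:\<Omega>|lebesgue. u y *\<^sub>R D\<rho> (y - x)) = (LINT y|lebesgue. u0 y *\<^sub>R D\<rho> (y - x))"
      unfolding set_lebesgue_integral_def u0_def using off(2) K2\<Omega>
      by (intro Bochner_Integration.integral_cong) (auto simp: indicator_def)
    moreover have "(LINT y:\<Omega>|lebesgue. \<rho> (y - x) *\<^sub>R G y) = (LINT y|lebesgue. \<rho> (y - x) *\<^sub>R G0 y)"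
      unfolding set_lebesgue_integral_def G0_def using off(1) K2\<Omega>
      by (intro Bochner_Integration.integral_cong) (auto simp: indicator_def)
    ultimately show ?thesis unfolding Dv_def by simp
  qed
  have vu: "\<bar>v x - u x\<bar> \<le> e" if x: "x \<in> K" for x
  proof -
    have "v x - u x = (LINT y|lebesgue. u0 y * \<rho> (y - x) - u x * \<rho> (y - x))"
      unfolding v_def using i\<rho>[OF u0i] sh by simp
    also have "norm \<dots> \<le> (LINT y|lebesgue. e * \<rho> (y - x))"
    proof (rule norm_integral_le)
      fix y
      show "norm (u0 y * \<rho> (y - x) - u x * \<rho> (y - x)) \<le> e * \<rho> (y - x)"
      proof (cases "\<epsilon> \<le> norm (y - x)")
        case False
        then have yx: "y \<in> K2" "x \<in> K2" "dist y x < d1"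
          using K2[OF x] \<epsilon> r x by (auto simp: dist_norm norm_minus_commute subset_iff)
        then have "\<bar>u0 y - u x\<bar> \<le> e" using d1(2)[OF yx(2,1)] by (simp add: u0_def dist_norm)
        then have "\<bar>u0 y - u x\<bar> * \<rho> (y - x) \<le> e * \<rho> (y - x)" using \<rho>(3) by (intro mult_right_mono) auto
        moreover have "norm (u0 y * \<rho> (y - x) - u x * \<rho> (y - x)) = \<bar>u0 y - u x\<bar> * \<rho> (y - x)"
          using \<rho>(3) by (simp add: left_diff_distrib[symmetric] abs_mult)
        ultimately show ?thesis by simp
      qed (use \<rho>(4) in auto)
    qed (use i\<rho>[OF u0i] sh in auto)
    also have "\<dots> = e" using sh by simp
    finally show ?thesis by simp
  qed
  define m where "m x = (LINT y|lebesgue. d y powr p * \<rho> (y - x))" for x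
  have mi: "integrable lebesgue m" "(LINT x|lebesgue. m x) = (LINT y|lebesgue. d y powr p)"
    unfolding m_def using integral_mollified[OF c\<rho> \<rho>(3,6,7,8) dpi] by auto
  have DvG: "norm (Dv x - G x) \<le> (LINT y|lebesgue. d y * \<rho> (y - x)) + \<gamma> + d x" if x: "x \<in> K" for x
  proof -
    have xK2: "x \<in> K2" using K2[OF x] r by auto
    have ic: "integrable lebesgue (\<lambda>y. \<rho> (y - x) *\<^sub>R g x)" using sh by auto
    have "Dv x - g x = (LINT y|lebesgue. \<rho> (y - x) *\<^sub>R G0 y - \<rho> (y - x) *\<^sub>R g x)"
      unfolding Dv[OF x] using i\<rho>G ic sh by simp
    also have "norm \<dots> \<le> (LINT y|lebesgue. d y * \<rho> (y - x) + \<gamma> * \<rho> (y - x))"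
    proof (rule norm_integral_le)
      fix y
      show "norm (\<rho> (y - x) *\<^sub>R G0 y - \<rho> (y - x) *\<^sub>R g x) \<le> d y * \<rho> (y - x) + \<gamma> * \<rho> (y - x)"
      proof (cases "\<epsilon> \<le> norm (y - x)")
        case False
        then have yx: "y \<in> K2" "dist y x < d2"
          using K2[OF x] \<epsilon> r x by (auto simp: dist_norm norm_minus_commute subset_iff)
        have "norm (G0 y - g x) \<le> norm (G0 y - g y) + norm (g y - g x)"
          using dist_triangle[of "G0 y" "g x" "g y"] by (simp add: dist_norm)
        also have "\<dots> \<le> d y + \<gamma>" using d2(2)[OF xK2 yx] yx(1) by (simp add: d_def dist_norm)
        finally have "norm (G0 y - g x) * \<rho> (y - x) \<le> (d y + \<gamma>) * \<rho> (y - x)"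
          using \<rho>(3) by (intro mult_right_mono) auto
        moreover have "norm (\<rho> (y - x) *\<^sub>R G0 y - \<rho> (y - x) *\<^sub>R g x) = norm (G0 y - g x) * \<rho> (y - x)"
          using \<rho>(3) by (simp add: scaleR_diff_right[symmetric])
        ultimately show ?thesis by (simp add: distrib_right)
      qed (use \<rho>(4) in auto)
    qed (use i\<rho>G ic i\<rho>[OF di] sh in auto)
    also have "\<dots> = (LINT y|lebesgue. d y * \<rho> (y - x)) + \<gamma>" using i\<rho>[OF di] sh by simp
    finally have 1: "norm (Dv x - g x) \<le> (LINT y|lebesgue. d y * \<rho> (y - x)) + \<gamma>" .
    have "norm (g x - G x) = d x" using xK2 by (simp add: d_def G0_def norm_minus_commute)
    then show ?thesis using 1 dist_triangle[of "Dv x" "G x" "g x"] by (simp add: dist_norm)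
  qed
  define c where "c = \<tau> powr (1 - p)"
  define F where "F x = 2 * \<tau> * H x powr p + c * m x + \<gamma> * H x powr (p - 1) + c * d x powr p" for x
  have Fi: "integrable lebesgue F" unfolding F_def using H(4) mi Hi dpi by auto
  have mnn: "0 \<le> m x" for x unfolding m_def by (intro integral_nonneg_AE) (auto simp: \<rho>)
  have cnn: "0 \<le> c" by (simp add: c_def)
  have Fnn: "0 \<le> F x" for x unfolding F_def using \<tau> mnn cnn by auto
  have le: "H x powr (p - 1) * norm (Dv x - G x) \<le> F x" for x
  proof (cases "x \<in> K")
    case True
    have "H x powr (p - 1) * (LINT y|lebesgue. d y * \<rho> (y - x)) = (LINT y|lebesgue. H x powr (p - 1) * (d y * \<rho> (y - x)))"
      by simp
    also have "\<dots> \<le> (LINT y|lebesgue. \<tau> * H x powr p * \<rho> (y - x) + c * (d y powr p * \<rho> (y - x)))"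
    proof (rule integral_mono)
      fix y
      have "H x powr (p - 1) * d y * \<rho> (y - x) \<le> (\<tau> * H x powr p + c * d y powr p) * \<rho> (y - x)"
        unfolding c_def using \<rho>(3) Young_weighted[OF H(2)[of x] dnn[of y] \<tau>(1) p] by (intro mult_right_mono) auto
      then show "H x powr (p - 1) * (d y * \<rho> (y - x)) \<le> \<tau> * H x powr p * \<rho> (y - x) + c * (d y powr p * \<rho> (y - x))"
        by (simp add: algebra_simps)
    qed (use i\<rho>[OF di] i\<rho>[OF dpi] sh in auto)
    also have "\<dots> = \<tau> * H x powr p + c * m x" unfolding m_def using i\<rho>[OF dpi] sh by simp
    finally have 1: "H x powr (p - 1) * (LINT y|lebesgue. d y * \<rho> (y - x)) \<le> \<tau> * H x powr p + c * m x" .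
    have 2: "H x powr (p - 1) * d x \<le> \<tau> * H x powr p + c * d x powr p"
      unfolding c_def by (rule Young_weighted[OF H(2) dnn \<tau>(1) p])
    have "H x powr (p - 1) * norm (Dv x - G x) \<le> H x powr (p - 1) * ((LINT y|lebesgue. d y * \<rho> (y - x)) + \<gamma> + d x)"
      using DvG[OF True] by (intro mult_left_mono) auto
    also have "\<dots> \<le> F x" unfolding F_def using 1 2 by (simp add: algebra_simps)
    finally show ?thesis .
  qed (use H(3) Fnn p in auto)
  have [measurable]: "Dv \<in> borel_measurable lebesgue" by (rule borel_measurable_lebesgue_continuous[OF cDv])
  have G0eq: "(\<lambda>x. H x powr (p - 1) * norm (Dv x - G x)) = (\<lambda>x. H x powr (p - 1) * norm (Dv x - G0 x))"
  proof
    fix x show "H x powr (p - 1) * norm (Dv x - G x) = H x powr (p - 1) * norm (Dv x - G0 x)"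
    proof (cases "x \<in> K")
      case True
      then have "x \<in> K2" using K2[of x] r centre_in_cball[of x r] by auto
      then show ?thesis by (simp add: G0_def)
    qed (use H(3)[of x] in simp)
  qed
  have int: "integrable lebesgue (\<lambda>x. H x powr (p - 1) * norm (Dv x - G x))"
  proof (rule Bochner_Integration.integrable_bound[OF Fi])
    show "(\<lambda>x. H x powr (p - 1) * norm (Dv x - G x)) \<in> borel_measurable lebesgue"
      unfolding G0eq by measurable
  qed (use le Fnn in auto)
  have "(LINT x|lebesgue. H x powr (p - 1) * norm (Dv x - G x)) \<le> (LINT x|lebesgue. F x)"
    by (rule integral_mono[OF int Fi le])
  also have "\<dots> = 2 * \<tau> * I + c * (LINT y|lebesgue. d y powr p) + \<gamma> * J + c * (LINT y|lebesgue. d y powr p)"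
    unfolding F_def I_def J_def using H(4) mi Hi dpi by simp
  also have "\<dots> \<le> e / 3 + e / 6 + e / 3 + e / 6"
  proof -
    have "2 * \<tau> * I \<le> e / 3" using e I by (simp add: \<tau>_def field_simps)
    moreover have "\<gamma> * J \<le> e / 3" using e J by (simp add: \<gamma>_def field_simps)
    moreover have "c * (LINT y|lebesgue. d y powr p) \<le> c * (e * \<tau> powr (p - 1) / 6)"
      using gle cnn unfolding dp by (intro mult_left_mono) auto
    moreover have "c * (e * \<tau> powr (p - 1) / 6) = e / 6"
      unfolding c_def using \<tau> by (simp add: powr_add[symmetric])
    ultimately show ?thesis by linarith
  qed
  also have "\<dots> = e" by simp
  finally show thesis using that[OF gv cDv vu int] by simp
qed

section \<open>The weak comparison principle\<close>

text \<open>
  The \<open>p\<close>-Laplacian of a function is the divergence of this field along its gradient.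
\<close>

definition p_flux :: "real \<Rightarrow> 'a::euclidean_space \<Rightarrow> 'a" where
  "p_flux p a = norm a powr (p - 2) *\<^sub>R a"

lemma norm_p_flux: "norm (p_flux p a) = norm a powr (p - 1)"
proof (cases "a = 0")
  case False
  then have "norm a powr (p - 2) * norm a powr 1 = norm a powr (p - 1)" by (subst powr_add[symmetric]) simp
  then show ?thesis using False by (simp add: p_flux_def)
qed (simp add: p_flux_def)

text \<open>
  By the Cauchy-Schwarz inequality this reduces to the norms, for which it says that
  \<open>r powr (p - 1)\<close> is nondecreasing in \<open>r\<close>.
\<close>

lemma p_flux_monotone:
  assumes "1 < p"
  shows "0 \<le> (p_flux p a - p_flux p b) \<bullet> (a - b)"
proof -
  define \<alpha> \<beta> where "\<alpha> = norm a powr (p - 2)" and "\<beta> = norm b powr (p - 2)"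
  have e: "\<alpha> * norm a = norm a powr (p - 1)" "\<beta> * norm b = norm b powr (p - 1)"
    using norm_p_flux[of p a] norm_p_flux[of p b] by (auto simp: p_flux_def \<alpha>_def \<beta>_def)
  have "0 \<le> (norm a powr (p - 1) - norm b powr (p - 1)) * (norm a - norm b)"
  proof (cases "norm a \<le> norm b")
    case True
    then have "norm a powr (p - 1) \<le> norm b powr (p - 1)" using assms by (intro powr_mono2) auto
    then show ?thesis using True by (intro mult_nonpos_nonpos) auto
  next
    case False
    then have "norm b powr (p - 1) \<le> norm a powr (p - 1)" using assms by (intro powr_mono2) auto
    then show ?thesis using False by (intro mult_nonneg_nonneg) auto
  qed
  also have "\<dots> = (\<alpha> * norm a - \<beta> * norm b) * (norm a - norm b)" using e by simp
  also have "\<dots> = \<alpha> * (norm a * norm a) + \<beta> * (norm b * norm b) - (\<alpha> + \<beta>) * (norm a * norm b)"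
    by (simp add: algebra_simps)
  also have "\<dots> \<le> \<alpha> * (norm a * norm a) + \<beta> * (norm b * norm b) - (\<alpha> + \<beta>) * (a \<bullet> b)"
    using norm_cauchy_schwarz[of a b] by (intro diff_left_mono mult_left_mono) (auto simp: \<alpha>_def \<beta>_def)
  also have "\<dots> = (p_flux p a - p_flux p b) \<bullet> (a - b)"
    unfolding p_flux_def \<alpha>_def[symmetric] \<beta>_def[symmetric]
    by (simp add: inner_diff_left inner_diff_right inner_commute dot_square_norm power2_eq_square algebra_simps)
  finally show ?thesis .
qed

lemma p_flux_0 [simp]: "p_flux p 0 = 0" by (simp add: p_flux_def)

lemma p_flux_uminus: "p_flux p (- a) = - p_flux p a" by (simp add: p_flux_def)

lemma borel_measurable_p_flux [measurable]:
  assumes [measurable]: "g \<in> borel_measurable M"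
  shows "(\<lambda>x. p_flux p (g x)) \<in> borel_measurable M"
  unfolding p_flux_def by measurable

lemma compact_bounded_above:
  fixes h :: "'a::topological_space \<Rightarrow> 'b::real_normed_vector"
  assumes "compact K" "continuous_on K h"
  obtains B where "0 < B" "\<And>x. x \<in> K \<Longrightarrow> norm (h x) \<le> B"
  using compact_imp_bounded[OF compact_continuous_image[OF assms(2,1)]] bounded_pos
  by (metis imageI)

text \<open>
  Because \<open>s \<le> 0\<close> on the part of \<open>U\<close> outside \<open>K\<close>, the cut-off at the boundary of \<open>K\<close> is invisible: the
  function agrees with the squared positive part on \<open>U\<close> and with zero on the complement of \<open>K\<close>, and
  these two open sets cover the space.
\<close>

lemma C1_0_truncated:
  fixes K :: "'a::euclidean_space set"
  assumes U: "open U" "K \<subseteq> U" and K: "compact K"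
    and g: "\<And>x. x \<in> U \<Longrightarrow> GDERIV s x :> Ds x" "continuous_on U Ds"
    and s: "\<And>x. x \<in> U - K \<Longrightarrow> s x \<le> 0"
  shows "C1_0 U (\<lambda>x. if x \<in> K then (max 0 (s x))\<^sup>2 else 0) (\<lambda>x. if x \<in> K then (2 * max 0 (s x)) *\<^sub>R Ds x else 0)"
    (is "C1_0 U ?w ?Dw")
  unfolding C1_0_def
proof (intro conjI allI)
  have oK: "open (- K)" using K by (simp add: compact_imp_closed open_Compl)
  fix x
  show "GDERIV ?w x :> ?Dw x"
  proof (cases "x \<in> U")
    case True
    have "GDERIV (\<lambda>x. (max 0 (s x))\<^sup>2) x :> (2 * max 0 (s x)) *\<^sub>R Ds x"
      by (rule GDERIV_pos_part_square[OF g(1)[OF True]])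
    then have "(?w has_derivative (\<lambda>h. h \<bullet> ((2 * max 0 (s x)) *\<^sub>R Ds x))) (at x)"
      unfolding gderiv_def
      by (rule has_derivative_transform_within_open[OF _ U(1) True]) (use s in auto)
    moreover have "(2 * max 0 (s x)) *\<^sub>R Ds x = ?Dw x" using s True by auto
    ultimately show ?thesis unfolding gderiv_def by simp
  next
    case False
    then have x: "x \<in> - K" using U by auto
    have "((\<lambda>x. 0::real) has_derivative (\<lambda>h. 0)) (at x)" by simp
    then have "(?w has_derivative (\<lambda>h. 0)) (at x)"
      by (rule has_derivative_transform_within_open[OF _ oK x]) auto
    then show ?thesis using x by (simp add: gderiv_def)
  qed
next
  have oK: "open (- K)" using K by (simp add: compact_imp_closed open_Compl)
  have cs: "continuous_on U s"
    using g(1) GDERIV_imp_isCont by (intro continuous_at_imp_continuous_on) blast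
  have 1: "continuous_on U ?Dw"
  proof (rule continuous_on_eq)
    show "continuous_on U (\<lambda>x. (2 * max 0 (s x)) *\<^sub>R Ds x)"
      by (intro continuous_intros cs g(2))
  qed (use s in auto)
  have 2: "continuous_on (- K) ?Dw" by (rule continuous_on_eq[of _ "\<lambda>x. 0"]) auto
  have "continuous_on (U \<union> - K) ?Dw" using continuous_on_open_Un[OF U(1) oK 1 2] .
  moreover have "U \<union> - K = UNIV" using U by auto
  ultimately show "continuous_on UNIV ?Dw" by simp
  have cl: "closure {x. ?w x \<noteq> 0} \<subseteq> K"
    by (rule closure_minimal) (use K in \<open>auto simp: compact_imp_closed\<close>)
  then show "compact (closure {x. ?w x \<noteq> 0})"
    using K by (meson bounded_subset closed_closure compact_eq_bounded_closed)
  show "closure {x. ?w x \<noteq> 0} \<subseteq> U" using cl U by auto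
qed

lemma C1_0_mono: "C1_0 U w Dw \<Longrightarrow> U \<subseteq> V \<Longrightarrow> C1_0 V w Dw"
  unfolding C1_0_def by auto

text \<open>
  Here \<open>u\<close> solves an equation with right-hand side \<open>F\<close>, and the barrier \<open>\<Phi>\<close> one with right-hand side
  \<open>f\<close>; the barrier is strict in the sense that \<open>f < F\<close> wherever \<open>u\<close> exceeds \<open>\<Phi> + \<delta>\<close>. Subtracting
  the two equations, tested with the squared positive part \<open>w0\<close> of \<open>u - \<Phi> - \<delta>\<close>, would give a
  nonnegative left-hand side by monotonicity of the flux, and minus the integral of \<open>(F - f) * w0\<close>
  on the right; hence \<open>w0\<close> vanishes almost everywhere, and everywhere by continuity. The actual test
  functions are built from a smooth approximation of \<open>u\<close> with error \<open>e\<close>. They are admissible because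
  \<open>u - \<Phi>\<close> stays below the level \<open>\<delta>\<close> by the margin \<open>\<delta> - \<delta>'\<close> on the part of \<open>U\<close> outside \<open>K\<close>, and they
  lead to the same conclusion up to an error \<open>e * C\<close>.
\<close>

lemma weak_comparison:
  fixes u \<Phi> F f :: "'a::euclidean_space \<Rightarrow> real"
  assumes \<Omega>: "open \<Omega>" and p: "1 < p" and u: "continuous_on \<Omega> u" and wg: "weak_gradient_on \<Omega> u G"
    and Gp: "locally_integrable_on \<Omega> (\<lambda>x. norm (G x) powr p)"
    and eq: "\<And>w Dw. C1_0 \<Omega> w Dw \<Longrightarrow> (\<And>x. 0 \<le> w x) \<Longrightarrow>
        (LINT x:\<Omega>|lebesgue. p_flux p (G x) \<bullet> Dw x) = - (LINT x:\<Omega>|lebesgue. F x * w x)"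
    and Fm: "F \<in> borel_measurable (lebesgue_on \<Omega>)" and Fb: "bounded (F ` \<Omega>)"
    and UK: "open U" "compact K" "K \<subseteq> U" "U \<subseteq> \<Omega>"
    and \<Phi>: "\<And>x. x \<in> U \<Longrightarrow> GDERIV \<Phi> x :> D\<Phi> x" "continuous_on U D\<Phi>"
    and flux: "\<And>w Dw. C1_0 U w Dw \<Longrightarrow>
        (LINT x:U|lebesgue. p_flux p (D\<Phi> x) \<bullet> Dw x) = - (LINT x:U|lebesgue. f x * w x)"
    and fc: "continuous_on U f"
    and bd: "\<And>x. x \<in> U - K \<Longrightarrow> u x \<le> \<Phi> x + \<delta>'" and \<delta>: "\<delta>' < \<delta>"
    and strict: "\<And>x. x \<in> K \<Longrightarrow> u x > \<Phi> x + \<delta> \<Longrightarrow> f x < F x"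
    and y: "y \<in> U"
  shows "u y \<le> \<Phi> y + \<delta>"
proof (rule ccontr)
  assume contra: "\<not> u y \<le> \<Phi> y + \<delta>"
  obtain r where r: "0 < r" "(\<Union>x\<in>K. cball x r) \<subseteq> U"
    using compact_subset_open_imp_cball_epsilon_subset[OF UK(2,1,3)] by blast
  define K' where "K' = {x + y | x y. x \<in> K \<and> y \<in> cball 0 r}"
  have K'c: "compact K'" unfolding K'_def by (intro compact_sums UK) auto
  define V where "V = (\<Union>x\<in>K. ball x r)"
  have Vo: "open V" unfolding V_def by auto
  have KV: "K \<subseteq> V" unfolding V_def using r by auto
  have VU: "V \<subseteq> U" unfolding V_def using r by (force simp: subset_iff)
  have VK': "V \<subseteq> K'"
  proof
    fix z assume "z \<in> V"
    then obtain x where "x \<in> K" "z \<in> ball x r" unfolding V_def by auto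
    then have "z = x + (z - x)" "z - x \<in> cball 0 r" by (auto simp: dist_norm norm_minus_commute)
    then show "z \<in> K'" unfolding K'_def using \<open>x \<in> K\<close> by blast
  qed
  have K'U: "K' \<subseteq> U"
  proof
    fix z assume "z \<in> K'"
    then obtain x y where "x \<in> K" "z = x + y" "norm y \<le> r" unfolding K'_def by auto
    then have "z \<in> cball x r" by (simp add: dist_norm)
    then show "z \<in> U" using r \<open>x \<in> K\<close> by blast
  qed
  have K'm[measurable]: "K' \<in> sets lebesgue"
    using K'c by (simp add: compact_imp_closed borel_closed sets_completionI_sets)
  have Km[measurable]: "K \<in> sets lebesgue"
    using UK(2) by (simp add: compact_imp_closed borel_closed sets_completionI_sets)
  have KK': "K \<subseteq> K'" using KV VK' by auto
  have K'\<Omega>: "K' \<subseteq> \<Omega>" "K \<subseteq> \<Omega>" using K'U UK by auto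
  have c\<Phi>: "continuous_on U \<Phi>"
    using \<Phi>(1) GDERIV_imp_isCont by (intro continuous_at_imp_continuous_on) blast
  obtain M where M: "0 < M" "\<And>x. x \<in> K' \<Longrightarrow> norm (D\<Phi> x) \<le> M"
    using compact_bounded_above[OF K'c continuous_on_subset[OF \<Phi>(2) K'U]] by blast
  define s where "s x = u x - \<Phi> x - \<delta>" for x
  have sc: "continuous_on K' s"
    unfolding s_def by (intro continuous_intros continuous_on_subset[OF u K'\<Omega>(1)] continuous_on_subset[OF c\<Phi> K'U])
  obtain S where S: "0 < S" "\<And>x. x \<in> K' \<Longrightarrow> norm (s x) \<le> S"
    using compact_bounded_above[OF K'c sc] by blast
  obtain Bf where Bf: "0 < Bf" "\<And>x. x \<in> K' \<Longrightarrow> norm (f x) \<le> Bf"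
    using compact_bounded_above[OF K'c continuous_on_subset[OF fc K'U]] by blast
  obtain BF where BF: "0 < BF" "\<And>x. x \<in> \<Omega> \<Longrightarrow> norm (F x) \<le> BF"
    using Fb unfolding bounded_pos by auto
  define g0 where "g0 x = indicator K' x *\<^sub>R G x" for x
  define \<phi>0 where "\<phi>0 x = indicator K' x *\<^sub>R D\<Phi> x" for x
  have g0i: "integrable lebesgue g0"
    using wg K'c K'\<Omega> unfolding weak_gradient_on_def locally_integrable_on_def set_integrable_def g0_def by blast
  have g0m[measurable]: "g0 \<in> borel_measurable lebesgue" using g0i by auto
  have "integrable lebesgue (\<lambda>x. indicator K' x *\<^sub>R norm (G x) powr p)"
    using Gp K'c K'\<Omega> unfolding locally_integrable_on_def set_integrable_def by blast
  moreover have "(\<lambda>x. indicator K' x *\<^sub>R norm (G x) powr p) = (\<lambda>x. norm (g0 x) powr p)"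
    using p by (auto simp: g0_def fun_eq_iff indicator_def)
  ultimately have g0p: "integrable lebesgue (\<lambda>x. norm (g0 x) powr p)" by simp
  have "integrable lebesgue \<phi>0"
  proof (rule integrable_lebesgue_compact_support[OF K'c])
    show "continuous_on K' \<phi>0"
      by (rule continuous_on_eq[OF continuous_on_subset[OF \<Phi>(2) K'U]]) (auto simp: \<phi>0_def)
  qed (auto simp: \<phi>0_def)
  then have \<phi>0m[measurable]: "\<phi>0 \<in> borel_measurable lebesgue" by auto
  have K'i: "integrable lebesgue (indicator K' :: 'a \<Rightarrow> real)"
    using integrable_lebesgue_compact_support[OF K'c, of "indicator K' :: 'a \<Rightarrow> real"]
    by (auto simp: indicator_def)
  \<comment> \<open>A weight that dominates both gradients, so that both fluxes are bounded by \<open>H powr (p - 1)\<close>.\<close>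
  define H where "H x = indicator K' x * max M (norm (g0 x))" for x
  have Hm[measurable]: "H \<in> borel_measurable lebesgue" unfolding H_def by measurable
  have Hnn: "0 \<le> H x" for x using M by (auto simp: H_def)
  have H0: "H x = 0" if "x \<notin> K'" for x using that by (simp add: H_def)
  have Hp: "integrable lebesgue (\<lambda>x. H x powr p)"
  proof (rule Bochner_Integration.integrable_bound)
    show "integrable lebesgue (\<lambda>x. indicator K' x * M powr p + norm (g0 x) powr p)" using K'i g0p by auto
    show "AE x in lebesgue. norm (H x powr p) \<le> norm (indicator K' x * M powr p + norm (g0 x) powr p)"
      by (rule AE_I2) (auto simp: H_def indicator_def max_def)
  qed measurable
  define I where "I = (LINT x|lebesgue. H x powr p)"
  have HK: "norm (g0 x) \<le> H x" "norm (\<phi>0 x) \<le> H x" for x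
    using M(2)[of x] by (cases "x \<in> K'"; simp add: H_def g0_def \<phi>0_def)+
  have fluxH: "norm (p_flux p (g0 x)) \<le> H x powr (p - 1)" "norm (p_flux p (\<phi>0 x)) \<le> H x powr (p - 1)" for x
    unfolding norm_p_flux using HK[of x] p by (auto intro!: powr_mono2)
  have HH: "H x powr (p - 1) * H x = H x powr p" for x
    using Hnn[of x] by (cases "H x = 0") (auto simp: powr_diff)
  define F0 where "F0 x = indicator K x * F x" for x
  define f0 where "f0 x = indicator K x * f x" for x
  have Ki: "integrable lebesgue (indicator K :: 'a \<Rightarrow> real)"
    using integrable_lebesgue_compact_support[OF UK(2), of "indicator K :: 'a \<Rightarrow> real"]
    by (auto simp: indicator_def)
  have "(\<lambda>x. indicator \<Omega> x *\<^sub>R F x) \<in> borel_measurable lebesgue"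
    using Fm \<Omega> by (subst (asm) borel_measurable_restrict_space_iff) (auto simp: borel_open sets_completionI_sets)
  then have "(\<lambda>x. indicator K x * (indicator \<Omega> x *\<^sub>R F x)) \<in> borel_measurable lebesgue" by measurable
  moreover have "(\<lambda>x. indicator K x * (indicator \<Omega> x *\<^sub>R F x)) = F0"
    using K'\<Omega> by (auto simp: F0_def fun_eq_iff indicator_def)
  ultimately have F0m[measurable]: "F0 \<in> borel_measurable lebesgue" by simp
  have f0i: "integrable lebesgue f0"
  proof (rule integrable_lebesgue_compact_support[OF UK(2)])
    show "continuous_on K f0"
      by (rule continuous_on_eq[OF continuous_on_subset[OF fc UK(3)]]) (auto simp: f0_def)
  qed (auto simp: f0_def)
  then have f0m[measurable]: "f0 \<in> borel_measurable lebesgue" by auto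
  have Ff: "\<bar>F0 x\<bar> \<le> BF" "\<bar>f0 x\<bar> \<le> Bf" for x
    using BF Bf K'\<Omega> KK' by (auto simp: F0_def f0_def indicator_def)
  define w0 where "w0 x = (if x \<in> K then (max 0 (s x))\<^sup>2 else 0)" for x
  have w0i: "integrable lebesgue w0"
  proof (rule integrable_lebesgue_compact_support[OF UK(2)])
    show "continuous_on K w0"
      by (rule continuous_on_eq[where f="\<lambda>x. (max 0 (s x))\<^sup>2"])
        (auto simp: w0_def intro!: continuous_intros continuous_on_subset[OF sc KK'])
  qed (auto simp: w0_def)
  have Fw: "integrable lebesgue (\<lambda>x. F0 x * w x)" "integrable lebesgue (\<lambda>x. f0 x * w x)"
    if "integrable lebesgue w" for w :: "'a \<Rightarrow> real"
  proof -
    have [measurable]: "w \<in> borel_measurable lebesgue" using that by auto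
    show "integrable lebesgue (\<lambda>x. F0 x * w x)"
      by (rule Bochner_Integration.integrable_bound[of _ "\<lambda>x. BF * w x"])
        (use that Ff(1) BF in \<open>auto simp: abs_mult intro!: AE_I2 mult_right_mono\<close>)
    show "integrable lebesgue (\<lambda>x. f0 x * w x)"
      by (rule Bochner_Integration.integrable_bound[of _ "\<lambda>x. Bf * w x"])
        (use that Ff(2) Bf in \<open>auto simp: abs_mult intro!: AE_I2 mult_right_mono\<close>)
  qed
  define L where "L = (LINT x|lebesgue. (F0 x - f0 x) * w0 x)"
  define m where "m = (LINT x|lebesgue. indicator K x :: real)"
  define C where "C = 4 * (S + 1) + 8 * I + (BF + Bf) * (2 * S + 1) * m"
  have key: "L \<le> e * C" if e: "0 < e" "e \<le> 1" "e \<le> \<delta> - \<delta>'" for e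
  proof -
    obtain v Dv where v: "\<And>x. GDERIV v x :> Dv x" "continuous_on UNIV Dv"
      "\<And>x. x \<in> K' \<Longrightarrow> \<bar>v x - u x\<bar> \<le> e"
      "integrable lebesgue (\<lambda>x. H x powr (p - 1) * norm (Dv x - G x))"
      "(LINT x|lebesgue. H x powr (p - 1) * norm (Dv x - G x)) \<le> e"
      using smooth_approximation[OF \<Omega> u wg Gp p K'c K'\<Omega>(1) Hm Hnn H0 Hp e(1)] by blast
    define sv where "sv x = v x - \<Phi> x - \<delta>" for x
    define w where "w x = (if x \<in> K then (max 0 (sv x))\<^sup>2 else 0)" for x
    define Dw where "Dw x = (if x \<in> K then (2 * max 0 (sv x)) *\<^sub>R (Dv x - D\<Phi> x) else 0)" for x
    have C1V: "C1_0 V w Dw"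
      unfolding w_def Dw_def
    proof (rule C1_0_truncated[OF Vo KV UK(2)])
      show "GDERIV sv x :> Dv x - D\<Phi> x" if "x \<in> V" for x
      proof -
        have "GDERIV (\<lambda>x. v x - \<Phi> x - \<delta>) x :> Dv x - D\<Phi> x - 0"
          using that VU by (intro GDERIV_diff v \<Phi> GDERIV_const) auto
        then show ?thesis unfolding sv_def by simp
      qed
      show "continuous_on V (\<lambda>x. Dv x - D\<Phi> x)"
        by (intro continuous_intros continuous_on_subset[OF v(2)] continuous_on_subset[OF \<Phi>(2) VU]) auto
      show "sv x \<le> 0" if "x \<in> V - K" for x
      proof -
        have "u x \<le> \<Phi> x + \<delta>'" using bd[of x] that VU by auto
        moreover have "\<bar>v x - u x\<bar> \<le> e" using v(3)[of x] that VK' by auto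
        ultimately show ?thesis unfolding sv_def using e by linarith
      qed
    qed
    have E1: "(LINT x:\<Omega>|lebesgue. p_flux p (G x) \<bullet> Dw x) = - (LINT x:\<Omega>|lebesgue. F x * w x)"
      by (rule eq[OF C1_0_mono[OF C1V]]) (use VU UK in \<open>auto simp: w_def\<close>)
    have E2: "(LINT x:U|lebesgue. p_flux p (D\<Phi> x) \<bullet> Dw x) = - (LINT x:U|lebesgue. f x * w x)"
      by (rule flux[OF C1_0_mono[OF C1V VU]])
    have r1: "(LINT x:\<Omega>|lebesgue. p_flux p (G x) \<bullet> Dw x) = (LINT x|lebesgue. p_flux p (g0 x) \<bullet> Dw x)"
      unfolding set_lebesgue_integral_def using K'\<Omega> KK'
      by (intro Bochner_Integration.integral_cong) (auto simp: indicator_def g0_def Dw_def)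
    have r2: "(LINT x:U|lebesgue. p_flux p (D\<Phi> x) \<bullet> Dw x) = (LINT x|lebesgue. p_flux p (\<phi>0 x) \<bullet> Dw x)"
      unfolding set_lebesgue_integral_def using K'U KK'
      by (intro Bochner_Integration.integral_cong) (auto simp: indicator_def \<phi>0_def Dw_def)
    have r3: "(LINT x:\<Omega>|lebesgue. F x * w x) = (LINT x|lebesgue. F0 x * w x)"
      unfolding set_lebesgue_integral_def using K'\<Omega> KK'
      by (intro Bochner_Integration.integral_cong) (auto simp: indicator_def F0_def w_def)
    have r4: "(LINT x:U|lebesgue. f x * w x) = (LINT x|lebesgue. f0 x * w x)"
      unfolding set_lebesgue_integral_def using K'U KK'
      by (intro Bochner_Integration.integral_cong) (auto simp: indicator_def f0_def w_def)
    have Dwc: "continuous_on UNIV Dw" using C1V unfolding C1_0_def by auto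
    have Dwm[measurable]: "Dw \<in> borel_measurable lebesgue"
      by (rule borel_measurable_lebesgue_continuous[OF Dwc])
    have wi: "integrable lebesgue w"
    proof (rule integrable_lebesgue_compact_support[OF UK(2)])
      have "continuous_on UNIV w" using C1V GDERIV_imp_isCont continuous_at_imp_continuous_on
        unfolding C1_0_def by blast
      then show "continuous_on K w" by (rule continuous_on_subset) auto
    qed (auto simp: w_def)
    have svs: "\<bar>sv x - s x\<bar> \<le> e" "\<bar>sv x\<bar> \<le> S + 1" if "x \<in> K'" for x
      using v(3)[OF that] S(2)[OF that] e by (auto simp: sv_def s_def)
    let ?N = "\<lambda>x. H x powr (p - 1) * norm (Dv x - G x)"
    have Dwb: "H x powr (p - 1) * norm (Dw x) \<le> 2 * (S + 1) * (?N x + 2 * H x powr p)" for x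
    proof (cases "x \<in> K")
      case True
      then have x: "x \<in> K'" using KK' by auto
      have "norm (Dv x - D\<Phi> x) \<le> norm (Dv x - G x) + norm (G x - D\<Phi> x)"
        using dist_triangle[of "Dv x" "D\<Phi> x" "G x"] by (simp add: dist_norm)
      also have "norm (G x - D\<Phi> x) \<le> 2 * H x"
        using norm_triangle_ineq4[of "G x" "D\<Phi> x"] HK[of x] x by (simp add: g0_def \<phi>0_def)
      finally have "norm (Dv x - D\<Phi> x) \<le> norm (Dv x - G x) + 2 * H x" by simp
      then have "2 * max 0 (sv x) * norm (Dv x - D\<Phi> x) \<le> 2 * (S + 1) * (norm (Dv x - G x) + 2 * H x)"
        using svs(2)[OF x] S by (intro mult_mono) auto
      moreover have "norm (Dw x) = 2 * max 0 (sv x) * norm (Dv x - D\<Phi> x)" using True by (simp add: Dw_def)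
      ultimately have "norm (Dw x) \<le> 2 * (S + 1) * (norm (Dv x - G x) + 2 * H x)" by simp
      then have "H x powr (p - 1) * norm (Dw x) \<le> H x powr (p - 1) * (2 * (S + 1) * (norm (Dv x - G x) + 2 * H x))"
        by (intro mult_left_mono) auto
      also have "\<dots> = 2 * (S + 1) * (?N x + 2 * (H x powr (p - 1) * H x))" by (simp add: algebra_simps)
      finally show ?thesis unfolding HH .
    next
      case False
      then have "norm (Dw x) = 0" by (simp add: Dw_def)
      then show ?thesis using S by simp
    qed
    have Nb: "integrable lebesgue (\<lambda>x. 2 * (S + 1) * (?N x + 2 * H x powr p))" using v(4) Hp by auto
    have fi: "integrable lebesgue (\<lambda>x. b x \<bullet> Dw x)"
      if [measurable]: "b \<in> borel_measurable lebesgue" and b: "\<And>x. norm (b x) \<le> H x powr (p - 1)" for b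
    proof (rule Bochner_Integration.integrable_bound[OF Nb])
      show "AE x in lebesgue. norm (b x \<bullet> Dw x) \<le> norm (2 * (S + 1) * (?N x + 2 * H x powr p))"
      proof (rule AE_I2)
        fix x
        have "norm (b x \<bullet> Dw x) \<le> norm (b x) * norm (Dw x)" using Cauchy_Schwarz_ineq2 by simp
        also have "\<dots> \<le> H x powr (p - 1) * norm (Dw x)" using b by (intro mult_right_mono) auto
        also note Dwb[of x]
        finally show "norm (b x \<bullet> Dw x) \<le> norm (2 * (S + 1) * (?N x + 2 * H x powr p))" by simp
      qed
    qed measurable
    have i1: "integrable lebesgue (\<lambda>x. p_flux p (g0 x) \<bullet> Dw x)" by (rule fi) (use fluxH in auto)
    have i2: "integrable lebesgue (\<lambda>x. p_flux p (\<phi>0 x) \<bullet> Dw x)" by (rule fi) (use fluxH in auto)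
    have "(LINT x|lebesgue. (p_flux p (g0 x) - p_flux p (\<phi>0 x)) \<bullet> Dw x) =
      (LINT x|lebesgue. p_flux p (g0 x) \<bullet> Dw x) - (LINT x|lebesgue. p_flux p (\<phi>0 x) \<bullet> Dw x)"
      unfolding inner_diff_left by (rule Bochner_Integration.integral_diff[OF i1 i2])
    also have "\<dots> = - ((LINT x|lebesgue. F0 x * w x) - (LINT x|lebesgue. f0 x * w x))"
      using E1 E2 unfolding r1 r2 r3 r4 by simp
    also have "(LINT x|lebesgue. F0 x * w x) - (LINT x|lebesgue. f0 x * w x) = (LINT x|lebesgue. (F0 x - f0 x) * w x)"
      unfolding left_diff_distrib by (rule Bochner_Integration.integral_diff[OF Fw[OF wi], symmetric])
    finally have ident: "(LINT x|lebesgue. (p_flux p (g0 x) - p_flux p (\<phi>0 x)) \<bullet> Dw x) = - (LINT x|lebesgue. (F0 x - f0 x) * w x)" .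
    have ia: "integrable lebesgue (\<lambda>x. (p_flux p (g0 x) - p_flux p (\<phi>0 x)) \<bullet> Dw x)"
      unfolding inner_diff_left using i1 i2 by auto
    have "- (e * (4 * (S + 1) + 8 * I)) \<le> (LINT x|lebesgue. - (4 * (S + 1) * ?N x + 8 * e * H x powr p))"
    proof -
      have "(LINT x|lebesgue. - (4 * (S + 1) * ?N x + 8 * e * H x powr p)) = - (4 * (S + 1) * (LINT x|lebesgue. ?N x) + 8 * e * I)"
        unfolding I_def using v(4) Hp by simp
      moreover have "4 * (S + 1) * (LINT x|lebesgue. ?N x) \<le> 4 * (S + 1) * e" using v(5) S by (intro mult_left_mono) auto
      ultimately show ?thesis by (simp add: algebra_simps)
    qed
    also have "\<dots> \<le> (LINT x|lebesgue. (p_flux p (g0 x) - p_flux p (\<phi>0 x)) \<bullet> Dw x)"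
    proof (rule integral_mono)
      fix x
      let ?a = "p_flux p (g0 x) - p_flux p (\<phi>0 x)"
      have a: "norm ?a \<le> 2 * H x powr (p - 1)"
        using norm_triangle_ineq4[of "p_flux p (g0 x)" "p_flux p (\<phi>0 x)"] fluxH[of x] by linarith
      show "- (4 * (S + 1) * ?N x + 8 * e * H x powr p) \<le> ?a \<bullet> Dw x"
      proof (cases "x \<in> K")
        case True
        then have x: "x \<in> K'" using KK' by auto
        let ?d = "G x - D\<Phi> x" and ?n = "Dv x - G x"
        \<comment> \<open>The first summand is the gradient of the ideal test function, where monotonicity applies; the other two are the errors from replacing \<open>u\<close> and its weak gradient.\<close>
        have dec: "Dw x = (2 * max 0 (s x)) *\<^sub>R ?d + (2 * (max 0 (sv x) - max 0 (s x))) *\<^sub>R ?d + (2 * max 0 (sv x)) *\<^sub>R ?n"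
          using True by (simp add: Dw_def algebra_simps)
        have t1: "0 \<le> ?a \<bullet> ((2 * max 0 (s x)) *\<^sub>R ?d)"
          using p_flux_monotone[OF p, of "g0 x" "\<phi>0 x"] x by (simp add: g0_def \<phi>0_def)
        have "\<bar>?a \<bullet> ((2 * (max 0 (sv x) - max 0 (s x))) *\<^sub>R ?d)\<bar> \<le> norm ?a * norm ((2 * (max 0 (sv x) - max 0 (s x))) *\<^sub>R ?d)"
          by (rule Cauchy_Schwarz_ineq2)
        also have "\<dots> \<le> (2 * H x powr (p - 1)) * (2 * e * (2 * H x))"
        proof (rule mult_mono[OF a])
          have "\<bar>max 0 (sv x) - max 0 (s x)\<bar> \<le> e" using svs(1)[OF x] by auto
          moreover have "norm ?d \<le> 2 * H x"
            using norm_triangle_ineq4[of "G x" "D\<Phi> x"] HK[of x] x by (simp add: g0_def \<phi>0_def)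
          ultimately show "norm ((2 * (max 0 (sv x) - max 0 (s x))) *\<^sub>R ?d) \<le> 2 * e * (2 * H x)"
            unfolding norm_scaleR using e by (intro mult_mono) auto
        qed auto
        also have "\<dots> = 8 * e * (H x powr (p - 1) * H x)" by simp
        finally have t2: "\<bar>?a \<bullet> ((2 * (max 0 (sv x) - max 0 (s x))) *\<^sub>R ?d)\<bar> \<le> 8 * e * H x powr p" unfolding HH .
        have "\<bar>?a \<bullet> ((2 * max 0 (sv x)) *\<^sub>R ?n)\<bar> \<le> norm ?a * norm ((2 * max 0 (sv x)) *\<^sub>R ?n)"
          by (rule Cauchy_Schwarz_ineq2)
        also have "\<dots> \<le> (2 * H x powr (p - 1)) * (2 * (S + 1) * norm ?n)"
        proof (rule mult_mono[OF a])
          show "norm ((2 * max 0 (sv x)) *\<^sub>R ?n) \<le> 2 * (S + 1) * norm ?n"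
            unfolding norm_scaleR using svs(2)[OF x] S by (intro mult_right_mono) auto
        qed auto
        also have "\<dots> = 4 * (S + 1) * ?N x" by simp
        finally have t3: "\<bar>?a \<bullet> ((2 * max 0 (sv x)) *\<^sub>R ?n)\<bar> \<le> 4 * (S + 1) * ?N x" .
        show ?thesis unfolding dec inner_add_right using t1 t2 t3 by linarith
      next
        case False
        then have "?a \<bullet> Dw x = 0" by (simp add: Dw_def)
        moreover have "0 \<le> 4 * (S + 1) * ?N x + 8 * e * H x powr p" using S e by simp
        ultimately show ?thesis by linarith
      qed
    qed (use ia v(4) Hp in auto)
    also have "\<dots> = - (LINT x|lebesgue. (F0 x - f0 x) * w x)" by (rule ident)
    finally have low: "(LINT x|lebesgue. (F0 x - f0 x) * w x) \<le> e * (4 * (S + 1) + 8 * I)" by simp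
    have "L \<le> (LINT x|lebesgue. (F0 x - f0 x) * w x + (BF + Bf) * (e * (2 * S + 1)) * indicator K x)"
      unfolding L_def
    proof (rule integral_mono)
      show "integrable lebesgue (\<lambda>x. (F0 x - f0 x) * w0 x)"
        unfolding left_diff_distrib using Fw[OF w0i] by auto
      show "integrable lebesgue (\<lambda>x. (F0 x - f0 x) * w x + (BF + Bf) * (e * (2 * S + 1)) * indicator K x)"
        unfolding left_diff_distrib using Fw[OF wi] Ki by auto
      fix x
      show "(F0 x - f0 x) * w0 x \<le> (F0 x - f0 x) * w x + (BF + Bf) * (e * (2 * S + 1)) * indicator K x"
      proof (cases "x \<in> K")
        case True
        then have x: "x \<in> K'" using KK' by auto
        let ?A = "max 0 (s x)" and ?B = "max 0 (sv x)"
        have "w0 x - w x = (?A - ?B) * (?A + ?B)"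
          using True by (simp add: w0_def w_def power2_eq_square algebra_simps)
        also have "\<bar>\<dots>\<bar> = \<bar>?A - ?B\<bar> * (?A + ?B)" by (simp add: abs_mult)
        also have "\<dots> \<le> e * (2 * S + 1)"
        proof (rule mult_mono)
          show "\<bar>?A - ?B\<bar> \<le> e" using svs(1)[OF x] by auto
          show "?A + ?B \<le> 2 * S + 1" using svs(2)[OF x] S(1) S(2)[OF x] by auto
        qed (use e in auto)
        finally have "\<bar>w0 x - w x\<bar> \<le> e * (2 * S + 1)" .
        moreover have "\<bar>F0 x - f0 x\<bar> \<le> BF + Bf" using Ff[of x] by linarith
        ultimately have "\<bar>F0 x - f0 x\<bar> * \<bar>w0 x - w x\<bar> \<le> (BF + Bf) * (e * (2 * S + 1))"
          using BF Bf by (intro mult_mono) auto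
        then have "(F0 x - f0 x) * (w0 x - w x) \<le> (BF + Bf) * (e * (2 * S + 1))"
          using abs_le_D1 by (simp add: abs_mult[symmetric])
        then show ?thesis using True by (simp add: right_diff_distrib)
      qed (auto simp: w0_def w_def)
    qed
    also have "\<dots> = (LINT x|lebesgue. (F0 x - f0 x) * w x) + (BF + Bf) * (e * (2 * S + 1)) * m"
    proof -
      have "integrable lebesgue (\<lambda>x. (F0 x - f0 x) * w x)"
        unfolding left_diff_distrib using Fw[OF wi] by auto
      then show ?thesis using Ki by (simp add: m_def)
    qed
    also have "\<dots> \<le> e * C" using low unfolding C_def by (simp add: algebra_simps)
    finally show ?thesis .
  qed
  have "L \<le> 0"
  proof (rule ccontr)
    assume "\<not> L \<le> 0"
    define e where "e = min (min 1 (\<delta> - \<delta>')) (L / (2 * (\<bar>C\<bar> + 1)))"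
    have e: "0 < e" "e \<le> 1" "e \<le> \<delta> - \<delta>'" "e \<le> L / (2 * (\<bar>C\<bar> + 1))"
      using \<open>\<not> L \<le> 0\<close> \<delta> by (auto simp: e_def)
    have "L \<le> e * C" by (rule key[OF e(1-3)])
    also have "\<dots> \<le> e * (\<bar>C\<bar> + 1)" using e(1) by (intro mult_left_mono) auto
    also have "\<dots> \<le> L / (2 * (\<bar>C\<bar> + 1)) * (\<bar>C\<bar> + 1)" using e(4) by (intro mult_right_mono) auto
    also have "\<dots> = L / 2" by (simp add: field_simps)
    finally show False using \<open>\<not> L \<le> 0\<close> by simp
  qed
  have pt: "0 \<le> (F0 x - f0 x) * w0 x" for x
  proof (cases "x \<in> K \<and> s x > 0")
    case True
    then have "f x < F x" by (intro strict) (auto simp: s_def)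
    then show ?thesis using True by (simp add: F0_def f0_def w0_def)
  qed (auto simp: w0_def)
  have iL: "integrable lebesgue (\<lambda>x. (F0 x - f0 x) * w0 x)"
    unfolding left_diff_distrib using Fw[OF w0i] by auto
  have "0 \<le> L" unfolding L_def using pt by (intro integral_nonneg_AE) auto
  then have "L = 0" using \<open>L \<le> 0\<close> by simp
  then have ae: "AE x in lebesgue. (F0 x - f0 x) * w0 x = 0"
    unfolding L_def using iL pt by (subst (asm) integral_nonneg_eq_0_iff_AE) auto
  define O' where "O' = {x \<in> U. s x > 0}"
  have "continuous_on U s"
    unfolding s_def by (intro continuous_intros continuous_on_subset[OF u UK(4)] c\<Phi>)
  then have "open O'"
    using continuous_open_preimage[OF _ UK(1) open_greaterThan[of 0], of s]
    by (simp add: O'_def vimage_def Int_def)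
  have yO: "y \<in> O'" using contra y by (auto simp: O'_def s_def)
  have sub: "O' \<subseteq> {x. (F0 x - f0 x) * w0 x \<noteq> 0}"
  proof
    fix x assume "x \<in> O'"
    then have x: "x \<in> U" "s x > 0" by (auto simp: O'_def)
    have "x \<in> K" using bd[of x] x \<delta> by (force simp: s_def)
    moreover from this have "f x < F x" using x by (intro strict) (auto simp: s_def)
    ultimately show "x \<in> {x. (F0 x - f0 x) * w0 x \<noteq> 0}" using x by (simp add: F0_def f0_def w0_def)
  qed
  have [measurable]: "w0 \<in> borel_measurable lebesgue" using w0i by auto
  have "{x. (F0 x - f0 x) * w0 x \<noteq> 0} \<in> null_sets lebesgue"
  proof (subst AE_iff_null_sets)
    have "(\<lambda>x. (F0 x - f0 x) * w0 x) \<in> borel_measurable lebesgue" by measurable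
    from measurable_sets[OF this, of "- {0}"]
    show "{x. (F0 x - f0 x) * w0 x \<noteq> 0} \<in> sets lebesgue" by (simp add: vimage_def Compl_eq)
    show "AE x in lebesgue. x \<notin> {x. (F0 x - f0 x) * w0 x \<noteq> 0}" using ae by simp
  qed
  then have "negligible O'" using sub by (metis negligible_iff_null_sets negligible_subset)
  then show False using open_not_negligible[OF \<open>open O'\<close>] yO by auto
qed

section \<open>Integration by parts for radial fields\<close>

text \<open>
  The difference quotients in direction \<open>b\<close> have integral zero by translation invariance, and they
  converge dominatedly to the derivative.
\<close>

lemma integral_directional_derivative_eq_0:
  fixes f :: "'a::euclidean_space \<Rightarrow> real"
  assumes f': "\<And>x. (f has_derivative f' x) (at x)" and c: "continuous_on UNIV (\<lambda>x. f' x b)"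
    and K: "compact K" "\<And>x. x \<notin> K \<Longrightarrow> f x = 0"
  shows "(LINT x|lebesgue. f' x b) = 0"
proof -
  have oK: "open (- K)" using K by (simp add: compact_imp_closed open_Compl)
  have z: "f' x b = 0" if "x \<notin> K" for x
  proof -
    have "((\<lambda>x. 0::real) has_derivative (\<lambda>h. 0)) (at x)" by simp
    then have "(f has_derivative (\<lambda>h. 0)) (at x)"
      by (rule has_derivative_transform_within_open[OF _ oK]) (use K that in auto)
    from has_derivative_unique[OF this f'] show ?thesis by metis
  qed
  obtain M where M: "0 < M" "\<And>x. x \<in> K \<Longrightarrow> norm (f' x b) \<le> M"
    using compact_bounded_above[OF K(1) continuous_on_subset[OF c]] by blast
  have Mb: "\<bar>f' x b\<bar> \<le> M" for x using M z[of x] by (cases "x \<in> K") auto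
  have fc: "continuous_on UNIV f"
    using f' has_derivative_continuous continuous_at_imp_continuous_on by blast
  have fi: "integrable lebesgue f"
    by (rule integrable_lebesgue_compact_support[OF K(1) continuous_on_subset[OF fc]]) (use K in auto)
  define K2 where "K2 = {x + y | x y. x \<in> K \<and> y \<in> cball 0 (norm b)}"
  have K2c: "compact K2" unfolding K2_def by (intro compact_sums K) auto
  have K2i: "integrable lebesgue (indicator K2 :: 'a \<Rightarrow> real)"
    using integrable_lebesgue_compact_support[OF K2c, of "indicator K2 :: 'a \<Rightarrow> real"]
    by (auto simp: indicator_def)
  define t where "t n = 1 / real (Suc n)" for n
  have t: "0 < t n" "t n \<le> 1" for n by (auto simp: t_def)
  define h where "h n x = (f (x - (- t n *\<^sub>R b)) - f x) / t n" for n x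
  have shi: "integrable lebesgue (\<lambda>x. f (x - (- t n *\<^sub>R b)))"
    "(LINT x|lebesgue. f (x - (- t n *\<^sub>R b))) = (LINT x|lebesgue. f x)" for n
    using lebesgue_shift[OF fc fi] by blast+
  have h0: "(LINT x|lebesgue. h n x) = 0" for n
    unfolding h_def using shi fi by simp
  have hi: "integrable lebesgue (h n)" for n
    unfolding h_def using shi fi by auto
  have hb: "\<bar>h n x\<bar> \<le> M * indicator K2 x" for n x
  proof (cases "x \<in> K2")
    case True
    have "norm (f (x + t n *\<^sub>R b) - f (x + 0 *\<^sub>R b)) \<le> M * norm (t n - 0)"
    proof (rule differentiable_bound[where S="{0..t n}" and f'="\<lambda>s k. f' (x + s *\<^sub>R b) (k *\<^sub>R b)"])
      fix s assume "s \<in> {0..t n}"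
      show "((\<lambda>s. f (x + s *\<^sub>R b)) has_derivative (\<lambda>k. f' (x + s *\<^sub>R b) (k *\<^sub>R b))) (at s within {0..t n})"
        by (rule has_derivative_compose[OF _ f'])
          (auto intro!: derivative_eq_intros)
      interpret bounded_linear "f' (x + s *\<^sub>R b)" using f' has_derivative_bounded_linear by blast
      show "onorm (\<lambda>k. f' (x + s *\<^sub>R b) (k *\<^sub>R b)) \<le> M"
      proof (rule onorm_bound)
        fix k :: real
        show "norm (f' (x + s *\<^sub>R b) (k *\<^sub>R b)) \<le> M * norm k"
          using mult_left_mono[OF Mb[of "x + s *\<^sub>R b"] abs_ge_zero[of k]]
          by (simp add: scaleR abs_mult mult.commute)
      qed (use M in auto)
    qed (use t[of n] in auto)
    then show ?thesis using True t[of n] by (simp add: h_def field_simps)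
  next
    case False
    have "x \<in> K2" if "x \<in> K"
      using that unfolding K2_def by (intro CollectI exI[of _ x] exI[of _ 0]) auto
    then have "f x = 0" using False K by auto
    moreover have "x + t n *\<^sub>R b \<notin> K"
    proof
      assume "x + t n *\<^sub>R b \<in> K"
      moreover have "x = (x + t n *\<^sub>R b) + (- t n *\<^sub>R b)" by simp
      moreover have "- t n *\<^sub>R b \<in> cball 0 (norm b)" using t[of n] by (simp add: mult_left_le_one_le)
      ultimately have "x \<in> K2" unfolding K2_def by blast
      then show False using False by simp
    qed
    ultimately show ?thesis using False K by (simp add: h_def)
  qed
  have "(\<lambda>n. LINT x|lebesgue. h n x) \<longlonglongrightarrow> (LINT x|lebesgue. f' x b)"
  proof (rule integral_dominated_convergence[where w="\<lambda>x. M * indicator K2 x"])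
    show "(\<lambda>x. f' x b) \<in> borel_measurable lebesgue"
      by (rule borel_measurable_lebesgue_continuous[OF c])
    show "h n \<in> borel_measurable lebesgue" for n using hi[of n] by auto
    have "(\<lambda>n. h n x) \<longlonglongrightarrow> f' x b" for x
    proof -
      have "((\<lambda>s. f (x + s *\<^sub>R b)) has_derivative (\<lambda>k. f' x (k *\<^sub>R b))) (at 0)"
      proof (rule has_derivative_compose[of "\<lambda>s. x + s *\<^sub>R b" "\<lambda>k. k *\<^sub>R b" 0 UNIV f "f' x"])
        show "((\<lambda>s. x + s *\<^sub>R b) has_derivative (\<lambda>k. k *\<^sub>R b)) (at 0)" by (auto intro!: derivative_eq_intros)
      qed (use f'[of x] in simp)
      moreover have "(\<lambda>k. f' x (k *\<^sub>R b)) = (\<lambda>k. k * f' x b)"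
      proof -
        interpret bounded_linear "f' x" using f' has_derivative_bounded_linear by blast
        show ?thesis by (simp add: scaleR)
      qed
      ultimately have "((\<lambda>s. f (x + s *\<^sub>R b)) has_real_derivative f' x b) (at 0)"
        by (simp add: has_field_derivative_def mult_commute_abs)
      then have "((\<lambda>s. (f (x + s *\<^sub>R b) - f x) / s) \<longlongrightarrow> f' x b) (at 0)"
        by (simp add: DERIV_def)
      moreover have "filterlim t (at 0) sequentially"
        unfolding filterlim_at
      proof
        show "t \<longlonglongrightarrow> 0" unfolding t_def by real_asymp
        show "\<forall>\<^sub>F n in sequentially. t n \<in> UNIV \<and> t n \<noteq> 0" using t by (auto simp: less_imp_neq[symmetric])
      qed
      ultimately have "(\<lambda>n. (f (x + t n *\<^sub>R b) - f x) / t n) \<longlonglongrightarrow> f' x b"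
        by (rule filterlim_compose)
      then show ?thesis by (simp add: h_def)
    qed
    then show "AE x in lebesgue. (\<lambda>n. h n x) \<longlonglongrightarrow> f' x b" by simp
  qed (use hb K2i in auto)
  then have "(\<lambda>n. 0) \<longlonglongrightarrow> (LINT x|lebesgue. f' x b)" unfolding h0 .
  then show ?thesis by (simp add: LIMSEQ_const_iff)
qed

lemma integration_by_parts_C1_0:
  fixes A :: "'a::euclidean_space \<Rightarrow> 'a"
  assumes U: "open U" and A: "\<And>x. x \<in> U \<Longrightarrow> (A has_derivative A' x) (at x)"
    and cA: "\<And>b. b \<in> Basis \<Longrightarrow> continuous_on U (\<lambda>x. A' x b)"
    and w: "C1_0 U w Dw"
  shows "(LINT x:U|lebesgue. A x \<bullet> Dw x) = - (LINT x:U|lebesgue. (\<Sum>b\<in>Basis. A' x b \<bullet> b) * w x)"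
proof -
  define S where "S = closure {x. w x \<noteq> 0}"
  have S: "compact S" "S \<subseteq> U" using w by (auto simp: C1_0_def S_def)
  have oS: "open (- S)" unfolding S_def by (simp add: open_Compl)
  have gw: "GDERIV w x :> Dw x" and cDw: "continuous_on UNIV Dw" for x using w by (auto simp: C1_0_def)
  have w0: "w x = 0" if "x \<notin> S" for x using that closure_subset[of "{x. w x \<noteq> 0}"] by (auto simp: S_def)
  have Dw0: "Dw x = 0" if "x \<notin> S" for x
  proof -
    have "((\<lambda>x. 0::real) has_derivative (\<lambda>h. 0)) (at x)" by simp
    then have "(w has_derivative (\<lambda>h. 0)) (at x)"
      by (rule has_derivative_transform_within_open[OF _ oS]) (use that w0 in auto)
    from has_derivative_unique[OF this gw[of x, unfolded gderiv_def]] have "Dw x \<bullet> Dw x = 0" by metis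
    then show ?thesis by simp
  qed
  have cw: "continuous_on UNIV w"
    using gw GDERIV_imp_isCont continuous_at_imp_continuous_on by blast
  have cA0: "continuous_on U A"
    using A has_derivative_continuous by (intro continuous_at_imp_continuous_on) blast
  define d where "d b x = (if x \<in> S then (b \<bullet> Dw x) * (A x \<bullet> b) + w x * (A' x b \<bullet> b) else 0)" for b x
  have cd: "continuous_on UNIV (d b)" if "b \<in> Basis" for b
  proof -
    have "continuous_on U (d b)"
    proof (rule continuous_on_eq)
      show "continuous_on U (\<lambda>x. (b \<bullet> Dw x) * (A x \<bullet> b) + w x * (A' x b \<bullet> b))"
        by (intro continuous_intros continuous_on_subset[OF cDw] continuous_on_subset[OF cw] cA0 cA that) auto
    qed (auto simp: d_def w0 Dw0)
    moreover have "continuous_on (- S) (d b)" by (rule continuous_on_eq[of _ "\<lambda>x. 0"]) (auto simp: d_def)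
    ultimately have "continuous_on (U \<union> - S) (d b)" by (rule continuous_on_open_Un[OF U oS])
    moreover have "U \<union> - S = UNIV" using S by auto
    ultimately show ?thesis by simp
  qed
  have d0: "(LINT x|lebesgue. d b x) = 0" if b: "b \<in> Basis" for b
  proof -
    define f where "f x = (if x \<in> S then w x * (A x \<bullet> b) else 0)" for x
    define f' where "f' x h = (if x \<in> S then (h \<bullet> Dw x) * (A x \<bullet> b) + w x * (A' x h \<bullet> b) else 0)" for x h
    have der: "(f has_derivative f' x) (at x)" for x
    proof (cases "x \<in> U")
      case True
      have "((\<lambda>x. w x * (A x \<bullet> b)) has_derivative (\<lambda>h. w x * (A' x h \<bullet> b) + (h \<bullet> Dw x) * (A x \<bullet> b))) (at x)"
        using gw[of x] A[OF True] unfolding gderiv_def by (auto intro!: derivative_eq_intros)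
      then have "(f has_derivative (\<lambda>h. w x * (A' x h \<bullet> b) + (h \<bullet> Dw x) * (A x \<bullet> b))) (at x)"
        by (rule has_derivative_transform_within_open[OF _ U True]) (auto simp: f_def w0)
      moreover have "(\<lambda>h. w x * (A' x h \<bullet> b) + (h \<bullet> Dw x) * (A x \<bullet> b)) = f' x"
        by (auto simp: f'_def fun_eq_iff w0 Dw0)
      ultimately show ?thesis by simp
    next
      case False
      then have x: "x \<in> - S" using S by auto
      have "((\<lambda>x. 0::real) has_derivative (\<lambda>h. 0)) (at x)" by simp
      then have "(f has_derivative (\<lambda>h. 0)) (at x)"
        by (rule has_derivative_transform_within_open[OF _ oS x]) (auto simp: f_def)
      moreover have "f' x = (\<lambda>h. 0)" using x by (auto simp: f'_def)
      ultimately show ?thesis by simp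
    qed
    have e: "(\<lambda>x. f' x b) = d b" by (auto simp: f'_def d_def)
    have "(LINT x|lebesgue. f' x b) = 0"
    proof (rule integral_directional_derivative_eq_0[OF der _ S(1)])
      show "continuous_on UNIV (\<lambda>x. f' x b)" unfolding e by (rule cd[OF b])
    qed (simp add: f_def)
    then show ?thesis unfolding e .
  qed
  have di: "integrable lebesgue (d b)" if "b \<in> Basis" for b
    by (rule integrable_lebesgue_compact_support[OF S(1) continuous_on_subset[OF cd[OF that]]]) (auto simp: d_def)
  define I1 where "I1 x = (if x \<in> S then A x \<bullet> Dw x else 0)" for x
  define I2 where "I2 x = (if x \<in> S then (\<Sum>b\<in>Basis. A' x b \<bullet> b) * w x else 0)" for x
  have i1: "integrable lebesgue I1"
  proof (rule integrable_lebesgue_compact_support[OF S(1)])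
    show "continuous_on S I1"
      by (rule continuous_on_eq[where f="\<lambda>x. A x \<bullet> Dw x"])
        (auto simp: I1_def intro!: continuous_intros continuous_on_subset[OF cDw] continuous_on_subset[OF cA0 S(2)])
  qed (auto simp: I1_def)
  have i2: "integrable lebesgue I2"
  proof (rule integrable_lebesgue_compact_support[OF S(1)])
    show "continuous_on S I2"
      by (rule continuous_on_eq[where f="\<lambda>x. (\<Sum>b\<in>Basis. A' x b \<bullet> b) * w x"])
        (auto simp: I2_def intro!: continuous_intros continuous_on_subset[OF cw] continuous_on_subset[OF cA S(2)])
  qed (auto simp: I2_def)
  have "I1 x + I2 x = (\<Sum>b\<in>Basis. d b x)" for x
  proof (cases "x \<in> S")
    case True
    have "A x \<bullet> Dw x = (\<Sum>b\<in>Basis. (b \<bullet> Dw x) * (A x \<bullet> b))"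
      by (subst euclidean_inner) (simp add: mult.commute inner_commute)
    moreover have "(\<Sum>b\<in>Basis. A' x b \<bullet> b) * w x = (\<Sum>b\<in>Basis. w x * (A' x b \<bullet> b))"
      by (simp add: sum_distrib_left mult.commute)
    ultimately show ?thesis using True by (simp add: I1_def I2_def d_def sum.distrib)
  qed (simp add: I1_def I2_def d_def)
  then have "(LINT x|lebesgue. I1 x) + (LINT x|lebesgue. I2 x) = (LINT x|lebesgue. (\<Sum>b\<in>Basis. d b x))"
    using i1 i2 by (simp flip: Bochner_Integration.integral_add)
  also have "\<dots> = 0" using di d0 by simp
  finally have "(LINT x|lebesgue. I1 x) = - (LINT x|lebesgue. I2 x)" by simp
  moreover have "(LINT x:U|lebesgue. A x \<bullet> Dw x) = (LINT x|lebesgue. I1 x)"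
    unfolding set_lebesgue_integral_def using S(2)
    by (intro Bochner_Integration.integral_cong) (auto simp: I1_def indicator_def Dw0)
  moreover have "(LINT x:U|lebesgue. (\<Sum>b\<in>Basis. A' x b \<bullet> b) * w x) = (LINT x|lebesgue. I2 x)"
    unfolding set_lebesgue_integral_def using S(2)
    by (intro Bochner_Integration.integral_cong) (auto simp: I2_def indicator_def w0)
  ultimately show ?thesis by simp
qed

text \<open>
  The divergence of the radial field with profile \<open>g\<close> is the factor in the last integral. The
  derivative of \<open>g\<close> is given in the form \<open>r * m r\<close> with \<open>m\<close> continuous so that the derivative of the
  field is continuous at the center as well; there \<open>g 0 = 0\<close> makes the field differentiable.
\<close>

lemma radial_integration_by_parts:
  fixes y :: "'a::euclidean_space" and g m :: "real \<Rightarrow> real"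
  assumes U: "open U"
    and g: "\<And>x. x \<in> U \<Longrightarrow> x \<noteq> y \<Longrightarrow>
       (g has_real_derivative norm (x - y) * m (norm (x - y))) (at (norm (x - y)))"
    and cm: "continuous_on U (\<lambda>x. m (norm (x - y)))"
    and cg: "continuous_on U (\<lambda>x. g (norm (x - y)))" and g0: "y \<in> U \<Longrightarrow> g 0 = 0"
    and w: "C1_0 U w Dw"
  shows "(LINT x:U|lebesgue. (g (norm (x - y)) *\<^sub>R (x - y)) \<bullet> Dw x) =
    - (LINT x:U|lebesgue. ((norm (x - y))\<^sup>2 * m (norm (x - y)) + real DIM('a) * g (norm (x - y))) * w x)"
proof -
  define A' where "A' x h = (m (norm (x - y)) * ((x - y) \<bullet> h)) *\<^sub>R (x - y) + g (norm (x - y)) *\<^sub>R h" for x h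
  have A: "((\<lambda>x. g (norm (x - y)) *\<^sub>R (x - y)) has_derivative A' x) (at x)" if x: "x \<in> U" for x
  proof (cases "x = y")
    case False
    have n: "((\<lambda>x. norm (x - y)) has_derivative (\<lambda>h. h \<bullet> sgn (x - y))) (at x)"
    proof (rule has_derivative_compose[of "\<lambda>x. x - y" "\<lambda>h. h" x UNIV norm "\<lambda>h. h \<bullet> sgn (x - y)"])
      show "((\<lambda>x. x - y) has_derivative (\<lambda>h. h)) (at x)" by (auto intro!: derivative_eq_intros)
    qed (use has_derivative_norm[of "x - y"] False in simp)
    have "((\<lambda>x. g (norm (x - y))) has_derivative (\<lambda>h. (norm (x - y) * m (norm (x - y))) * (h \<bullet> sgn (x - y)))) (at x)"
      using has_derivative_compose[OF n g[OF x False, unfolded has_field_derivative_def]] .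
    then have "((\<lambda>x. g (norm (x - y)) *\<^sub>R (x - y)) has_derivative
      (\<lambda>h. g (norm (x - y)) *\<^sub>R h + ((norm (x - y) * m (norm (x - y))) * (h \<bullet> sgn (x - y))) *\<^sub>R (x - y))) (at x)"
      by (auto intro!: derivative_eq_intros)
    moreover have "(\<lambda>h. g (norm (x - y)) *\<^sub>R h + ((norm (x - y) * m (norm (x - y))) * (h \<bullet> sgn (x - y))) *\<^sub>R (x - y)) = A' x"
      using False by (auto simp: A'_def fun_eq_iff sgn_div_norm inner_commute)
    ultimately show ?thesis by simp
  next
    case True
    have z: "A' x = (\<lambda>h. 0)" using True g0 x by (auto simp: A'_def fun_eq_iff)
    have "isCont (\<lambda>x. g (norm (x - y))) y" using cg x True U continuous_on_eq_continuous_at by blast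
    then have lim: "((\<lambda>x. g (norm (x - y))) \<longlongrightarrow> 0) (at y)" using g0 x True by (simp add: isCont_def)
    show ?thesis unfolding z unfolding True has_derivative_within
    proof (intro conjI)
      have "((\<lambda>x. \<bar>g (norm (x - y))\<bar>) \<longlongrightarrow> 0) (at y)" using lim by (rule tendsto_rabs_zero)
      then have "((\<lambda>x. norm (g (norm (x - y)) *\<^sub>R sgn (x - y))) \<longlongrightarrow> 0) (at y)"
      proof (rule Lim_null_comparison[rotated])
        show "\<forall>\<^sub>F x in at y. norm (norm (g (norm (x - y)) *\<^sub>R sgn (x - y))) \<le> \<bar>g (norm (x - y))\<bar>"
          by (intro eventuallyI) (auto simp: norm_sgn)
      qed
      then have "((\<lambda>x. g (norm (x - y)) *\<^sub>R sgn (x - y)) \<longlongrightarrow> 0) (at y)" by (rule tendsto_norm_zero_cancel)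
      then show "((\<lambda>x. (1 / norm (x - y)) *\<^sub>R (g (norm (x - y)) *\<^sub>R (x - y) - (g (norm (y - y)) *\<^sub>R (y - y) + 0))) \<longlongrightarrow> 0) (at y)"
        by (simp add: sgn_div_norm divide_inverse mult.commute)
    qed auto
  qed
  have cA: "continuous_on U (\<lambda>x. A' x b)" for b
    unfolding A'_def by (intro continuous_intros cm cg)
  have div: "(\<Sum>b\<in>Basis. A' x b \<bullet> b) = (norm (x - y))\<^sup>2 * m (norm (x - y)) + real DIM('a) * g (norm (x - y))" for x
  proof -
    have "(\<Sum>b\<in>Basis. A' x b \<bullet> b) = (\<Sum>b\<in>Basis. m (norm (x - y)) * (((x - y) \<bullet> b) * ((x - y) \<bullet> b)) + g (norm (x - y)))"
      by (rule sum.cong) (auto simp: A'_def inner_add_left)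
    also have "\<dots> = m (norm (x - y)) * ((x - y) \<bullet> (x - y)) + real DIM('a) * g (norm (x - y))"
      unfolding euclidean_inner[of "x - y" "x - y"] by (simp add: sum.distrib sum_distrib_left)
    finally show ?thesis by (simp add: power2_norm_eq_inner)
  qed
  show ?thesis using integration_by_parts_C1_0[OF U A cA w] unfolding div by simp
qed

text \<open>
  The second comparison is \<open>weak_comparison\<close> for \<open>- u\<close> and \<open>- \<Phi>\<close>, since the flux is odd.
\<close>

lemma weak_solution_comparison:
  fixes u \<Phi> f :: "'a::euclidean_space \<Rightarrow> real"
  assumes \<Omega>: "open \<Omega>" "bounded \<Omega>" and p: "1 < p" and q: "0 \<le> q"
    and sol: "weak_solution \<Omega> p q lam0 u" and u: "continuous_on (closure \<Omega>) u"
    and lam: "lam0 \<in> borel_measurable (lebesgue_on \<Omega>)" "bounded (lam0 ` \<Omega>)"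
    and UK: "open U" "compact K" "K \<subseteq> U" "U \<subseteq> \<Omega>"
    and \<Phi>: "\<And>x. x \<in> U \<Longrightarrow> GDERIV \<Phi> x :> D\<Phi> x" "continuous_on U D\<Phi>"
    and flux: "\<And>w Dw. C1_0 U w Dw \<Longrightarrow>
        (LINT x:U|lebesgue. p_flux p (D\<Phi> x) \<bullet> Dw x) = - (LINT x:U|lebesgue. f x * w x)"
    and fc: "continuous_on U f" and \<delta>: "\<delta>' < \<delta>" and y: "y \<in> U"
  shows "\<lbrakk>\<And>x. x \<in> U - K \<Longrightarrow> u x \<le> \<Phi> x + \<delta>';
     \<And>x. x \<in> K \<Longrightarrow> u x > \<Phi> x + \<delta> \<Longrightarrow> f x < lam0 x * max (u x) 0 powr q\<rbrakk> \<Longrightarrow> u y \<le> \<Phi> y + \<delta>"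
    and "\<lbrakk>\<And>x. x \<in> U - K \<Longrightarrow> \<Phi> x \<le> u x + \<delta>';
     \<And>x. x \<in> K \<Longrightarrow> \<Phi> x > u x + \<delta> \<Longrightarrow> lam0 x * max (u x) 0 powr q < f x\<rbrakk> \<Longrightarrow> \<Phi> y \<le> u y + \<delta>"
proof -
  define F where "F x = lam0 x * max (u x) 0 powr q" for x
  obtain G where G: "W1p_loc \<Omega> p u G"
    and eq: "\<And>w Dw. C1_0 \<Omega> w Dw \<Longrightarrow> (\<And>x. 0 \<le> w x) \<Longrightarrow>
       (LINT x:\<Omega>|lebesgue. p_flux p (G x) \<bullet> Dw x) = - (LINT x:\<Omega>|lebesgue. F x * w x)"
    using sol unfolding weak_solution_def p_flux_def F_def by (auto simp: mult.assoc)
  have wg: "weak_gradient_on \<Omega> u G" and Gp: "locally_integrable_on \<Omega> (\<lambda>x. norm (G x) powr p)"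
    using G by (auto simp: W1p_loc_def)
  have u\<Omega>: "continuous_on \<Omega> u" using u closure_subset by (rule continuous_on_subset)
  have um: "u \<in> borel_measurable (lebesgue_on \<Omega>)"
    using u\<Omega> \<Omega> by (intro continuous_imp_measurable_on_sets_lebesgue) (auto simp: borel_open sets_completionI_sets)
  have Fm: "F \<in> borel_measurable (lebesgue_on \<Omega>)"
    unfolding F_def using lam(1) um by measurable
  obtain B1 where B1: "0 < B1" "\<And>x. x \<in> \<Omega> \<Longrightarrow> norm (lam0 x) \<le> B1" using lam(2) unfolding bounded_pos by auto
  obtain B2 where B2: "0 < B2" "\<And>x. x \<in> closure \<Omega> \<Longrightarrow> norm (u x) \<le> B2"
    using compact_bounded_above[OF _ u] \<Omega>(2) compact_closure by blast
  have Fb: "norm (F x) \<le> B1 * B2 powr q" if "x \<in> \<Omega>" for x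
  proof -
    have "\<bar>u x\<bar> \<le> B2" using B2(2)[of x] that closure_subset by auto
    then have "max (u x) 0 powr q \<le> B2 powr q" using q B2 by (intro powr_mono2) auto
    then show ?thesis unfolding F_def using B1(2)[OF that] by (auto simp: abs_mult intro!: mult_mono)
  qed
  then have Fbd: "bounded (F ` \<Omega>)" unfolding bounded_iff by auto
  show "u y \<le> \<Phi> y + \<delta>" if "\<And>x. x \<in> U - K \<Longrightarrow> u x \<le> \<Phi> x + \<delta>'"
    "\<And>x. x \<in> K \<Longrightarrow> u x > \<Phi> x + \<delta> \<Longrightarrow> f x < lam0 x * max (u x) 0 powr q"
    by (rule weak_comparison[OF \<Omega>(1) p u\<Omega> wg Gp eq Fm Fbd UK \<Phi> flux fc that(1) \<delta> _ y])
      (use that(2) in \<open>auto simp: F_def\<close>)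
  show "\<Phi> y \<le> u y + \<delta>" if bd: "\<And>x. x \<in> U - K \<Longrightarrow> \<Phi> x \<le> u x + \<delta>'"
    and strict: "\<And>x. x \<in> K \<Longrightarrow> \<Phi> x > u x + \<delta> \<Longrightarrow> lam0 x * max (u x) 0 powr q < f x"
  proof -
    have "- u y \<le> - \<Phi> y + \<delta>"
    proof (rule weak_comparison[OF \<Omega>(1) p, where u="\<lambda>x. - u x" and G="\<lambda>x. - G x" and F="\<lambda>x. - F x"
          and \<Phi>="\<lambda>x. - \<Phi> x" and D\<Phi>="\<lambda>x. - D\<Phi> x" and f="\<lambda>x. - f x" and U=U and K=K and \<delta>'=\<delta>'])
      show "continuous_on \<Omega> (\<lambda>x. - u x)" using u\<Omega> by (intro continuous_intros)
      show "weak_gradient_on \<Omega> (\<lambda>x. - u x) (\<lambda>x. - G x)"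
        using wg unfolding weak_gradient_on_def locally_integrable_on_def set_integrable_def set_lebesgue_integral_def
        by simp
      show "locally_integrable_on \<Omega> (\<lambda>x. norm (- G x) powr p)" using Gp by simp
      show "(LINT x:\<Omega>|lebesgue. p_flux p (- G x) \<bullet> Dw x) = - (LINT x:\<Omega>|lebesgue. - F x * w x)"
        if "C1_0 \<Omega> w Dw" "\<And>x. 0 \<le> w x" for w Dw
        using eq[OF that] unfolding set_lebesgue_integral_def by (simp add: p_flux_uminus)
      show "(\<lambda>x. - F x) \<in> borel_measurable (lebesgue_on \<Omega>)" using Fm by simp
      show "bounded ((\<lambda>x. - F x) ` \<Omega>)" using Fb unfolding bounded_iff by auto
      show "GDERIV (\<lambda>x. - \<Phi> x) x :> - D\<Phi> x" if "x \<in> U" for x using \<Phi>(1)[OF that] by (rule GDERIV_minus)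
      show "continuous_on U (\<lambda>x. - D\<Phi> x)" using \<Phi>(2) by (intro continuous_intros)
      show "(LINT x:U|lebesgue. p_flux p (- D\<Phi> x) \<bullet> Dw x) = - (LINT x:U|lebesgue. - f x * w x)"
        if "C1_0 U w Dw" for w Dw
        using flux[OF that] unfolding set_lebesgue_integral_def by (simp add: p_flux_uminus)
      show "continuous_on U (\<lambda>x. - f x)" using fc by (intro continuous_intros)
      show "- u x \<le> - \<Phi> x + \<delta>'" if "x \<in> U - K" for x using bd[OF that] by simp
      show "- f x < - F x" if "x \<in> K" "- u x > - \<Phi> x + \<delta>" for x
        using strict[OF that(1)] that(2) by (simp add: F_def)
    qed (use UK \<delta> y in auto)
    then show ?thesis by simp
  qed
qed

section \<open>Radial barriers for large exponents\<close>

text \<open>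
  As \<open>q p / p\<close> tends to \<open>ell\<close>, the exponent \<open>ell * (p - 2) - q p\<close> is of smaller order than \<open>p\<close>; the
  exponential is therefore at most \<open>exp (p * ln 2 / 2)\<close>, the square root of \<open>2 powr p\<close>, and cannot compensate
  the decay of \<open>(1 / 2) powr (p - 2)\<close>.
\<close>

lemma eventually_upper_barrier_small:
  fixes q :: "real \<Rightarrow> real"
  assumes q: "((\<lambda>p. q p / p) \<longlongrightarrow> ell) at_top" and "0 < \<mu>" "0 \<le> C1" "0 \<le> C2" "0 \<le> \<Lambda>"
  shows "\<forall>\<^sub>F p in at_top. (1 / 2) powr (p - 2) * (C1 * p + C2) * exp (\<bar>ell * (p - 2) - q p\<bar> * \<Lambda>) < \<mu>"
proof -
  have l2: "0 < ln (2::real)" by simp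
  have "((\<lambda>p::real. 1 / p) \<longlongrightarrow> 0) at_top" by real_asymp
  from tendsto_mult_right_zero[OF this, of "2 * ell"]
  have "((\<lambda>p. 2 * ell / p) \<longlongrightarrow> 0) at_top" by simp
  from tendsto_diff[OF tendsto_diff[OF tendsto_const this] q]
  have "((\<lambda>p. ell - 2 * ell / p - q p / p) \<longlongrightarrow> ell - 0 - ell) at_top" .
  then have "((\<lambda>p. \<bar>ell - 2 * ell / p - q p / p\<bar> * \<Lambda>) \<longlongrightarrow> \<bar>ell - 0 - ell\<bar> * \<Lambda>) at_top"
    by (rule tendsto_mult[OF tendsto_rabs tendsto_const])
  then have "\<forall>\<^sub>F p in at_top. \<bar>ell - 2 * ell / p - q p / p\<bar> * \<Lambda> < ln 2 / 2"
    by (rule order_tendstoD) simp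
  moreover have "((\<lambda>p::real. (1 / 2) powr (p - 2) * (C1 * p + C2) * exp (p * ln 2 / 2)) \<longlongrightarrow> 0) at_top"
  proof -
    define c :: real where "c = ln 2 / 2"
    have c: "0 < c" unfolding c_def by simp
    have e: "(1 / 2) powr (p - 2) * exp (p * ln 2 / 2) = 4 * exp (- (c * p))" for p :: real
    proof -
      have "(1 / 2) powr (p - 2) * exp (p * ln 2 / 2) = exp (ln 2 * 2) * exp (- (c * p))"
        by (simp add: powr_def ln_div c_def algebra_simps flip: exp_add)
      also have "exp (ln 2 * 2) = (2::real) powr 2" by (simp add: powr_def mult.commute)
      finally show ?thesis by simp
    qed
    have l0: "((\<lambda>p::real. exp (- (c * p))) \<longlongrightarrow> 0) at_top" using c by real_asymp
    have l1: "((\<lambda>p::real. p * exp (- (c * p))) \<longlongrightarrow> 0) at_top" using c by real_asymp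
    from tendsto_add[OF tendsto_mult_right_zero[OF l1, of "4 * C1"] tendsto_mult_right_zero[OF l0, of "4 * C2"]]
    have "((\<lambda>p::real. (C1 * p + C2) * (4 * exp (- (c * p)))) \<longlongrightarrow> 0) at_top" by (simp add: algebra_simps)
    moreover have "(\<lambda>p::real. (1 / 2) powr (p - 2) * (C1 * p + C2) * exp (p * ln 2 / 2)) =
      (\<lambda>p. (C1 * p + C2) * (4 * exp (- (c * p))))" unfolding e[symmetric] by (simp add: mult_ac)
    ultimately show ?thesis by simp
  qed
  then have "\<forall>\<^sub>F p::real in at_top. (1 / 2) powr (p - 2) * (C1 * p + C2) * exp (p * ln 2 / 2) < \<mu>"
    using \<open>0 < \<mu>\<close> by (rule order_tendstoD)
  ultimately show ?thesis using eventually_gt_at_top[of 0]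
  proof eventually_elim
    case (elim p)
    have "\<bar>ell * (p - 2) - q p\<bar> * \<Lambda> = p * (\<bar>ell - 2 * ell / p - q p / p\<bar> * \<Lambda>)"
    proof -
      have "ell * (p - 2) - q p = p * (ell - 2 * ell / p - q p / p)" using elim by (simp add: field_simps)
      then show ?thesis using elim by (simp add: abs_mult)
    qed
    also have "\<dots> \<le> p * (ln 2 / 2)" using elim by (intro mult_left_mono) auto
    finally have "exp (\<bar>ell * (p - 2) - q p\<bar> * \<Lambda>) \<le> exp (p * ln 2 / 2)" by simp
    then have "(1 / 2) powr (p - 2) * (C1 * p + C2) * exp (\<bar>ell * (p - 2) - q p\<bar> * \<Lambda>) \<le>
       (1 / 2) powr (p - 2) * (C1 * p + C2) * exp (p * ln 2 / 2)"
      using elim assms by (intro mult_left_mono) auto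
    then show ?case using elim by linarith
  qed
qed

text \<open>
  For \<open>B > 0\<close> the \<open>p\<close>-th roots of the two sides tend to \<open>M powr ell\<close> and to \<open>\<sigma>\<close>.
\<close>

lemma eventually_lower_barrier_large:
  fixes q :: "real \<Rightarrow> real"
  assumes q: "((\<lambda>p. q p / p) \<longlongrightarrow> ell) at_top" and M: "0 < M" "M powr ell < \<sigma>" and C: "0 < C"
  shows "\<forall>\<^sub>F p in at_top. B * M powr q p < C * \<sigma> powr (p - 2)"
proof -
  have \<sigma>: "0 < \<sigma>" using M(2) powr_ge_zero[of M ell] by linarith
  have "ell * ln M < ln \<sigma>" using M \<sigma> by (metis exp_less_cancel_iff exp_ln powr_def less_irrefl)
  then obtain d where d: "0 < d" "ell * ln M < ln \<sigma> - d" using dense[of 0 "ln \<sigma> - ell * ln M"] by auto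
  have "((\<lambda>p. q p / p * ln M) \<longlongrightarrow> ell * ln M) at_top" by (intro tendsto_intros q)
  then have "\<forall>\<^sub>F p in at_top. q p / p * ln M < ln \<sigma> - d" using d(2) by (rule order_tendstoD)
  moreover have "((\<lambda>p::real. \<bar>B\<bar> * (\<sigma> * \<sigma>) * exp (- (d * p))) \<longlongrightarrow> \<bar>B\<bar> * (\<sigma> * \<sigma>) * 0) at_top"
  proof (intro tendsto_intros)
    show "((\<lambda>p::real. exp (- (d * p))) \<longlongrightarrow> 0) at_top" using d(1) by real_asymp
  qed
  then have "\<forall>\<^sub>F p in at_top. \<bar>B\<bar> * (\<sigma> * \<sigma>) * exp (- (d * p)) < C" using C by (intro order_tendstoD) auto
  ultimately show ?thesis using eventually_gt_at_top[of 0]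
  proof eventually_elim
    case (elim p)
    have "q p * ln M \<le> p * (ln \<sigma> - d)" using elim by (simp add: field_simps)
    then have "M powr q p \<le> exp (p * (ln \<sigma> - d))" using M by (simp add: powr_def)
    also have "\<dots> = (\<sigma> * \<sigma> * exp (- (d * p))) * \<sigma> powr (p - 2)"
    proof -
      have "\<sigma> * \<sigma> * \<sigma> powr (p - 2) = \<sigma> powr p"
        using \<sigma> by (simp add: powr_diff power2_eq_square)
      also have "\<dots> = exp (p * ln \<sigma>)" using \<sigma> by (simp add: powr_def)
      finally have "(\<sigma> * \<sigma> * exp (- (d * p))) * \<sigma> powr (p - 2) = exp (p * ln \<sigma>) * exp (- (d * p))" by (simp add: algebra_simps)
      also have "\<dots> = exp (p * (ln \<sigma> - d))" by (simp flip: exp_add add: algebra_simps)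
      finally show ?thesis ..
    qed
    finally have "\<bar>B\<bar> * M powr q p \<le> \<bar>B\<bar> * ((\<sigma> * \<sigma> * exp (- (d * p))) * \<sigma> powr (p - 2))"
      by (intro mult_left_mono) auto
    also have "\<dots> = (\<bar>B\<bar> * (\<sigma> * \<sigma>) * exp (- (d * p))) * \<sigma> powr (p - 2)" by (simp add: algebra_simps)
    also have "\<dots> < C * \<sigma> powr (p - 2)" using elim \<sigma> by (intro mult_strict_right_mono) auto
    finally have "\<bar>B\<bar> * M powr q p < C * \<sigma> powr (p - 2)" .
    moreover have "B * M powr q p \<le> \<bar>B\<bar> * M powr q p" by (intro mult_right_mono) auto
    ultimately show ?case by linarith
  qed
qed

text \<open>
  The supersolution used for nondegeneracy is an even power of the distance to \<open>y\<close>, raised by a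
  constant \<open>\<kappa> > 0\<close>. An even power is smooth at the center, and its degree \<open>2 * n\<close> will be taken at least
  \<open>1 / (1 - ell)\<close>.
\<close>

lemma GDERIV_power_barrier:
  fixes y :: "'a::euclidean_space"
  assumes "1 \<le> n"
  shows "GDERIV (\<lambda>x. \<kappa> + A * ((norm (x - y))\<^sup>2) ^ n) x :> (2 * real n * A * ((norm (x - y))\<^sup>2) ^ (n - 1)) *\<^sub>R (x - y)"
  unfolding gderiv_def power2_norm_eq_inner
  by (auto intro!: derivative_eq_intros simp: inner_commute algebra_simps)

lemma p_flux_power_barrier:
  fixes z :: "'a::euclidean_space"
  assumes n: "1 \<le> n" and A: "0 < A" and p: "4 < p"
  defines "k \<equiv> (2 * real n - 1) * (p - 1) - 1"
  shows "p_flux p ((2 * real n * A * ((norm z)\<^sup>2) ^ (n - 1)) *\<^sub>R z) = ((2 * real n * A) powr (p - 1) * norm z powr k) *\<^sub>R z"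
proof (cases "z = 0")
  case False
  define c where "c = 2 * real n * A"
  have c: "0 < c" using n A by (simp add: c_def)
  have r: "0 < norm z" using False by simp
  have e1: "((norm z)\<^sup>2) ^ (n - 1) = norm z powr (2 * real n - 2)"
  proof -
    have "((norm z)\<^sup>2) ^ (n - 1) = norm z ^ (2 * (n - 1))" by (simp add: power_mult)
    also have "\<dots> = norm z powr real (2 * (n - 1))" by (rule powr_realpow[OF r, symmetric])
    also have "real (2 * (n - 1)) = 2 * real n - 2" using n by (simp add: of_nat_diff)
    finally show ?thesis .
  qed
  have e2: "norm ((c * norm z powr (2 * real n - 2)) *\<^sub>R z) = c * norm z powr (2 * real n - 1)"
  proof -
    have "norm ((c * norm z powr (2 * real n - 2)) *\<^sub>R z) = c * (norm z powr (2 * real n - 2) * norm z powr 1)"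
      using c by (simp add: abs_mult)
    also have "norm z powr (2 * real n - 2) * norm z powr 1 = norm z powr (2 * real n - 1)"
      by (subst powr_add[symmetric]) simp
    finally show ?thesis .
  qed
  have "p_flux p ((c * ((norm z)\<^sup>2) ^ (n - 1)) *\<^sub>R z) =
    ((c * norm z powr (2 * real n - 1)) powr (p - 2) * (c * norm z powr (2 * real n - 2))) *\<^sub>R z"
    unfolding p_flux_def e1 e2 by simp
  also have "(c * norm z powr (2 * real n - 1)) powr (p - 2) * (c * norm z powr (2 * real n - 2)) =
     (c powr (p - 2) * c powr 1) * (norm z powr ((2 * real n - 1) * (p - 2)) * norm z powr (2 * real n - 2))"
    using c r by (simp add: powr_mult powr_powr)
  also have "c powr (p - 2) * c powr 1 = c powr (p - 1)" by (subst powr_add[symmetric]) simp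
  also have "norm z powr ((2 * real n - 1) * (p - 2)) * norm z powr (2 * real n - 2) = norm z powr k"
    unfolding k_def by (subst powr_add[symmetric]) (simp add: algebra_simps)
  finally show ?thesis unfolding c_def .
qed simp

lemma power_barrier_flux:
  fixes y :: "'a::euclidean_space"
  assumes n: "1 \<le> n" and A: "0 < A" and p: "4 < p" and U: "open U" and w: "C1_0 U w Dw"
  defines "k \<equiv> (2 * real n - 1) * (p - 1) - 1"
  shows "(LINT x:U|lebesgue. p_flux p ((2 * real n * A * ((norm (x - y))\<^sup>2) ^ (n - 1)) *\<^sub>R (x - y)) \<bullet> Dw x) =
    - (LINT x:U|lebesgue. ((2 * real n * A) powr (p - 1) * (k + real DIM('a)) * norm (x - y) powr k) * w x)"
proof -
  define c where "c = (2 * real n * A) powr (p - 1)"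
  have k: "2 < k"
  proof -
    have "1 * (p - 1) \<le> (2 * real n - 1) * (p - 1)" using n p by (intro mult_right_mono) auto
    then have "p - 1 \<le> k + 1" unfolding k_def by simp
    then show ?thesis using p by linarith
  qed
  have "(LINT x:U|lebesgue. ((\<lambda>r. c * r powr k) (norm (x - y)) *\<^sub>R (x - y)) \<bullet> Dw x) =
    - (LINT x:U|lebesgue. ((norm (x - y))\<^sup>2 * (\<lambda>r. c * k * r powr (k - 2)) (norm (x - y))
        + real DIM('a) * (\<lambda>r. c * r powr k) (norm (x - y))) * w x)"
  proof (rule radial_integration_by_parts[OF U])
    show "((\<lambda>r. c * r powr k) has_real_derivative norm (x - y) * (\<lambda>r. c * k * r powr (k - 2)) (norm (x - y))) (at (norm (x - y)))"
      if "x \<noteq> y" for x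
    proof -
      have r: "0 < norm (x - y)" using that by simp
      have "((\<lambda>r. c * r powr k) has_real_derivative c * (k * norm (x - y) powr (k - 1))) (at (norm (x - y)))"
        using r by (intro DERIV_cmult has_real_derivative_powr)
      moreover have "norm (x - y) powr (k - 1) = norm (x - y) powr 1 * norm (x - y) powr (k - 2)"
        by (subst powr_add[symmetric]) simp
      ultimately show ?thesis by (simp add: algebra_simps)
    qed
    show "continuous_on U (\<lambda>x. (\<lambda>r. c * k * r powr (k - 2)) (norm (x - y)))"
      using k by (intro continuous_intros continuous_on_powr') auto
    show "continuous_on U (\<lambda>x. (\<lambda>r. c * r powr k) (norm (x - y)))"
      using k by (intro continuous_intros continuous_on_powr') auto
  qed (use w in auto)
  moreover have "(norm (x - y))\<^sup>2 * (c * k * norm (x - y) powr (k - 2)) + real DIM('a) * (c * norm (x - y) powr k) =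
    c * (k + real DIM('a)) * norm (x - y) powr k" for x
  proof -
    have "norm (x - y) powr k = (norm (x - y))\<^sup>2 * norm (x - y) powr (k - 2)"
    proof (cases "x = y")
      case False
      then have "norm (x - y) powr 2 * norm (x - y) powr (k - 2) = norm (x - y) powr k"
        by (subst powr_add[symmetric]) simp
      then show ?thesis using False by (simp add: powr_numeral)
    qed (use k in simp)
    then show ?thesis by (simp add: algebra_simps)
  qed
  ultimately show ?thesis unfolding p_flux_power_barrier[OF n A p] k_def[symmetric] c_def[symmetric] by simp
qed

text \<open>
  On the annulus \<open>U\<close> the subsolution used for positivity decreases along rays, is convex there, and
  is positive exactly at distances less than \<open>R\<close> from \<open>y\<close>. Its slope up to distance \<open>R\<close> lies between \<open>2 * B * R\<close> and
  \<open>4 * B * R\<close>. The annulus keeps away from \<open>y\<close>, where the function is not differentiable.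
\<close>

lemma quadratic_barrier:
  fixes y :: "'a::euclidean_space"
  assumes B: "0 < B" and p: "2 \<le> p" and R: "0 < R" and r0: "0 < r0"
    and U: "U = {x. r0 < norm (x - y) \<and> norm (x - y) < 3 * R / 2}"
  defines "D \<equiv> \<lambda>x. (- 2 * B * (2 * R - norm (x - y))) *\<^sub>R sgn (x - y)"
  defines "f \<equiv> \<lambda>x. (2 * B) powr (p - 1) * ((p - 1) * (2 * R - norm (x - y)) powr (p - 2)
      - (real DIM('a) - 1) * (2 * R - norm (x - y)) powr (p - 1) / norm (x - y))"
  shows "\<And>x. x \<in> U \<Longrightarrow> GDERIV (\<lambda>x. B * (2 * R - norm (x - y))\<^sup>2 - B * R\<^sup>2) x :> D x"
    and "continuous_on U D" and "continuous_on U f" and "open U"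
    and "\<And>w Dw. C1_0 U w Dw \<Longrightarrow> (LINT x:U|lebesgue. p_flux p (D x) \<bullet> Dw x) = - (LINT x:U|lebesgue. f x * w x)"
proof -
  have r: "0 < norm (x - y)" "0 < 2 * R - norm (x - y)" if "x \<in> U" for x
  proof -
    have "r0 < norm (x - y)" "norm (x - y) < 3 * R / 2" using that by (simp_all add: U)
    then show "0 < norm (x - y)" "0 < 2 * R - norm (x - y)" using r0 R by linarith+
  qed
  have "U = ball y (3 * R / 2) - cball y r0"
    unfolding U by (auto simp: dist_norm norm_minus_commute)
  then show op: "open U" by (simp add: open_Diff)
  show "GDERIV (\<lambda>x. B * (2 * R - norm (x - y))\<^sup>2 - B * R\<^sup>2) x :> D x" if "x \<in> U" for x
  proof -
    have "((\<lambda>x. norm (x - y)) has_derivative (\<lambda>h. h \<bullet> sgn (x - y))) (at x)"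
    proof (rule has_derivative_compose[of "\<lambda>x. x - y" "\<lambda>h. h" x UNIV norm "\<lambda>h. h \<bullet> sgn (x - y)"])
      show "((\<lambda>x. x - y) has_derivative (\<lambda>h. h)) (at x)" by (auto intro!: derivative_eq_intros)
    qed (use has_derivative_norm[of "x - y"] r(1)[OF that] in simp)
    then show ?thesis unfolding gderiv_def D_def
      by (auto intro!: derivative_eq_intros simp: algebra_simps)
  qed
  show "continuous_on U D" unfolding D_def sgn_div_norm
    using r by (intro continuous_intros) force
  show "continuous_on U f" unfolding f_def
    using r by (intro continuous_intros) force+
  define c where "c = (2 * B) powr (p - 1)"
  define g where "g s = - (c * ((2 * R - s) powr (p - 1) / s))" for s
  define m where "m s = c * ((p - 1) * (2 * R - s) powr (p - 2) / s\<^sup>2 + (2 * R - s) powr (p - 1) / s ^ 3)" for s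
  have "(LINT x:U|lebesgue. (g (norm (x - y)) *\<^sub>R (x - y)) \<bullet> Dw x) =
    - (LINT x:U|lebesgue. ((norm (x - y))\<^sup>2 * m (norm (x - y)) + real DIM('a) * g (norm (x - y))) * w x)"
    if w: "C1_0 U w Dw" for w Dw
  proof (rule radial_integration_by_parts[OF op _ _ _ _ w])
    show "(g has_real_derivative norm (x - y) * m (norm (x - y))) (at (norm (x - y)))" if "x \<in> U" for x
    proof -
      let ?s = "norm (x - y)"
      have "((\<lambda>s. (2 * R - s) powr (p - 1)) has_real_derivative (p - 1) * (2 * R - ?s) powr (p - 1 - 1) * (- 1)) (at ?s)"
        using r[OF that] by (intro DERIV_fun_powr derivative_eq_intros) auto
      from DERIV_minus[OF DERIV_cmult[OF DERIV_divide[OF this DERIV_ident], of c]]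
      have "(g has_real_derivative - (c * (((p - 1) * (2 * R - ?s) powr (p - 1 - 1) * (- 1) * ?s - (2 * R - ?s) powr (p - 1) * 1) / (?s * ?s)))) (at ?s)"
        unfolding g_def using r[OF that] by simp
      moreover have "- (c * (((p - 1) * (2 * R - ?s) powr (p - 1 - 1) * (- 1) * ?s - (2 * R - ?s) powr (p - 1) * 1) / (?s * ?s))) = ?s * m ?s"
        using r[OF that] by (simp add: m_def field_simps power2_eq_square power3_eq_cube)
      ultimately show ?thesis by simp
    qed
    show "continuous_on U (\<lambda>x. m (norm (x - y)))" unfolding m_def
      using r by (intro continuous_intros) force+
    show "continuous_on U (\<lambda>x. g (norm (x - y)))" unfolding g_def
      using r by (intro continuous_intros) force+
    show "y \<in> U \<Longrightarrow> g 0 = 0" using r(1)[of y] by simp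
  qed
  moreover have "(norm (x - y))\<^sup>2 * m (norm (x - y)) + real DIM('a) * g (norm (x - y)) = f x" if "x \<in> U" for x
    using r[OF that] unfolding m_def g_def f_def c_def[symmetric]
    by (simp add: field_simps power2_eq_square power3_eq_cube)
  moreover have "p_flux p (D x) = g (norm (x - y)) *\<^sub>R (x - y)" if "x \<in> U" for x
  proof -
    have n: "norm (D x) = 2 * B * (2 * R - norm (x - y))"
      using r[OF that] B by (simp add: D_def norm_sgn abs_mult)
    have "p_flux p (D x) = - (((2 * B * (2 * R - norm (x - y))) powr (p - 2) * (2 * B * (2 * R - norm (x - y))) powr 1) *\<^sub>R sgn (x - y))"
      unfolding p_flux_def n using r[OF that] B by (simp add: D_def)
    also have "(2 * B * (2 * R - norm (x - y))) powr (p - 2) * (2 * B * (2 * R - norm (x - y))) powr 1 = (2 * B * (2 * R - norm (x - y))) powr (p - 1)"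
      by (subst powr_add[symmetric]) simp
    also have "\<dots> = c * (2 * R - norm (x - y)) powr (p - 1)" using r[OF that] B by (simp add: powr_mult c_def)
    finally show ?thesis using r[OF that] by (simp add: g_def sgn_div_norm divide_inverse)
  qed
  moreover have Um: "U \<in> sets lebesgue" using op by (simp add: borel_open sets_completionI_sets)
  ultimately show "(LINT x:U|lebesgue. p_flux p (D x) \<bullet> Dw x) = - (LINT x:U|lebesgue. f x * w x)"
    if "C1_0 U w Dw" for w Dw
    using that set_lebesgue_integral_cong[OF Um, of "\<lambda>x. p_flux p (D x) \<bullet> Dw x" "\<lambda>x. (g (norm (x - y)) *\<^sub>R (x - y)) \<bullet> Dw x"]
      set_lebesgue_integral_cong[OF Um, of "\<lambda>x. f x * w x"
        "\<lambda>x. ((norm (x - y))\<^sup>2 * m (norm (x - y)) + real DIM('a) * g (norm (x - y))) * w x"]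
    by simp
qed

text \<open>
  The left-hand side is the \<open>p\<close>-Laplacian of the power barrier at distance \<open>s\<close> from its center. The
  equation for \<open>T\<close> says that \<open>4 * n * T / r = T powr ell\<close>, so at distance \<open>r\<close> the slope of
  \<open>A * (s^2)^n\<close> is half of its own power \<open>ell\<close>; for smaller distances this
  persists because \<open>2 * n * (1 - ell) \<ge> 1\<close>. Thus the slope of the barrier is at most half of its
  power \<open>ell\<close>, and the factor \<open>1 / 2\<close> raised to \<open>p - 2\<close> absorbs all other terms. The constant
  \<open>\<kappa>\<close> keeps the logarithm of the barrier bounded, which controls the mismatch between the
  exponents \<open>ell * (p - 2)\<close> and \<open>q\<close>.
\<close>

lemma upper_barrier_strict:
  fixes n :: nat and T r A ell \<kappa> s p q \<Lambda> \<mu> N :: real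
  assumes n: "1 \<le> n" "1 \<le> 2 * real n * (1 - ell)" and ell: "0 \<le> ell" "ell < 1"
    and T: "0 < T" "T powr (1 - ell) = r / (4 * real n)" and r: "0 < r" and A: "A = T / (r\<^sup>2) ^ n"
    and \<kappa>: "0 < \<kappa>" and s: "0 \<le> s" "s \<le> r" and p: "4 < p" and N: "0 \<le> N" and \<mu>: "0 < \<mu>"
    and \<Lambda>: "\<bar>ln \<kappa>\<bar> \<le> \<Lambda>" "\<bar>ln (\<kappa> + T)\<bar> \<le> \<Lambda>"
    and small: "(1 / 2) powr (p - 2) * ((2 * real n * A * (r\<^sup>2) ^ (n - 1) * (2 * real n)) * p + 2 * real n * A * (r\<^sup>2) ^ (n - 1) * N)
       * exp (\<bar>ell * (p - 2) - q\<bar> * \<Lambda>) < \<mu>"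
  defines "k \<equiv> (2 * real n - 1) * (p - 1) - 1"
  shows "(2 * real n * A) powr (p - 1) * (k + N) * s powr k < \<mu> * (\<kappa> + A * (s\<^sup>2) ^ n) powr q"
proof (cases "s = 0")
  case True
  have e: "A * (s\<^sup>2) ^ n = 0" using True n(1) by (cases n) auto
  have "0 < (\<kappa> + A * (s\<^sup>2) ^ n) powr q" unfolding e using \<kappa> by simp
  then show ?thesis using True \<mu> by simp
next
  case False
  then have s0: "0 < s" using s by simp
  have A0: "0 < A" unfolding A using T r by simp
  define \<Phi> where "\<Phi> = \<kappa> + A * (s\<^sup>2) ^ n"
  define c where "c = 2 * real n * A"
  have c0: "0 < c" using n A0 by (simp add: c_def)
  define t where "t = s / r"
  have t: "0 < t" "t \<le> 1" using s0 s r by (auto simp: t_def)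
  have As: "A * (s\<^sup>2) ^ n = T * t powr (2 * real n)"
  proof -
    have "t powr (2 * real n) = t powr real (2 * n)" by simp
    also have "\<dots> = t ^ (2 * n)" by (rule powr_realpow[OF t(1)])
    also have "\<dots> = (s\<^sup>2) ^ n / (r\<^sup>2) ^ n" unfolding t_def by (simp add: power_divide power_mult)
    finally show ?thesis unfolding A by simp
  qed
  have \<Phi>: "\<kappa> \<le> \<Phi>" "\<Phi> \<le> \<kappa> + T" "0 < \<Phi>"
  proof -
    have "t powr (2 * real n) \<le> 1" using t by (intro powr_le1) auto
    then have "T * t powr (2 * real n) \<le> T" using T by (simp add: mult_left_le)
    then show "\<Phi> \<le> \<kappa> + T" unfolding \<Phi>_def As by simp
    show "\<kappa> \<le> \<Phi>" unfolding \<Phi>_def As using T by simp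
    then show "0 < \<Phi>" using \<kappa> by simp
  qed
  have TT: "4 * real n * T / r = T powr ell"
  proof -
    have "T = T powr ell * T powr (1 - ell)" using T by (subst powr_add[symmetric]) simp
    then show ?thesis unfolding T(2) using n r by (simp add: field_simps)
  qed
  have D: "c * s powr (2 * real n - 1) \<le> \<Phi> powr ell / 2"
  proof -
    have "s powr (2 * real n - 1) = (r * t) powr (2 * real n - 1)" using r by (simp add: t_def)
    also have "\<dots> = r powr (2 * real n - 1) * t powr (2 * real n - 1)" using r t by (simp add: powr_mult)
    also have "r powr (2 * real n - 1) = (r\<^sup>2) ^ n / r"
    proof -
      have "r powr (2 * real n - 1) = r powr real (2 * n) / r powr 1" by (subst powr_diff[symmetric]) simp
      also have "r powr real (2 * n) = r ^ (2 * n)" by (rule powr_realpow[OF r])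
      finally show ?thesis using r by (simp add: power_mult)
    qed
    finally have "c * s powr (2 * real n - 1) = (4 * real n * T / r) * t powr (2 * real n - 1) / 2"
      unfolding c_def A using r by (simp add: field_simps)
    also have "\<dots> = T powr ell * t powr (2 * real n - 1) / 2" unfolding TT ..
    also have "t powr (2 * real n - 1) \<le> t powr (2 * real n * ell)"
      using t n(2) by (intro powr_mono') (auto simp: algebra_simps)
    then have "T powr ell * t powr (2 * real n - 1) / 2 \<le> T powr ell * t powr (2 * real n * ell) / 2"
      by (intro divide_right_mono mult_left_mono) auto
    also have "T powr ell * t powr (2 * real n * ell) = (T * t powr (2 * real n)) powr ell"
      using T t by (simp add: powr_mult powr_powr)
    also have "(T * t powr (2 * real n)) powr ell \<le> \<Phi> powr ell"
      unfolding \<Phi>_def As using \<kappa> T ell by (intro powr_mono2) auto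
    finally show ?thesis by simp
  qed
  have "c powr (p - 1) * s powr k = (c * s powr (2 * real n - 1)) powr (p - 2) * (c * s powr (2 * real n - 2))"
  proof -
    have "(c * s powr (2 * real n - 1)) powr (p - 2) * (c * s powr (2 * real n - 2)) =
     (c powr (p - 2) * c powr 1) * (s powr ((2 * real n - 1) * (p - 2)) * s powr (2 * real n - 2))"
      using c0 s0 by (simp add: powr_mult powr_powr)
    also have "c powr (p - 2) * c powr 1 = c powr (p - 1)" by (subst powr_add[symmetric]) simp
    also have "s powr ((2 * real n - 1) * (p - 2)) * s powr (2 * real n - 2) = s powr k"
      unfolding k_def by (subst powr_add[symmetric]) (simp add: algebra_simps)
    finally show ?thesis ..
  qed
  also have "\<dots> \<le> ((1 / 2) powr (p - 2) * \<Phi> powr (ell * (p - 2))) * (c * (r\<^sup>2) ^ (n - 1))"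
  proof (rule mult_mono)
    have "(c * s powr (2 * real n - 1)) powr (p - 2) \<le> (\<Phi> powr ell / 2) powr (p - 2)"
      using D c0 p by (intro powr_mono2) auto
    also have "\<dots> = (1 / 2) powr (p - 2) * \<Phi> powr (ell * (p - 2))"
      using \<Phi> by (simp add: powr_mult[symmetric] powr_powr[symmetric])
    finally show "(c * s powr (2 * real n - 1)) powr (p - 2) \<le> (1 / 2) powr (p - 2) * \<Phi> powr (ell * (p - 2))" .
    have "s powr (2 * real n - 2) = s powr real (2 * (n - 1))" using n by (simp add: of_nat_diff algebra_simps)
    also have "\<dots> = s ^ (2 * (n - 1))" by (rule powr_realpow[OF s0])
    also have "\<dots> = (s\<^sup>2) ^ (n - 1)" by (simp add: power_mult)
    also have "\<dots> \<le> (r\<^sup>2) ^ (n - 1)" using s by (intro power_mono) auto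
    finally show "c * s powr (2 * real n - 2) \<le> c * (r\<^sup>2) ^ (n - 1)" using c0 by simp
  qed (use c0 in auto)
  finally have 1: "c powr (p - 1) * s powr k \<le> ((1 / 2) powr (p - 2) * \<Phi> powr (ell * (p - 2))) * (c * (r\<^sup>2) ^ (n - 1))" .
  have k: "0 \<le> k" "k \<le> 2 * real n * p"
  proof -
    have "1 * (p - 1) \<le> (2 * real n - 1) * (p - 1)" using n p by (intro mult_right_mono) auto
    then have "p - 1 \<le> k + 1" unfolding k_def by simp
    then show "0 \<le> k" using p by linarith
    have "(2 * real n - 1) * (p - 1) \<le> 2 * real n * p" using n p by (intro mult_mono) auto
    then show "k \<le> 2 * real n * p" unfolding k_def by simp
  qed
  have 2: "\<Phi> powr (ell * (p - 2)) \<le> \<Phi> powr q * exp (\<bar>ell * (p - 2) - q\<bar> * \<Lambda>)"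
  proof -
    have "\<bar>ln \<Phi>\<bar> \<le> \<Lambda>"
    proof -
      have "ln \<kappa> \<le> ln \<Phi>" "ln \<Phi> \<le> ln (\<kappa> + T)" using \<Phi> \<kappa> T by auto
      then show ?thesis using \<Lambda> by linarith
    qed
    then have "\<bar>ell * (p - 2) - q\<bar> * \<bar>ln \<Phi>\<bar> \<le> \<bar>ell * (p - 2) - q\<bar> * \<Lambda>"
      by (intro mult_left_mono) auto
    then have "(ell * (p - 2) - q) * ln \<Phi> \<le> \<bar>ell * (p - 2) - q\<bar> * \<Lambda>"
      using abs_ge_self[of "(ell * (p - 2) - q) * ln \<Phi>"] unfolding abs_mult by linarith
    then have "\<Phi> powr (ell * (p - 2) - q) \<le> exp (\<bar>ell * (p - 2) - q\<bar> * \<Lambda>)"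
      using \<Phi> by (simp add: powr_def)
    then have "\<Phi> powr q * \<Phi> powr (ell * (p - 2) - q) \<le> \<Phi> powr q * exp (\<bar>ell * (p - 2) - q\<bar> * \<Lambda>)"
      by (intro mult_left_mono) auto
    then show ?thesis by (simp flip: powr_add)
  qed
  have "c powr (p - 1) * (k + N) * s powr k = (c powr (p - 1) * s powr k) * (k + N)" by simp
  also have "\<dots> \<le> (((1 / 2) powr (p - 2) * (\<Phi> powr q * exp (\<bar>ell * (p - 2) - q\<bar> * \<Lambda>))) * (c * (r\<^sup>2) ^ (n - 1))) * (2 * real n * p + N)"
  proof (rule mult_mono)
    show "c powr (p - 1) * s powr k \<le> ((1 / 2) powr (p - 2) * (\<Phi> powr q * exp (\<bar>ell * (p - 2) - q\<bar> * \<Lambda>))) * (c * (r\<^sup>2) ^ (n - 1))"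
      using 1 by (rule order_trans) (intro mult_right_mono mult_left_mono 2; use c0 r in auto)
  qed (use k N c0 r in auto)
  also have "\<dots> = \<Phi> powr q * ((1 / 2) powr (p - 2) * ((2 * real n * A * (r\<^sup>2) ^ (n - 1) * (2 * real n)) * p + 2 * real n * A * (r\<^sup>2) ^ (n - 1) * N)
       * exp (\<bar>ell * (p - 2) - q\<bar> * \<Lambda>))"
    unfolding c_def by (simp add: algebra_simps)
  also have "\<dots> < \<Phi> powr q * \<mu>" using small \<Phi> by (intro mult_strict_left_mono) auto
  finally show ?thesis unfolding c_def \<Phi>_def by (simp add: mult.commute)
qed

text \<open>
  The right-hand side is the \<open>p\<close>-Laplacian of the quadratic barrier at distance \<open>s\<close>. For \<open>p\<close> large in
  terms of \<open>R / r1\<close> the radial convexity dominates the curvature term, which has the opposite sign.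
\<close>

lemma lower_barrier_flux_bound:
  fixes B R r1 s p N :: real
  assumes "0 < B" "0 < r1" "r1 \<le> s" "s \<le> R" "2 \<le> p" "0 \<le> N" and large: "2 + N * (2 * R / r1) \<le> p"
  shows "2 * B * (2 * B * R) powr (p - 2) \<le>
    (2 * B) powr (p - 1) * ((p - 1) * (2 * R - s) powr (p - 2) - (N - 1) * (2 * R - s) powr (p - 1) / s)"
proof -
  have s: "0 < s" "0 < 2 * R - s" "R \<le> 2 * R - s" "0 < R" using assms by auto
  have e: "(2 * R - s) powr (p - 1) = (2 * R - s) powr (p - 2) * (2 * R - s)"
  proof -
    have "(2 * R - s) powr (p - 1) = (2 * R - s) powr (p - 2) * (2 * R - s) powr 1" by (subst powr_add[symmetric]) simp
    then show ?thesis using s by simp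
  qed
  have "(N - 1) * ((2 * R - s) / s) \<le> N * (2 * R / r1)"
  proof -
    have "(2 * R - s) / s \<le> 2 * R / r1" using s assms by (intro frac_le) auto
    moreover have "0 \<le> (2 * R - s) / s" using s by simp
    ultimately have "N * ((2 * R - s) / s) \<le> N * (2 * R / r1)" using assms by (intro mult_left_mono) auto
    moreover have "(N - 1) * ((2 * R - s) / s) \<le> N * ((2 * R - s) / s)" using \<open>0 \<le> (2 * R - s) / s\<close> by (intro mult_right_mono) auto
    ultimately show ?thesis by linarith
  qed
  then have b: "1 \<le> (p - 1) - (N - 1) * ((2 * R - s) / s)" using large by linarith
  have "2 * B * (2 * B * R) powr (p - 2) = (2 * B) powr 1 * (2 * B) powr (p - 2) * R powr (p - 2)"
    using assms s by (simp add: powr_mult)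
  also have "(2 * B) powr 1 * (2 * B) powr (p - 2) = (2 * B) powr (p - 1)" by (subst powr_add[symmetric]) simp
  also have "(2 * B) powr (p - 1) * R powr (p - 2) \<le> (2 * B) powr (p - 1) * ((2 * R - s) powr (p - 2) * 1)"
    using s assms by (intro mult_left_mono) (auto intro!: powr_mono2)
  also have "\<dots> \<le> (2 * B) powr (p - 1) * ((2 * R - s) powr (p - 2) * ((p - 1) - (N - 1) * ((2 * R - s) / s)))"
    using b by (intro mult_left_mono) auto
  also have "(2 * R - s) powr (p - 2) * ((p - 1) - (N - 1) * ((2 * R - s) / s)) = (p - 1) * (2 * R - s) powr (p - 2) - (N - 1) * (2 * R - s) powr (p - 1) / s"
  proof -
    have "P * ((p - 1) - (N - 1) * (d / s)) = (p - 1) * P - (N - 1) * (P * d) / s" for P d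
      using s(1) by (simp add: field_simps)
    then show ?thesis unfolding e .
  qed
  finally show ?thesis .
qed

section \<open>Growth and positivity of limit solutions\<close>

text \<open>
  Every property that holds for all large exponents holds at some exponent whose solution is uniformly
  as close to the limit as desired. One such exponent suffices for each comparison.
\<close>

lemma limit_solution_approximant:
  assumes lim: "limit_solution \<Omega> lam0 g q v" and ev: "\<forall>\<^sub>F p in at_top. Q p" and e: "0 < e"
  obtains p w where "2 \<le> p" "Q p" "dirichlet_solution \<Omega> p (q p) lam0 g w" "\<And>x. x \<in> closure \<Omega> \<Longrightarrow> \<bar>w x - v x\<bar> < e"
proof -
  obtain u P where u: "\<And>p. 2 \<le> p \<Longrightarrow> dirichlet_solution \<Omega> p (q p) lam0 g (u p)"
    and P: "\<And>j. 2 \<le> P j" "filterlim P at_top sequentially"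
    and ul: "uniform_limit (closure \<Omega>) (\<lambda>j. u (P j)) v sequentially"
    using lim unfolding limit_solution_def by blast
  have "\<forall>\<^sub>F j in sequentially. Q (P j)" using ev P(2) by (simp add: filterlim_iff)
  moreover have "\<forall>\<^sub>F j in sequentially. \<forall>x\<in>closure \<Omega>. dist (u (P j) x) (v x) < e"
    using ul e by (rule uniform_limitD)
  ultimately have "\<forall>\<^sub>F j in sequentially. Q (P j) \<and> (\<forall>x\<in>closure \<Omega>. dist (u (P j) x) (v x) < e)"
    by (rule eventually_conj)
  then obtain j where "Q (P j)" "\<forall>x\<in>closure \<Omega>. dist (u (P j) x) (v x) < e"
    by (auto dest: eventually_happens)
  then show thesis using that[of "P j" "u (P j)"] u[OF P(1)] P(1) by (auto simp: dist_real_def)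
qed

lemma limit_solution_continuous:
  assumes "limit_solution \<Omega> lam0 g q v"
  shows "continuous_on (closure \<Omega>) v"
proof -
  obtain u P where u: "\<And>p. 2 \<le> p \<Longrightarrow> dirichlet_solution \<Omega> p (q p) lam0 g (u p)"
    and P: "\<And>j. 2 \<le> P j" and ul: "uniform_limit (closure \<Omega>) (\<lambda>j. u (P j)) v sequentially"
    using assms unfolding limit_solution_def by blast
  show ?thesis
    by (rule uniform_limit_theorem[OF _ ul]) (use u P in \<open>auto simp: dirichlet_solution_def\<close>)
qed

text \<open>
  If \<open>v\<close> stayed below \<open>T / 4^n\<close> in the ball, the solution for some large \<open>p\<close> would stay below the power
  barrier of height \<open>T\<close> at distances from \<open>r / 2\<close> to \<open>r\<close>, hence in the whole ball, and its value at
  the center would be at most \<open>\<kappa>\<close>. With \<open>\<kappa> = v y / 4\<close> this is a contradiction. Working on half the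
  radius costs the factor \<open>4^n\<close>.
\<close>

lemma limit_solution_nondegenerate:
  fixes y :: "'a::euclidean_space"
  assumes \<Omega>: "open \<Omega>" "bounded \<Omega>" and ad: "admissible_data \<Omega> ell lam0 g q" and lim: "limit_solution \<Omega> lam0 g q v"
    and ell: "0 \<le> ell" "ell < 1" and n: "1 \<le> n" "1 \<le> 2 * real n * (1 - ell)"
    and y: "0 < v y" and r: "0 < r" "ball y r \<subseteq> \<Omega>"
  shows "\<exists>x\<in>ball y r. (r / (4 * real n)) powr (1 / (1 - ell)) / 4 ^ n \<le> v x"
proof (rule ccontr)
  define T where "T = (r / (4 * real n)) powr (1 / (1 - ell))"
  assume "\<not> (\<exists>x\<in>ball y r. (r / (4 * real n)) powr (1 / (1 - ell)) / 4 ^ n \<le> v x)"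
  then have neg: "v x < T / 4 ^ n" if "x \<in> ball y r" for x using that by (auto simp: T_def not_le)
  have T: "0 < T" "T powr (1 - ell) = r / (4 * real n)"
    using r n ell by (auto simp: T_def powr_powr)
  have y\<Omega>: "y \<in> \<Omega>" using r by auto
  define \<mu> where "\<mu> = (INF x\<in>\<Omega>. lam0 x)"
  have \<mu>: "0 < \<mu>" "\<And>x. x \<in> \<Omega> \<Longrightarrow> \<mu> \<le> lam0 x"
    using ad unfolding admissible_data_def \<mu>_def by (auto intro!: cINF_lower bounded_imp_bdd_below)
  define \<kappa> where "\<kappa> = v y / 4"
  have \<kappa>: "0 < \<kappa>" using y by (simp add: \<kappa>_def)
  define A where "A = T / (r\<^sup>2) ^ n"
  have A: "0 < A" using T r by (simp add: A_def)
  define \<Lambda> where "\<Lambda> = max \<bar>ln \<kappa>\<bar> \<bar>ln (\<kappa> + T)\<bar>"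
  define N where "N = real DIM('a)"
  define C1 where "C1 = 2 * real n * A * (r\<^sup>2) ^ (n - 1) * (2 * real n)"
  define C2 where "C2 = 2 * real n * A * (r\<^sup>2) ^ (n - 1) * N"
  have "\<forall>\<^sub>F p in at_top. (1 / 2) powr (p - 2) * (C1 * p + C2) * exp (\<bar>ell * (p - 2) - q p\<bar> * \<Lambda>) < \<mu>"
    by (rule eventually_upper_barrier_small)
      (use ad \<mu> A r in \<open>auto simp: admissible_data_def C1_def C2_def N_def \<Lambda>_def\<close>)
  then have ev: "\<forall>\<^sub>F p in at_top. 4 < p \<and> (1 / 2) powr (p - 2) * (C1 * p + C2) * exp (\<bar>ell * (p - 2) - q p\<bar> * \<Lambda>) < \<mu>"
    using eventually_gt_at_top[of 4] by eventually_elim auto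
  have "0 < \<kappa> / 2" using \<kappa> by simp
  then obtain p w where pw: "4 < p" "(1 / 2) powr (p - 2) * (C1 * p + C2) * exp (\<bar>ell * (p - 2) - q p\<bar> * \<Lambda>) < \<mu>"
    "dirichlet_solution \<Omega> p (q p) lam0 g w" "\<And>x. x \<in> closure \<Omega> \<Longrightarrow> \<bar>w x - v x\<bar> < \<kappa> / 2"
    using limit_solution_approximant[OF lim ev] by blast
  have q0: "0 \<le> q p" using ad pw(1) by (auto simp: admissible_data_def)
  define k where "k = (2 * real n - 1) * (p - 1) - 1"
  define f where "f x = (2 * real n * A) powr (p - 1) * (k + N) * norm (x - y) powr k" for x
  define \<Phi> where "\<Phi> x = \<kappa> + A * ((norm (x - y))\<^sup>2) ^ n" for x
  have k: "0 < k"
  proof -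
    have "1 * (p - 1) \<le> (2 * real n - 1) * (p - 1)" using n pw by (intro mult_right_mono) auto
    then have "p - 1 \<le> k + 1" unfolding k_def by simp
    then show ?thesis using pw by linarith
  qed
  have "w y \<le> \<Phi> y + 0"
  proof (rule weak_solution_comparison(1)[OF \<Omega> _ q0, where U="ball y r" and K="cball y (r / 2)" and \<delta>'="- \<kappa> / 2" and f=f
        and D\<Phi>="\<lambda>x. (2 * real n * A * ((norm (x - y))\<^sup>2) ^ (n - 1)) *\<^sub>R (x - y)"])
    show "GDERIV \<Phi> x :> (2 * real n * A * ((norm (x - y))\<^sup>2) ^ (n - 1)) *\<^sub>R (x - y)" for x
      unfolding \<Phi>_def by (rule GDERIV_power_barrier[OF n(1)])
    show "(LINT x:ball y r|lebesgue. p_flux p ((2 * real n * A * ((norm (x - y))\<^sup>2) ^ (n - 1)) *\<^sub>R (x - y)) \<bullet> Dw x) =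
      - (LINT x:ball y r|lebesgue. f x * w x)" if "C1_0 (ball y r) w Dw" for w Dw
      unfolding f_def k_def N_def by (rule power_barrier_flux[OF n(1) A pw(1) open_ball that])
    show "continuous_on (ball y r) f"
      unfolding f_def using k by (intro continuous_intros continuous_on_powr') auto
    show "w x \<le> \<Phi> x + - \<kappa> / 2" if x: "x \<in> ball y r - cball y (r / 2)" for x
    proof -
      have "x \<in> closure \<Omega>" using x r closure_subset by blast
      then have "w x \<le> v x + \<kappa> / 2" using pw(4)[of x] by linarith
      moreover have "v x < T / 4 ^ n" using neg x by auto
      moreover have "T / 4 ^ n \<le> A * ((norm (x - y))\<^sup>2) ^ n"
      proof -
        have "r / 2 \<le> norm (x - y)" using x by (auto simp: dist_norm norm_minus_commute)
        then have "((r / 2)\<^sup>2) ^ n \<le> ((norm (x - y))\<^sup>2) ^ n" using r by (intro power_mono) auto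
        then have "A * ((r / 2)\<^sup>2) ^ n \<le> A * ((norm (x - y))\<^sup>2) ^ n" using A by simp
        moreover have "A * ((r / 2)\<^sup>2) ^ n = T / 4 ^ n" unfolding A_def using r by (simp add: power_divide)
        ultimately show ?thesis by simp
      qed
      ultimately show ?thesis unfolding \<Phi>_def by linarith
    qed
    show "f x < lam0 x * max (w x) 0 powr q p" if x: "x \<in> cball y (r / 2)" "\<Phi> x + 0 < w x" for x
    proof -
      have n: "norm (x - y) \<le> r" using x r by (auto simp: dist_norm norm_minus_commute)
      have x\<Omega>: "x \<in> \<Omega>" using x r by (auto simp: subset_iff)
      have "f x < \<mu> * \<Phi> x powr q p"
        unfolding f_def k_def \<Phi>_def
        by (rule upper_barrier_strict[OF assms(7,8) ell T r(1) A_def \<kappa> norm_ge_zero n pw(1) _ \<mu>(1), where \<Lambda>=\<Lambda>])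
          (use pw(2) in \<open>auto simp: \<Lambda>_def N_def C1_def C2_def\<close>)
      also have "\<dots> \<le> lam0 x * max (w x) 0 powr q p"
      proof (rule mult_mono)
        have "0 \<le> \<Phi> x" unfolding \<Phi>_def using \<kappa> A by simp
        then show "\<Phi> x powr q p \<le> max (w x) 0 powr q p" using x q0 by (intro powr_mono2) auto
        show "0 \<le> lam0 x" using \<mu>(1) \<mu>(2)[OF x\<Omega>] by simp
      qed (use \<mu> x\<Omega> in auto)
      finally show ?thesis .
    qed
    show "continuous_on (ball y r) (\<lambda>x. (2 * real n * A * ((norm (x - y))\<^sup>2) ^ (n - 1)) *\<^sub>R (x - y))"
      by (intro continuous_intros)
  qed (use pw ad r \<kappa> in \<open>auto simp: dirichlet_solution_def admissible_data_def\<close>)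
  moreover have "(0::real) ^ n = 0" using n(1) by (simp add: power_0_left)
  ultimately have "w y \<le> \<kappa>" by (simp add: \<Phi>_def)
  moreover have "\<bar>w y - v y\<bar> < \<kappa> / 2" using pw(4)[of y] y\<Omega> closure_subset by blast
  ultimately show False using \<kappa> by (simp add: \<kappa>_def)
qed

text \<open>
  The quadratic barrier has height \<open>M\<close> at \<open>y\<close> and vanishes at distance \<open>R\<close>. Its slope is at least
  \<open>2 * B * R = 4 / 3 * M powr ell\<close>, which exceeds \<open>M powr ell\<close>, so it is a strict subsolution on every
  annulus around \<open>y\<close> for large \<open>p\<close>. Near \<open>y\<close> the solution lies above \<open>M\<close> by continuity of \<open>v\<close>. This keeps
  the singularity of the barrier out of the comparison, and the radius \<open>r1\<close> where it happens does not enter \<open>R\<close>.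
\<close>

lemma limit_solution_positive_near:
  fixes y :: "'a::euclidean_space"
  assumes \<Omega>: "open \<Omega>" "bounded \<Omega>" and ad: "admissible_data \<Omega> ell lam0 g q" and lim: "limit_solution \<Omega> lam0 g q v"
    and M: "0 < M" "M < v y" and R: "R = M powr (1 - ell) / 2" "cball y (3 * R / 2) \<subseteq> \<Omega>"
    and x: "x \<in> ball y R"
  shows "0 < v x"
proof -
  have "0 < M powr (1 - ell)" using M by simp
  then have R0: "0 < R" using R(1) by linarith
  define B where "B = M / (3 * R\<^sup>2)"
  have B: "0 < B" "3 * B * R\<^sup>2 = M" using M R0 by (auto simp: B_def)
  have \<sigma>: "M powr ell < 2 * B * R"
  proof -
    have "M powr ell * M powr (1 - ell) = M" using M by (subst powr_add[symmetric]) simp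
    moreover have "M powr (1 - ell) = 2 * R" using R(1) by simp
    ultimately have X: "M powr ell * (2 * R) = M" by (simp only:)
    have "2 * B * R = 2 * M / (3 * R)" unfolding B_def using R0 by (simp add: power2_eq_square)
    also have "\<dots> = 2 * (M powr ell * (2 * R)) / (3 * R)" by (simp only: X)
    also have "\<dots> = 4 / 3 * M powr ell" using R0 by simp
    finally have "2 * B * R = 4 / 3 * M powr ell" .
    moreover have "0 < M powr ell" using M by simp
    ultimately show ?thesis by linarith
  qed
  have cl: "z \<in> closure \<Omega>" if "z \<in> \<Omega>" for z using that closure_subset by blast
  have cR: "cball y s \<subseteq> \<Omega>" if "s \<le> 3 * R / 2" for s using R(2) that by (auto simp: subset_iff)
  define \<xi> where "\<xi> = (v y - M) / 2"
  have \<xi>: "0 < \<xi>" using M by (simp add: \<xi>_def)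
  have "y \<in> \<Omega>" using R(2) R0 by auto
  moreover have "continuous_on \<Omega> v" using limit_solution_continuous[OF lim] closure_subset by (rule continuous_on_subset)
  ultimately have "isCont v y" using \<Omega>(1) continuous_on_eq_continuous_at by blast
  then obtain d where d: "0 < d" "\<And>z. dist z y < d \<Longrightarrow> dist (v z) (v y) < \<xi>"
    using \<xi> unfolding continuous_at_eps_delta by (auto simp: dist_norm)
  define r1 where "r1 = min (d / 2) (R / 2)"
  have r1: "0 < r1" "r1 < d" "r1 \<le> R / 2" using d R0 by (auto simp: r1_def)
  have near: "M + \<xi> < v z" if "norm (z - y) \<le> r1" for z
  proof -
    have "\<bar>v z - v y\<bar> < \<xi>" using d(2)[of z] that r1 by (simp add: dist_norm)
    moreover have "v y = M + 2 * \<xi>" by (simp add: \<xi>_def field_simps)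
    ultimately show ?thesis by linarith
  qed
  define \<phi> where "\<phi> z = B * (2 * R - norm (z - y))\<^sup>2 - B * R\<^sup>2" for z
  show ?thesis
  proof (cases "norm (x - y) \<le> r1")
    case True
    then show ?thesis using near[OF True] M \<xi> by linarith
  next
    case False
    have xR: "norm (x - y) < R" using x by (simp add: dist_norm norm_minus_commute)
    have "R\<^sup>2 < (2 * R - norm (x - y))\<^sup>2" using xR R0 by (intro power_strict_mono) auto
    then have "0 < \<phi> x" unfolding \<phi>_def using B by simp
    define \<delta> where "\<delta> = \<phi> x / 2"
    have \<delta>: "0 < \<delta>" using \<open>0 < \<phi> x\<close> by (simp add: \<delta>_def)
    define N where "N = real DIM('a)"
    obtain L where L: "0 < L" "\<And>z. z \<in> \<Omega> \<Longrightarrow> norm (lam0 z) \<le> L"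
      using ad unfolding admissible_data_def bounded_pos by auto
    have "\<forall>\<^sub>F p in at_top. L * M powr q p < 2 * B * (2 * B * R) powr (p - 2)"
      by (rule eventually_lower_barrier_large) (use ad M \<sigma> B in \<open>auto simp: admissible_data_def\<close>)
    then have ev: "\<forall>\<^sub>F p in at_top. 2 + N * (2 * R / r1) \<le> p \<and> L * M powr q p < 2 * B * (2 * B * R) powr (p - 2)"
      using eventually_ge_at_top[of "2 + N * (2 * R / r1)"] by eventually_elim auto
    have "0 < min \<xi> (\<delta> / 2)" using \<xi> \<delta> by simp
    then obtain p w where pw: "2 \<le> p" "2 + N * (2 * R / r1) \<le> p" "L * M powr q p < 2 * B * (2 * B * R) powr (p - 2)"
      "dirichlet_solution \<Omega> p (q p) lam0 g w" "\<And>z. z \<in> closure \<Omega> \<Longrightarrow> \<bar>w z - v z\<bar> < min \<xi> (\<delta> / 2)"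
      using limit_solution_approximant[OF lim ev] by blast
    have q0: "0 \<le> q p" using ad pw(1) by (auto simp: admissible_data_def)
    define U where "U = {z. r1 / 2 < norm (z - y) \<and> norm (z - y) < 3 * R / 2}"
    define K where "K = {z. r1 \<le> norm (z - y) \<and> norm (z - y) \<le> R}"
    have U\<Omega>: "U \<subseteq> \<Omega>" using R(2) unfolding U_def by (auto simp: subset_iff dist_norm norm_minus_commute)
    have KU: "K \<subseteq> U" unfolding K_def U_def using r1 R0 by auto
    have Kc: "compact K"
    proof -
      have "K = cball y R - ball y r1" unfolding K_def by (auto simp: dist_norm norm_minus_commute)
      then show ?thesis by (simp add: compact_diff)
    qed
    have r12: "0 < r1 / 2" using r1 by simp
    note cone = quadratic_barrier[OF B(1) pw(1) R0 r12 U_def]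
    have wnn: "0 \<le> w z" if "z \<in> \<Omega>" for z using pw(4) cl[OF that] by (auto simp: dirichlet_solution_def)
    have \<phi>M: "\<phi> z \<le> M" if "norm (z - y) \<le> 2 * R" for z
    proof -
      have "(2 * R - norm (z - y))\<^sup>2 \<le> (2 * R)\<^sup>2" using that by (intro power_mono) auto
      then have "B * (2 * R - norm (z - y))\<^sup>2 \<le> B * (2 * R)\<^sup>2" using B by simp
      then show ?thesis unfolding \<phi>_def using B(2) by (simp add: power2_eq_square)
    qed
    have "\<phi> x \<le> w x + \<delta>"
    proof (rule weak_solution_comparison(2)[OF \<Omega> _ q0, where U=U and K=K and \<delta>'=0,
          OF _ _ _ _ _ _ Kc KU U\<Omega> _ cone(2) cone(5) cone(3)])
      show "GDERIV \<phi> z :> (- 2 * B * (2 * R - norm (z - y))) *\<^sub>R sgn (z - y)" if "z \<in> U" for z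
        unfolding \<phi>_def by (rule cone(1)[OF that])
      show "\<phi> z \<le> w z + 0" if z: "z \<in> U - K" for z
      proof -
        have z\<Omega>: "z \<in> \<Omega>" using z U\<Omega> by auto
        from z consider "norm (z - y) < r1" | "R < norm (z - y)" "norm (z - y) < 3 * R / 2"
          unfolding U_def K_def by auto
        then show ?thesis
        proof cases
          case 1
          have "\<phi> z \<le> M" by (rule \<phi>M) (use 1 r1 R0 in linarith)
          moreover have "M + \<xi> < v z" by (rule near) (use 1 in simp)
          moreover have "\<bar>w z - v z\<bar> < \<xi>" using pw(5)[OF cl[OF z\<Omega>]] by simp
          ultimately show ?thesis by linarith
        next
          case 2
          have "(2 * R - norm (z - y))\<^sup>2 \<le> R\<^sup>2" using 2 R0 by (intro power_mono) auto
          then have "B * (2 * R - norm (z - y))\<^sup>2 \<le> B * R\<^sup>2" using B by simp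
          then show ?thesis unfolding \<phi>_def using wnn[OF z\<Omega>] by linarith
        qed
      qed
      show "lam0 z * max (w z) 0 powr q p < (2 * B) powr (p - 1) * ((p - 1) * (2 * R - norm (z - y)) powr (p - 2)
          - (real DIM('a) - 1) * (2 * R - norm (z - y)) powr (p - 1) / norm (z - y))"
        if z: "z \<in> K" "w z + \<delta> < \<phi> z" for z
      proof -
        have z\<Omega>: "z \<in> \<Omega>" using z KU U\<Omega> by auto
        have zK: "r1 \<le> norm (z - y)" "norm (z - y) \<le> R" using z by (auto simp: K_def)
        have "w z \<le> M" using \<phi>M[of z] zK z R0 \<delta> by linarith
        then have "max (w z) 0 powr q p \<le> M powr q p" using q0 M by (intro powr_mono2) auto
        moreover have "lam0 z \<le> L" using L(2)[OF z\<Omega>] by simp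
        ultimately have "lam0 z * max (w z) 0 powr q p \<le> L * M powr q p"
          using L(1) by (intro mult_mono) auto
        also note pw(3)
        also note lower_barrier_flux_bound[OF B(1) r1(1) zK pw(1) _ pw(2)]
        finally show ?thesis unfolding N_def by simp
      qed
      show "x \<in> U" using False xR R0 r1 by (auto simp: U_def)
    qed (use cone(4) pw ad \<delta> in \<open>auto simp: dirichlet_solution_def admissible_data_def\<close>)
    then have "\<delta> \<le> w x" by (simp add: \<delta>_def)
    moreover have "x \<in> closure \<Omega>" by (rule cl) (use cR[of R] x R0 in auto)
    then have "\<bar>w x - v x\<bar> < \<delta> / 2" using pw(5) by simp
    ultimately show ?thesis using \<delta> by linarith
  qed
qed

section \<open>Positive density of the positivity set\<close>

theorem corollary4p5:
  fixes ell :: real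
  assumes "0 \<le> ell" and "ell < 1"
  shows "\<exists>\<theta>>0. \<forall>(lam0 :: real ^ 'n \<Rightarrow> real) g q u_inf x\<^sub>0 \<rho>.
    admissible_data (ball 0 1) ell lam0 g q \<longrightarrow>
    limit_solution (ball 0 1) lam0 g q u_inf \<longrightarrow>
    x\<^sub>0 \<in> frontier (positivity_set (ball 0 1) u_inf) \<inter> ball 0 (1 / 2) \<longrightarrow>
    0 < \<rho> \<longrightarrow> \<rho> < 1 / 2 \<longrightarrow>
    measure lebesgue (ball x\<^sub>0 \<rho> \<inter> positivity_set (ball 0 1) u_inf) \<ge> \<theta> * \<rho> ^ CARD('n)"
proof -
  obtain n0 :: nat where n0: "1 / (2 * (1 - ell)) \<le> real n0" using real_arch_simple by blast
  define n where "n = max 1 n0"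
  have n: "1 \<le> n" "1 \<le> 2 * real n * (1 - ell)"
  proof -
    have "1 / (2 * (1 - ell)) \<le> real n" using n0 unfolding n_def by simp
    then show "1 \<le> 2 * real n * (1 - ell)" using assms by (simp add: field_simps)
  qed (simp add: n_def)
  \<comment> \<open>The ratio \<open>R / \<rho>\<close> for the radius \<open>R = M powr (1 - ell) / 2\<close> that belongs to \<open>M = T / (2 * 4 ^ n)\<close> and \<open>r = \<rho> / 4\<close> below.\<close>
  define c where "c = 1 / (32 * real n * (2 * 4 ^ n) powr (1 - ell))"
  have big: "1 \<le> (2 * 4 ^ n :: real) powr (1 - ell)"
  proof -
    have "(1::real) \<le> 4 ^ n" by simp
    then show ?thesis using assms by (intro ge_one_powr_ge_zero) linarith+
  qed
  have c: "0 < c" "c \<le> 1 / 32"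
  proof -
    have "1 * 1 \<le> real n * (2 * 4 ^ n) powr (1 - ell)" using n big by (intro mult_mono) auto
    then show "0 < c" "c \<le> 1 / 32" unfolding c_def by (auto simp: field_simps)
  qed
  define V where "V = unit_ball_vol (real CARD('n))"
  have V: "0 < V" by (simp add: V_def)
  show ?thesis
  proof (intro exI[of _ "V * c ^ CARD('n)"] conjI allI impI)
    show "0 < V * c ^ CARD('n)" using V c by simp
    fix lam0 :: "real ^ 'n \<Rightarrow> real" and g q u_inf x0 and \<rho> :: real
    let ?\<Omega> = "ball (0 :: real ^ 'n) 1" and ?P = "positivity_set (ball (0 :: real ^ 'n) 1) u_inf"
    assume ad: "admissible_data ?\<Omega> ell lam0 g q" and lim: "limit_solution ?\<Omega> lam0 g q u_inf"
      and x0: "x0 \<in> frontier ?P \<inter> ball 0 (1 / 2)" and \<rho>: "0 < \<rho>" "\<rho> < 1 / 2"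
    have sub: "ball x0 \<rho> \<subseteq> ?\<Omega>"
    proof
      fix z assume "z \<in> ball x0 \<rho>"
      then show "z \<in> ?\<Omega>" using x0 \<rho> norm_triangle_sub[of z x0] by (auto simp: dist_norm norm_minus_commute)
    qed
    define r where "r = \<rho> / 4"
    have r: "0 < r" using \<rho> by (simp add: r_def)
    have "x0 \<in> closure ?P" using x0 by (auto simp: frontier_def)
    then obtain x where x: "x \<in> ?P" "dist x x0 < r" using r closure_approachable by blast
    have xP: "0 < u_inf x" using x by (simp add: positivity_set_def)
    have bs: "ball x r \<subseteq> ball x0 (\<rho> / 2)"
    proof
      fix z assume "z \<in> ball x r"
      then show "z \<in> ball x0 (\<rho> / 2)" using x(2) dist_triangle[of x0 z x] by (simp add: r_def dist_commute)
    qed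
    also have "\<dots> \<subseteq> ?\<Omega>" using sub \<rho> by (auto simp: subset_iff)
    finally have brO: "ball x r \<subseteq> ?\<Omega>" .
    define T where "T = (r / (4 * real n)) powr (1 / (1 - ell))"
    obtain y where y: "y \<in> ball x r" "T / 4 ^ n \<le> u_inf y"
      using limit_solution_nondegenerate[OF open_ball bounded_ball ad lim assms n xP r brO] unfolding T_def by blast
    have yx0: "dist x0 y < \<rho> / 2" using bs y(1) by auto
    have T: "0 < T" "T powr (1 - ell) = r / (4 * real n)"
      using r n assms by (auto simp: T_def powr_powr)
    define M where "M = T / (2 * 4 ^ n)"
    have M: "0 < M" "M < u_inf y"
    proof -
      show "0 < M" using T by (simp add: M_def)
      have "M < T / 4 ^ n" using T by (simp add: M_def field_simps)
      then show "M < u_inf y" using y by simp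
    qed
    define R where "R = M powr (1 - ell) / 2"
    have R: "R = c * \<rho>"
    proof -
      have "M powr (1 - ell) = T powr (1 - ell) / (2 * 4 ^ n) powr (1 - ell)"
        unfolding M_def by (rule powr_divide)
      then show ?thesis unfolding R_def T(2) c_def r_def by simp
    qed
    have R1: "R \<le> \<rho> / 32" using c \<rho> unfolding R by simp
    have cb: "cball y (3 * R / 2) \<subseteq> ?\<Omega>" "ball y R \<subseteq> ball x0 \<rho>"
    proof -
      have "z \<in> ball x0 \<rho>" if "dist y z \<le> 3 * R / 2" for z
        using that yx0 R1 \<rho> dist_triangle[of x0 z y] by simp
      then have 1: "cball y (3 * R / 2) \<subseteq> ball x0 \<rho>" by auto
      then show "cball y (3 * R / 2) \<subseteq> ?\<Omega>" using sub by blast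
      have "0 \<le> R" using R c \<rho> by simp
      then have "ball y R \<subseteq> cball y (3 * R / 2)" by auto
      then show "ball y R \<subseteq> ball x0 \<rho>" using 1 by blast
    qed
    have inc: "ball y R \<subseteq> ball x0 \<rho> \<inter> ?P"
      using limit_solution_positive_near[OF open_ball bounded_ball ad lim M R_def cb(1)] cb(2) sub
      by (auto simp: positivity_set_def)
    have "continuous_on ?\<Omega> u_inf" using limit_solution_continuous[OF lim] closure_subset by (rule continuous_on_subset)
    then have "open ?P"
      using continuous_open_preimage[OF _ open_ball open_greaterThan[of 0], of 0 1 u_inf]
      by (simp add: positivity_set_def vimage_def Int_def)
    then have "open (ball x0 \<rho> \<inter> ?P)" by auto
    then have lm: "ball x0 \<rho> \<inter> ?P \<in> lmeasurable"
      by (intro bounded_set_imp_lmeasurable) (auto simp: borel_open sets_completionI_sets)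
    have "V * c ^ CARD('n) * \<rho> ^ CARD('n) = measure lebesgue (ball y R)"
    proof -
      have "0 \<le> R" using R c \<rho> by simp
      then have "measure lebesgue (ball y R) = V * R ^ CARD('n)" by (simp add: content_ball V_def)
      then show ?thesis unfolding R by (simp add: power_mult_distrib)
    qed
    also have "\<dots> \<le> measure lebesgue (ball x0 \<rho> \<inter> ?P)"
      by (rule measure_mono_fmeasurable[OF inc _ lm]) auto
    finally show "V * c ^ CARD('n) * \<rho> ^ CARD('n) \<le> measure lebesgue (ball x0 \<rho> \<inter> ?P)" .
  qed
qed

end
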